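(* Let $\mathfrak{g}$ be a finite-dimensional simple Lie algebra over $\mathbb{C}$ with root system $\Delta$, positive system $\Delta^+$, simple roots $\Pi$ and highest root $\theta$, and consider the extra-special $\mathbb{Z}$-grading defined by $\theta^\vee$, whose degree-one part is $\Delta(1)=\{\alpha\in\Delta^+:(\alpha,\theta^\vee)=1\}$. Then the Panyushev complement $\mathfrak{X}$ acting on the lower ideals of $\Delta(1)$ has exactly $|\Pi_l|$ orbits, and each orbit has exactly $h-1$ elements. Furthermore, if $h$ is even, then each orbit contains exactly one lower ideal $I$ with $|I|=h^*-2$.
   Context: An extra-special $\mathbb{Z}$-grading is one of the form $\mathfrak{g}=\mathfrak{g}(-2)\oplus\mathfrak{g}(-1)\oplus\mathfrak{g}(0)\oplus\mathfrak{g}(1)\oplus\mathfrak{g}(2)$ with $\dim\mathfrak{g}(2)=1$; up to conjugation it is unique and can be taken with $\Delta(2)=\{\theta\}$, defined by $\theta^\vee=2\theta/(\theta,\theta)$. $\Delta(1)$ is ordered by $\alpha\le\beta$ iff $\beta-\alpha$ is a nonnegative integer combination of simple roots. For a finite poset $P$ and a lower ideal $I$ (a downward-closed subset), the Panyushev complement (reverse operator) is $\mathfrak{X}(I):=\{y\in P: y\le x\text{ for some }x\in\min(P\setminus I)\}$; equivalently on antichains $A$, $\mathfrak{X}(A)=\min(P\setminus I(A))$ where $I(A)$ is the lower ideal generated by $A$. $h=\mathrm{ht}(\theta)+1$ is the Coxeter number, $h^*$ is the height of $\theta^\vee$ in the dual root system $\Delta^\vee$ (w.r.t. simple coroots), and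 $\Pi_l$ is the set of long simple roots (in simply-laced types all roots count as long).
   Formalization: Here h* is the dual Coxeter number, i.e. one plus the height of θ^∨ in the dual root system, rather than that height itself; with the height itself the last claim fails (for A_1, Δ(1) is empty, h = 2 and h*−2 would be −1). *)

theory Defs
  imports "HOL-Analysis.Analysis"
begin

definition refl_root :: "'a::euclidean_space \<Rightarrow> 'a \<Rightarrow> 'a" where
  "refl_root \<alpha> \<beta> = \<beta> - (2 * (\<beta> \<bullet> \<alpha>) / (\<alpha> \<bullet> \<alpha>)) *\<^sub>R \<alpha>"

definition coroot :: "'a::euclidean_space \<Rightarrow> 'a" where
  "coroot \<alpha> = (2 / (\<alpha> \<bullet> \<alpha>)) *\<^sub>R \<alpha>"

definition root_system :: "'a::euclidean_space set \<Rightarrow> bool" where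
  "root_system R \<longleftrightarrow> finite R \<and> 0 \<notin> R \<and> span R = UNIV
     \<and> (\<forall>\<alpha>\<in>R. \<forall>\<beta>\<in>R. refl_root \<alpha> \<beta> \<in> R)
     \<and> (\<forall>\<alpha>\<in>R. \<forall>\<beta>\<in>R. 2 * (\<beta> \<bullet> \<alpha>) / (\<alpha> \<bullet> \<alpha>) \<in> \<int>)
     \<and> (\<forall>\<alpha>\<in>R. \<forall>c::real. c *\<^sub>R \<alpha> \<in> R \<longrightarrow> c = 1 \<or> c = -1)"

definition irreducible_rs :: "'a::euclidean_space set \<Rightarrow> bool" where
  "irreducible_rs R \<longleftrightarrow> \<not> (\<exists>R1 R2. R1 \<noteq> {} \<and> R2 \<noteq> {} \<and> R1 \<union> R2 = R \<and> R1 \<inter> R2 = {}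
                                \<and> (\<forall>x\<in>R1. \<forall>y\<in>R2. x \<bullet> y = 0))"

definition nonneg_comb :: "'a::euclidean_space set \<Rightarrow> 'a \<Rightarrow> bool" where
  "nonneg_comb B v \<longleftrightarrow> (\<exists>c::'a \<Rightarrow> nat. v = (\<Sum>\<gamma>\<in>B. real (c \<gamma>) *\<^sub>R \<gamma>))"

definition simple_system :: "'a::euclidean_space set \<Rightarrow> 'a set \<Rightarrow> bool" where
  "simple_system R S \<longleftrightarrow> S \<subseteq> R \<and> independent S
     \<and> (\<forall>\<beta>\<in>R. nonneg_comb S \<beta> \<or> nonneg_comb S (- \<beta>))"

definition pos_roots :: "'a::euclidean_space set \<Rightarrow> 'a set \<Rightarrow> 'a set" where
  "pos_roots R S = {\<beta>\<in>R. nonneg_comb S \<beta>}"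

definition root_le :: "'a::euclidean_space set \<Rightarrow> 'a \<Rightarrow> 'a \<Rightarrow> bool" where
  "root_le S \<alpha> \<beta> \<longleftrightarrow> nonneg_comb S (\<beta> - \<alpha>)"

definition coeffs :: "'a::euclidean_space set \<Rightarrow> 'a \<Rightarrow> ('a \<Rightarrow> int)" where
  "coeffs B v = (THE c. (\<forall>\<gamma>. \<gamma> \<notin> B \<longrightarrow> c \<gamma> = 0) \<and> v = (\<Sum>\<gamma>\<in>B. of_int (c \<gamma>) *\<^sub>R \<gamma>))"

definition height :: "'a::euclidean_space set \<Rightarrow> 'a \<Rightarrow> int" where
  "height S v = (\<Sum>\<gamma>\<in>S. coeffs S v \<gamma>)"

definition coheight :: "'a::euclidean_space set \<Rightarrow> 'a \<Rightarrow> int" where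
  "coheight S v = (\<Sum>\<gamma>\<in>coroot ` S. coeffs (coroot ` S) v \<gamma>)"

definition highest_root :: "'a::euclidean_space set \<Rightarrow> 'a set \<Rightarrow> 'a" where
  "highest_root R S = (THE \<theta>. \<theta> \<in> R \<and> (\<forall>\<alpha>\<in>R. root_le S \<alpha> \<theta>))"

definition coxeter_number :: "'a::euclidean_space set \<Rightarrow> 'a set \<Rightarrow> int" where
  "coxeter_number R S = height S (highest_root R S) + 1"

definition dual_coxeter_number :: "'a::euclidean_space set \<Rightarrow> 'a set \<Rightarrow> int" where
  "dual_coxeter_number R S = coheight S (coroot (highest_root R S)) + 1"

definition delta1 :: "'a::euclidean_space set \<Rightarrow> 'a set \<Rightarrow> 'a set" where
  "delta1 R S = {\<alpha>\<in>pos_roots R S. \<alpha> \<bullet> coroot (highest_root R S) = 1}"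

definition long_simple :: "'a::euclidean_space set \<Rightarrow> 'a set \<Rightarrow> 'a set" where
  "long_simple R S = {\<alpha>\<in>S. \<forall>\<beta>\<in>R. \<beta> \<bullet> \<beta> \<le> \<alpha> \<bullet> \<alpha>}"

definition lower_ideals :: "'b set \<Rightarrow> ('b \<Rightarrow> 'b \<Rightarrow> bool) \<Rightarrow> 'b set set" where
  "lower_ideals P le = {I. I \<subseteq> P \<and> (\<forall>x\<in>I. \<forall>y\<in>P. le y x \<longrightarrow> y \<in> I)}"

definition minimal_elems :: "'b set \<Rightarrow> ('b \<Rightarrow> 'b \<Rightarrow> bool) \<Rightarrow> 'b set" where
  "minimal_elems A le = {x\<in>A. \<forall>y\<in>A. le y x \<longrightarrow> y = x}"

definition panyushev :: "'b set \<Rightarrow> ('b \<Rightarrow> 'b \<Rightarrow> bool) \<Rightarrow> 'b set \<Rightarrow> 'b set" where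
  "panyushev P le I = {y\<in>P. \<exists>x\<in>minimal_elems (P - I) le. le y x}"

definition orbit_of :: "('c \<Rightarrow> 'c) \<Rightarrow> 'c \<Rightarrow> 'c set" where
  "orbit_of f x = {(f ^^ k) x | k. True}"

definition orbits :: "('c \<Rightarrow> 'c) \<Rightarrow> 'c set \<Rightarrow> 'c set set" where
  "orbits f A = orbit_of f ` A"

end

theory Submission
  imports Defs
begin

text \<open>
  The argument is uniform in the type. Let \<open>P\<close> be \<open>\<Delta>(1)\<close>. Lower ideals of \<open>P\<close> containing no pair
  \<open>\<gamma>, \<theta> - \<gamma>\<close> are the inversion sets of the elements \<open>w\<close> of the Weyl group that are positive on
  the simple roots orthogonal to \<open>\<theta>\<close> and on \<open>\<theta>\<close>, and \<open>w \<mapsto> w \<theta>\<close> identifies them with the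
  positive long roots. Every other ideal is the image of such an ideal under the duality
  \<open>I \<mapsto> P - (\<theta> - I)\<close>, which corresponds to negating the long root, and the self-dual ideals,
  those of size \<open>card P / 2 = h* - 2\<close>, correspond to the long simple roots. So the ideals are the
  long roots, with each simple root glued to its negative.

  Two-colour the Dynkin diagram and let the product of the simple reflections of either colour act
  alternately. A Perron--Frobenius vector shows that every walk of positive roots has the same length,
  and counting roots (Schur's lemma for the reflection representation) identifies it as \<open>h\<close>.
  Under the above correspondence the two colour classes of reflections become toggles of the elements
  of \<open>P\<close> of either parity of a suitable rank function, except that the sign changes of a walk
  are skipped; a walk of \<open>2 h\<close> half-steps thus becomes a toggle orbit of \<open>2 (h - 1)\<close> half-steps with
  one positive-to-negative crossing, hence one long simple root. The reverse operator, being toggling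
  rank by rank, is conjugate to the alternating product of the two classes of toggles.

  Finally the duality conjugates the reverse operator to its inverse. When \<open>h - 1\<close> is odd, an orbit
  contains at most one self-dual ideal, and there are as many self-dual ideals as orbits.
\<close>

section \<open>Root systems with a base\<close>

text \<open>Two gaps have to be bridged without classification: the statement speaks of
  \<open>ht \<theta> + 1\<close>, not of the order of a Coxeter element, and of a poset on which the
  Weyl group does not act. The bridge to the poset is a label. Away from sign changes, an element
  \<open>g\<close> of \<open>P\<close> can be toggled in the inversion set of \<open>w\<close>
  exactly when \<open>w g\<close> is plus or minus a simple root, and reflecting in that root
  toggles \<open>g\<close> alone. A colour class of reflections therefore becomes a class of toggles
  only if the colour of the label depends on \<open>g\<close> and not on the ideal; this requirement
  dictates the weights in the rank function. A sign change costs no half-step on ideals because a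
  simple root and its negative give the same self-dual ideal; that is how 2 h becomes 2 (h - 1).
  Roots and ideals are paired with the colour to be applied next. The alternating walk is then the
  iteration of a single map, and for roots flipping the colour reverses time.\<close>

definition pair :: "'a::euclidean_space \<Rightarrow> 'a \<Rightarrow> real" where
  "pair \<beta> \<alpha> = 2 * (\<beta> \<bullet> \<alpha>) / (\<alpha> \<bullet> \<alpha>)"

lemma refl_root_pair: "refl_root \<alpha> \<beta> = \<beta> - pair \<beta> \<alpha> *\<^sub>R \<alpha>"
  by (simp add: refl_root_def pair_def)

lemma pair_coroot: "\<beta> \<bullet> coroot \<alpha> = pair \<beta> \<alpha>"
  by (simp add: coroot_def pair_def)

lemma pair_add: "pair (x + y) a = pair x a + pair y a"
  by (simp add: pair_def inner_add_left add_divide_distrib distrib_left)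

lemma pair_diff: "pair (x - y) a = pair x a - pair y a"
  by (simp add: pair_def inner_diff_left diff_divide_distrib right_diff_distrib)

lemma pair_scale: "pair (c *\<^sub>R x) a = c * pair x a"
  by (simp add: pair_def)

lemma pair_minus [simp]: "pair (- x) a = - pair x a"
  by (simp add: pair_def)

lemma pair_zero [simp]: "pair 0 a = 0"
  by (simp add: pair_def)

lemma pair_sum: "pair (\<Sum>i\<in>I. f i) a = (\<Sum>i\<in>I. pair (f i) a)"
  by (simp add: pair_def inner_sum_left sum_distrib_left sum_divide_distrib)

lemma pair_self: "a \<noteq> 0 \<Longrightarrow> pair a a = 2"
  by (simp add: pair_def)

lemma pair_pos_iff: "a \<noteq> 0 \<Longrightarrow> pair b a > 0 \<longleftrightarrow> b \<bullet> a > 0"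
  by (simp add: pair_def zero_less_divide_iff order.strict_iff_not[of "a \<bullet> a"])

lemma pair_nonneg_iff: "a \<noteq> 0 \<Longrightarrow> pair b a \<ge> 0 \<longleftrightarrow> b \<bullet> a \<ge> 0"
  using inner_ge_zero[of a] by (auto simp: pair_def zero_le_divide_iff simp del: inner_ge_zero)

lemma pair_eq_0_iff: "a \<noteq> 0 \<Longrightarrow> pair b a = 0 \<longleftrightarrow> b \<bullet> a = 0"
  by (simp add: pair_def)

lemma inner_pair: "a \<noteq> 0 \<Longrightarrow> b \<bullet> a = pair b a * (a \<bullet> a) / 2"
  by (simp add: pair_def)

lemma refl_root_linear: "linear (refl_root a)"
  by (rule linearI) (simp_all add: refl_root_pair pair_add pair_scale algebra_simps)

lemma refl_root_self: "a \<noteq> 0 \<Longrightarrow> refl_root a a = - a"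
  by (simp add: refl_root_pair pair_self scaleR_2)

lemma pair_refl_root: "a \<noteq> 0 \<Longrightarrow> pair (refl_root a b) a = - pair b a"
  by (simp add: refl_root_pair pair_diff pair_scale pair_self)

lemma refl_root_invol: "a \<noteq> 0 \<Longrightarrow> refl_root a (refl_root a b) = b"
  using refl_root_pair[of a "refl_root a b"] pair_refl_root[of a b] by (simp add: refl_root_pair[of a b])

lemma refl_root_minus: "refl_root a (- b) = - refl_root a b"
  by (simp add: refl_root_pair)

lemma refl_root_adjoint: "refl_root a x \<bullet> y = x \<bullet> refl_root a y"
  by (simp add: refl_root_pair pair_def inner_diff_left inner_diff_right inner_commute)

lemma refl_root_inner: "a \<noteq> 0 \<Longrightarrow> refl_root a x \<bullet> refl_root a y = x \<bullet> y"
  by (simp add: refl_root_adjoint refl_root_invol)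

lemma sum_Nats: "(\<And>x. x \<in> A \<Longrightarrow> f x \<in> \<nat>) \<Longrightarrow> sum f A \<in> \<nat>"
  by (induction A rule: infinite_finite_induct) auto

locale based_root_system =
  fixes R S :: "'a::euclidean_space set"
  assumes root_system: "root_system R"
    and irreducible: "irreducible_rs R"
    and simple_system: "simple_system R S"
begin

abbreviation "Pos \<equiv> pos_roots R S"

lemma finite_R: "finite R"
  and zero_notin_R: "0 \<notin> R"
  and span_R: "span R = UNIV"
  and refl_R: "a \<in> R \<Longrightarrow> b \<in> R \<Longrightarrow> refl_root a b \<in> R"
  and pair_Ints: "a \<in> R \<Longrightarrow> b \<in> R \<Longrightarrow> pair b a \<in> \<int>"
  and scale_R: "a \<in> R \<Longrightarrow> c *\<^sub>R a \<in> R \<Longrightarrow> c = 1 \<or> c = -1"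
  using root_system by (auto simp: root_system_def pair_def)

lemma root_nz: "a \<in> R \<Longrightarrow> a \<noteq> 0"
  using zero_notin_R by blast

lemma root_sq_pos: "a \<in> R \<Longrightarrow> a \<bullet> a > 0"
  using root_nz by simp

lemma minus_R: "a \<in> R \<Longrightarrow> - a \<in> R"
  using refl_R[of a a] refl_root_self[of a] root_nz by auto

lemma minus_R_iff [simp]: "- a \<in> R \<longleftrightarrow> a \<in> R"
  using minus_R[of a] minus_R[of "- a"] by auto

lemma S_sub_R: "S \<subseteq> R"
  and indep_S: "independent S"
  and root_comb: "b \<in> R \<Longrightarrow> nonneg_comb S b \<or> nonneg_comb S (- b)"
  using simple_system by (auto simp: simple_system_def)

lemma S_R: "a \<in> S \<Longrightarrow> a \<in> R"
  using S_sub_R by blast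

lemma finite_S: "finite S"
  using S_sub_R finite_R finite_subset by blast

lemma S_nz: "a \<in> S \<Longrightarrow> a \<noteq> 0"
  using S_R root_nz by blast

lemma span_S: "span S = UNIV"
proof -
  have "R \<subseteq> span S"
  proof
    fix b assume "b \<in> R"
    then consider c where "b = (\<Sum>\<gamma>\<in>S. real (c \<gamma>) *\<^sub>R \<gamma>)" | c where "- b = (\<Sum>\<gamma>\<in>S. real (c \<gamma>) *\<^sub>R \<gamma>)"
      using root_comb unfolding nonneg_comb_def by blast
    then show "b \<in> span S"
    proof cases
      case 1
      then show ?thesis by (simp add: span_base span_scale span_sum)
    next
      case 2
      then have "- b \<in> span S" by (simp add: span_base span_scale span_sum)
      then show ?thesis using span_neg[of "- b" S] by simp
    qed
  qed
  then have "span R \<subseteq> span S" by (metis span_mono span_span)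
  then show ?thesis using span_R by auto
qed

lemma card_S: "card S = DIM('a)"
  using indep_S span_S by (metis dim_UNIV dim_eq_card_independent dim_span)

text \<open>Real coordinates exist and are linear on the whole space, whereas the integer
  \<open>coeffs\<close> is a definite description that is pinned down only on the root
  lattice.\<close>

definition cf :: "'a \<Rightarrow> 'a \<Rightarrow> real" where "cf v = representation S v"

lemma cf_expand: "(\<Sum>a\<in>S. cf v a *\<^sub>R a) = v"
  unfolding cf_def
  using real_vector.sum_representation_eq[OF indep_S _ finite_S order_refl, of v] span_S by simp

lemma cf_add: "cf (x + y) a = cf x a + cf y a"
  and cf_diff: "cf (x - y) a = cf x a - cf y a"
  and cf_minus: "cf (- x) a = - cf x a"
  and cf_scale: "cf (c *\<^sub>R x) a = c * cf x a"
  using real_vector.representation_add[OF indep_S, of y x] real_vector.representation_diff[OF indep_S, of y x]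
    real_vector.representation_neg[OF indep_S, of x] real_vector.representation_scale[OF indep_S, of x c] span_S
  by (simp_all add: cf_def)

lemma cf_zero [simp]: "cf 0 a = 0"
  using cf_scale[of 0 0 a] by simp

lemma cf_sum: "cf (\<Sum>i\<in>I. f i) a = (\<Sum>i\<in>I. cf (f i) a)"
  by (induction I rule: infinite_finite_induct) (simp_all add: cf_add)

lemma cf_basis: "a \<in> S \<Longrightarrow> cf a b = (if a = b then 1 else 0)"
  using real_vector.representation_basis[OF indep_S, of a] by (simp add: cf_def)

lemma cf_comb:
  assumes "b \<in> S" shows "cf (\<Sum>a\<in>S. c a *\<^sub>R a) b = c b"
proof -
  have "cf (\<Sum>a\<in>S. c a *\<^sub>R a) b = (\<Sum>a\<in>S. if a = b then c a else 0)"
    unfolding cf_sum by (rule sum.cong) (simp_all add: cf_scale cf_basis)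
  then show ?thesis using assms finite_S by simp
qed

lemma cf_eqI:
  assumes "\<And>a. a \<in> S \<Longrightarrow> cf x a = cf y a" shows "x = y"
proof -
  have "(\<Sum>a\<in>S. cf x a *\<^sub>R a) = (\<Sum>a\<in>S. cf y a *\<^sub>R a)"
    by (rule sum.cong) (simp_all only: assms)
  then show ?thesis by (simp only: cf_expand)
qed

lemma inner_cf: "v \<bullet> w = (\<Sum>a\<in>S. cf v a * (a \<bullet> w))"
proof -
  have "v \<bullet> w = (\<Sum>a\<in>S. cf v a *\<^sub>R a) \<bullet> w" by (simp only: cf_expand)
  then show ?thesis by (simp add: inner_sum_left)
qed

lemma nonneg_comb_iff: "nonneg_comb S v \<longleftrightarrow> (\<forall>a\<in>S. cf v a \<in> \<nat>)"
proof
  assume "nonneg_comb S v"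
  then show "\<forall>a\<in>S. cf v a \<in> \<nat>"
    unfolding nonneg_comb_def using cf_comb by auto
next
  assume *: "\<forall>a\<in>S. cf v a \<in> \<nat>"
  define c where "c a = nat \<lfloor>cf v a\<rfloor>" for a
  have "real (c a) = cf v a" if "a \<in> S" for a
    using *[rule_format, OF that] unfolding c_def by (auto elim: Nats_cases)
  then have "(\<Sum>a\<in>S. real (c a) *\<^sub>R a) = (\<Sum>a\<in>S. cf v a *\<^sub>R a)"
    by (intro sum.cong) simp_all
  then have "(\<Sum>a\<in>S. real (c a) *\<^sub>R a) = v"
    by (simp only: cf_expand)
  from this[symmetric] show "nonneg_comb S v" unfolding nonneg_comb_def by blast
qed

lemma nonneg_comb_cf: "nonneg_comb S v \<Longrightarrow> a \<in> S \<Longrightarrow> cf v a \<ge> 0"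
  unfolding nonneg_comb_iff by (auto elim!: Nats_cases dest!: bspec[of _ _ a])

lemma nonneg_comb_0: "nonneg_comb S 0"
  by (simp add: nonneg_comb_iff)

lemma nonneg_comb_add: "nonneg_comb S x \<Longrightarrow> nonneg_comb S y \<Longrightarrow> nonneg_comb S (x + y)"
  by (simp add: nonneg_comb_iff cf_add)

lemma nonneg_comb_antisym: "nonneg_comb S x \<Longrightarrow> nonneg_comb S (- x) \<Longrightarrow> x = 0"
proof (rule cf_eqI)
  fix a assume "nonneg_comb S x" "nonneg_comb S (- x)" "a \<in> S"
  then have "cf x a \<ge> 0" "cf (- x) a \<ge> 0" using nonneg_comb_cf by blast+
  then show "cf x a = cf 0 a" by (simp add: cf_minus)
qed

lemma root_cf_Ints:
  assumes "b \<in> R" "a \<in> S" shows "cf b a \<in> \<int>"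
proof -
  consider "cf b a \<in> \<nat>" | "- cf b a \<in> \<nat>"
    using root_comb[OF assms(1)] assms(2) unfolding nonneg_comb_iff cf_minus by blast
  then show ?thesis using Nats_subset_Ints Ints_minus[of "- cf b a"] by cases auto
qed

lemma Pos_R: "b \<in> Pos \<Longrightarrow> b \<in> R"
  by (simp add: pos_roots_def)

lemma finite_Pos: "finite Pos"
  using finite_R by (auto simp: pos_roots_def)

lemma Pos_cases: "b \<in> R \<Longrightarrow> b \<in> Pos \<or> - b \<in> Pos"
  using root_comb by (auto simp: pos_roots_def)

lemma Pos_not_minus: "b \<in> Pos \<Longrightarrow> - b \<notin> Pos"
  using nonneg_comb_antisym root_nz by (auto simp: pos_roots_def)

lemma Pos_minus_iff: "b \<in> R \<Longrightarrow> - b \<in> Pos \<longleftrightarrow> b \<notin> Pos"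
  using Pos_cases Pos_not_minus by blast

lemma Pos_cf: "b \<in> Pos \<Longrightarrow> a \<in> S \<Longrightarrow> cf b a \<ge> 0"
  using nonneg_comb_cf by (auto simp: pos_roots_def)

lemma Pos_cfI:
  assumes "b \<in> R" "a \<in> S" "cf b a > 0" shows "b \<in> Pos"
  using Pos_cases[OF assms(1)] Pos_cf[of "- b" a] assms by (auto simp: cf_minus)

lemma Pos_comb: "b \<in> Pos \<Longrightarrow> nonneg_comb S b"
  by (simp add: pos_roots_def)

lemma PosI: "b \<in> R \<Longrightarrow> nonneg_comb S b \<Longrightarrow> b \<in> Pos"
  by (simp add: pos_roots_def)

lemma S_Pos: "a \<in> S \<Longrightarrow> a \<in> Pos"
  using Pos_cfI[of a a] S_R by (simp add: cf_basis)

text \<open>By Cauchy-Schwarz the two Cartan integers, both positive, have product at most 4, and 2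
  times 2 forces equal vectors. So one of them is 1, and a single reflection yields the difference
  up to sign.\<close>

lemma diff_root:
  assumes a: "a \<in> R" and b: "b \<in> R" and ne: "a \<noteq> b" and pos: "a \<bullet> b > 0"
  shows "a - b \<in> R"
proof -
  have nz: "a \<noteq> 0" "b \<noteq> 0" using a b root_nz by auto
  obtain m where m: "pair a b = of_int m" using pair_Ints[OF b a] by (auto elim: Ints_cases)
  obtain n where n: "pair b a = of_int n" using pair_Ints[OF a b] by (auto elim: Ints_cases)
  have mp: "m > 0" using m pos pair_pos_iff[of b a] nz by simp
  have np: "n > 0" using n pos pair_pos_iff[of a b] nz by (simp add: inner_commute)
  have prod: "pair a b * pair b a = 4 * (a \<bullet> b)^2 / ((a \<bullet> a) * (b \<bullet> b))"
    by (simp add: pair_def power2_eq_square inner_commute)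
  have cs: "(a \<bullet> b)^2 \<le> (a \<bullet> a) * (b \<bullet> b)" by (rule Cauchy_Schwarz_ineq)
  have den: "(a \<bullet> a) * (b \<bullet> b) > 0" using nz by simp
  have "m = 1 \<or> n = 1"
  proof (rule ccontr)
    assume "\<not> (m = 1 \<or> n = 1)"
    then have m2: "m \<ge> 2" and n2: "n \<ge> 2" using mp np by auto
    have "m * n \<le> 4"
    proof -
      have "of_int (m * n) \<le> (4::real)"
        using prod cs den m n by (simp add: divide_le_eq)
      then show ?thesis by linarith
    qed
    moreover have "2 * n \<le> m * n" "m * 2 \<le> m * n" using m2 n2 by (auto intro: mult_right_mono mult_left_mono)
    ultimately have "m = 2" "n = 2" using m2 n2 by linarith+
    then have "a \<bullet> b = b \<bullet> b" "a \<bullet> b = a \<bullet> a" using m n nz by (auto simp: pair_def field_simps inner_commute)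
    then have "(a - b) \<bullet> (a - b) = 0" by (simp add: inner_diff_left inner_diff_right inner_commute)
    then show False using ne by simp
  qed
  then show ?thesis
  proof
    assume "m = 1"
    then have "refl_root b a = a - b" using m by (simp add: refl_root_pair)
    then show ?thesis using refl_R[OF b a] by simp
  next
    assume "n = 1"
    then have "refl_root a b = b - a" using n by (simp add: refl_root_pair)
    then show ?thesis using minus_R[OF refl_R[OF a b]] by simp
  qed
qed

lemma add_root:
  assumes "a \<in> R" "b \<in> R" "a \<noteq> - b" "a \<bullet> b < 0"
  shows "a + b \<in> R"
  using diff_root[of a "- b"] assms minus_R by simp

lemma S_obtuse:
  assumes "a \<in> S" "b \<in> S" "a \<noteq> b" shows "a \<bullet> b \<le> 0"
proof (rule ccontr)
  assume "\<not> a \<bullet> b \<le> 0"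
  then have r: "a - b \<in> R" using diff_root S_R assms by simp
  have "cf (a - b) a = 1" "cf (a - b) b = -1" using assms by (simp_all add: cf_diff cf_basis)
  moreover from this have "a - b \<in> Pos" by (intro Pos_cfI[OF r assms(1)]) linarith
  ultimately show False using Pos_cf[of "a - b" b] assms(2) by linarith
qed

lemma multiple_of_simple:
  assumes "b \<in> Pos" "a \<in> S" "\<And>c. c \<in> S \<Longrightarrow> c \<noteq> a \<Longrightarrow> cf b c = 0"
  shows "b = a"
proof -
  have eq: "cf b a *\<^sub>R a = b"
  proof (rule cf_eqI)
    fix c assume "c \<in> S"
    then show "cf (cf b a *\<^sub>R a) c = cf b c"
      using assms(2) assms(3)[of c] by (cases "c = a") (simp_all add: cf_scale cf_basis)
  qed
  have "cf b a *\<^sub>R a \<in> R" unfolding eq using assms(1) by (rule Pos_R)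
  then have "cf b a = 1 \<or> cf b a = -1" using scale_R[of a "cf b a"] assms(2) S_R by blast
  then have "cf b a = 1" using Pos_cf[of b a] assms by linarith
  then show ?thesis using eq by simp
qed

lemma other_support:
  assumes "b \<in> Pos" "a \<in> S" "b \<noteq> a"
  obtains c where "c \<in> S" "c \<noteq> a" "cf b c > 0"
proof -
  have "\<exists>c\<in>S. c \<noteq> a \<and> cf b c \<noteq> 0" using multiple_of_simple[OF assms(1,2)] assms(3) by blast
  then obtain c where c: "c \<in> S" "c \<noteq> a" "cf b c \<noteq> 0" by blast
  then have "cf b c > 0" using Pos_cf[of b c] assms(1) by linarith
  then show ?thesis using c that by blast
qed

text \<open>The reflection changes only the coordinate at \<open>a\<close>. A positive root other
  than \<open>a\<close> has another positive coordinate, and one positive coordinate decides the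
  sign of a root.\<close>

lemma refl_simple_Pos:
  assumes b: "b \<in> Pos" and a: "a \<in> S" and ne: "b \<noteq> a"
  shows "refl_root a b \<in> Pos"
proof -
  obtain c where c: "c \<in> S" "c \<noteq> a" "cf b c > 0" using other_support assms by blast
  have "cf (refl_root a b) c = cf b c" using c a by (simp add: refl_root_pair cf_diff cf_scale cf_basis)
  then show ?thesis using Pos_cfI[of "refl_root a b" c] c refl_R[of a b] a b S_R Pos_R by auto
qed

lemma diff_simple_Pos:
  assumes b: "b \<in> Pos" and a: "a \<in> S" and ne: "b \<noteq> a" and r: "b - a \<in> R"
  shows "b - a \<in> Pos"
proof -
  obtain c where c: "c \<in> S" "c \<noteq> a" "cf b c > 0" using other_support assms by blast
  have "cf (b - a) c = cf b c" using c a by (simp add: cf_diff cf_basis)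
  then show ?thesis using Pos_cfI[OF r] c by auto
qed

lemma acute_simple:
  assumes "b \<in> Pos" obtains a where "a \<in> S" "b \<bullet> a > 0" "cf b a > 0"
proof -
  have "0 < b \<bullet> b" using root_sq_pos Pos_R assms by blast
  also have "b \<bullet> b = (\<Sum>a\<in>S. cf b a * (a \<bullet> b))" by (rule inner_cf)
  finally have "\<exists>a\<in>S. cf b a * (a \<bullet> b) > 0"
    using sum_nonpos[of S "\<lambda>a. cf b a * (a \<bullet> b)"] by force
  then obtain a where "a \<in> S" "cf b a * (a \<bullet> b) > 0" by blast
  moreover have "cf b a \<ge> 0" using Pos_cf assms \<open>a \<in> S\<close> by blast
  ultimately have "a \<bullet> b > 0" "cf b a > 0" by (auto simp: zero_less_mult_iff)
  then show ?thesis using that \<open>a \<in> S\<close> by (simp add: inner_commute)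
qed

lemma simple_decomp:
  assumes "b \<in> Pos" "b \<notin> S"
  obtains a where "a \<in> S" "b \<bullet> a > 0" "b - a \<in> Pos"
proof -
  obtain a where a: "a \<in> S" "b \<bullet> a > 0" using acute_simple assms(1) by blast
  have ne: "b \<noteq> a" using a assms by auto
  have "b - a \<in> R" by (rule diff_root) (use a S_R Pos_R assms ne in auto)
  then show ?thesis using that[OF a] diff_simple_Pos[OF assms(1) a(1) ne] by blast
qed

definition ht :: "'a \<Rightarrow> real" where "ht v = (\<Sum>a\<in>S. cf v a)"

lemma ht_add: "ht (x + y) = ht x + ht y"
  and ht_diff: "ht (x - y) = ht x - ht y"
  and ht_scale: "ht (c *\<^sub>R x) = c * ht x"
  and ht_minus: "ht (- x) = - ht x"
  by (simp_all add: ht_def cf_add cf_diff cf_scale cf_minus sum.distrib sum_subtractf sum_distrib_left sum_negf)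

lemma ht_S: "a \<in> S \<Longrightarrow> ht a = 1"
  using finite_S by (simp add: ht_def cf_basis)

lemma ht_nonneg: "nonneg_comb S v \<Longrightarrow> ht v \<ge> 0"
  unfolding ht_def by (intro sum_nonneg nonneg_comb_cf)

lemma ht_Nats: "nonneg_comb S v \<Longrightarrow> ht v \<in> \<nat>"
  unfolding ht_def nonneg_comb_iff by (rule sum_Nats) auto

lemma ht_eq_0: "nonneg_comb S v \<Longrightarrow> ht v = 0 \<Longrightarrow> v = 0"
  unfolding ht_def
  by (rule cf_eqI) (simp add: sum_nonneg_eq_0_iff[OF finite_S] nonneg_comb_cf)

lemma ht_ge1:
  assumes "nonneg_comb S v" "v \<noteq> 0" shows "ht v \<ge> 1"
proof -
  have "ht v \<in> \<nat>" "ht v \<noteq> 0" using ht_Nats ht_eq_0 assms by auto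
  then show ?thesis by (auto elim!: Nats_cases)
qed

lemma ht_Pos: "b \<in> Pos \<Longrightarrow> ht b \<ge> 1"
  using ht_ge1 Pos_comb Pos_R root_nz by blast

lemma simple_not_sum:
  assumes "x \<in> Pos" "y \<in> Pos" shows "x + y \<notin> S"
  using ht_S[of "x + y"] ht_Pos[OF assms(1)] ht_Pos[OF assms(2)] by (auto simp: ht_add)

text \<open>With pairwise orthogonal support, reflecting in \<open>a\<close> merely negates the
  coordinate at \<open>a\<close>, which is impossible for a positive root other than
  \<open>a\<close>. This recognises the simple root at which a walk ends.\<close>

lemma orthogonal_support_simple:
  assumes b: "b \<in> Pos"
    and orth: "\<And>x y. x \<in> S \<Longrightarrow> y \<in> S \<Longrightarrow> cf b x \<noteq> 0 \<Longrightarrow> cf b y \<noteq> 0 \<Longrightarrow> x \<noteq> y \<Longrightarrow> x \<bullet> y = 0"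
  shows "b \<in> S"
proof (rule ccontr)
  assume n: "b \<notin> S"
  obtain a where a: "a \<in> S" "b \<bullet> a > 0" "cf b a > 0" using acute_simple b by blast
  have "b \<bullet> a = (\<Sum>x\<in>S. if x = a then cf b a * (a \<bullet> a) else 0)"
    unfolding inner_cf[of b a]
  proof (rule sum.cong)
    fix x assume "x \<in> S"
    then show "cf b x * (x \<bullet> a) = (if x = a then cf b a * (a \<bullet> a) else 0)"
      using orth[of x a] a by auto
  qed simp
  then have "pair b a = 2 * cf b a" using a finite_S S_nz[of a] by (simp add: pair_def)
  then have "cf (refl_root a b) a = - cf b a" using a by (simp add: refl_root_pair cf_diff cf_scale cf_basis)
  moreover have "refl_root a b \<in> Pos" using refl_simple_Pos[OF b a(1)] n a by auto
  ultimately show False using Pos_cf[of "refl_root a b" a] a by simp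
qed

end

section \<open>The highest root\<close>

lemma coroot_coroot: "a \<noteq> 0 \<Longrightarrow> coroot (coroot a) = a"
  by (simp add: coroot_def)

lemma refl_root_sum: "refl_root a (sum f I) = (\<Sum>i\<in>I. refl_root a (f i))"
  using linear_sum[OF refl_root_linear] by (simp add: o_def)

lemma refl_root_scale: "refl_root a (c *\<^sub>R x) = c *\<^sub>R refl_root a x"
  using linear_scale[OF refl_root_linear] .

lemma refl_root_coroot: "a \<noteq> 0 \<Longrightarrow> refl_root a (coroot b) = coroot (refl_root a b)"
  by (simp add: coroot_def refl_root_scale refl_root_inner)

lemma refl_root_conj:
  assumes "linear w" "\<And>x y. w x \<bullet> w y = x \<bullet> y"
  shows "refl_root (w a) (w x) = w (refl_root a x)"
  using assms by (simp add: refl_root_def linear_diff linear_scale)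

context based_root_system
begin

text \<open>Without an edge leaving \<open>A\<close>, every positive root would be supported in
  \<open>A\<close> or in its complement, and the two kinds of roots would contradict
  irreducibility.\<close>

lemma S_connected:
  assumes A: "A \<subseteq> S" "A \<noteq> {}" "A \<noteq> S"
  obtains a b where "a \<in> A" "b \<in> S - A" "a \<bullet> b < 0"
proof -
  let ?supp = "\<lambda>C b. \<forall>c\<in>S - C. cf b c = 0"
  have "\<exists>a\<in>A. \<exists>b\<in>S - A. a \<bullet> b \<noteq> 0"
  proof (rule ccontr)
    assume "\<not> ?thesis"
    then have orth: "a \<bullet> b = 0" if "a \<in> A" "b \<in> S - A" for a b using that by blast
    have step: "b \<bullet> a = 0" if "?supp C b" "a \<in> S - C" "\<And>c. c \<in> C \<Longrightarrow> c \<in> S \<Longrightarrow> c \<bullet> a = 0" for C a b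
      unfolding inner_cf[of b a] by (rule sum.neutral) (use that in auto)
    have key: "b \<in> Pos \<Longrightarrow> ?supp A b \<or> ?supp (S - A) b" for b
    proof (induction "nat \<lfloor>ht b\<rfloor>" arbitrary: b rule: less_induct)
      case less
      show ?case
      proof (cases "b \<in> S")
        case True
        then show ?thesis by (cases "b \<in> A") (auto simp: cf_basis)
      next
        case False
        obtain a where a: "a \<in> S" "b \<bullet> a > 0" "b - a \<in> Pos" using simple_decomp less.prems False by blast
        have "ht (b - a) = ht b - 1" using a by (simp add: ht_diff ht_S)
        moreover have "ht b \<ge> 1" "ht (b - a) \<ge> 1" using ht_Pos less.prems a by auto
        ultimately have "nat \<lfloor>ht (b - a)\<rfloor> < nat \<lfloor>ht b\<rfloor>" by linarith
        from less.hyps[OF this a(3)] have ih: "?supp A (b - a) \<or> ?supp (S - A) (b - a)" .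
        have "?supp C b" if C: "?supp C (b - a)" "C = A \<or> C = S - A" for C
        proof (cases "a \<in> C")
          case True
          then show ?thesis using C a by (auto simp: cf_diff cf_basis)
        next
          case nC: False
          \<comment> \<open>A simple root outside the class supporting \<open>b - a\<close> is
            orthogonal to it, so reflecting \<open>b\<close> gives \<open>b - 2 a\<close>, a
            positive root with coordinate -1 at \<open>a\<close>.\<close>
          have "(b - a) \<bullet> a = 0"
          proof (rule step[of C])
            show "?supp C (b - a)" using C by blast
            show "a \<in> S - C" using nC a by blast
            show "c \<bullet> a = 0" if "c \<in> C" "c \<in> S" for c
              using C(2) orth[of c a] orth[of a c] that nC a by (auto simp: inner_commute)
          qed
          then have "b \<bullet> a = a \<bullet> a" by (simp add: inner_diff_left)
          then have "refl_root a b = b - 2 *\<^sub>R a" using S_nz[OF a(1)] by (simp add: refl_root_def)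
          moreover have "cf (b - a) a = 0" using C nC a by auto
          ultimately have "cf (refl_root a b) a = -1"
            using a by (simp add: cf_diff cf_scale cf_basis)
          moreover have "refl_root a b \<in> Pos" using refl_simple_Pos[OF less.prems a(1)] False a by auto
          ultimately show ?thesis using Pos_cf[of "refl_root a b" a] a by simp
        qed
        then show ?thesis using ih by blast
      qed
    qed
    define R1 R2 where "R1 = {b\<in>R. ?supp A b}" and "R2 = {b\<in>R. ?supp (S - A) b}"
    have "R1 \<union> R2 = R"
      using key Pos_cases unfolding R1_def R2_def by (fastforce simp: cf_minus)
    moreover have "R1 \<inter> R2 = {}"
    proof -
      have "b = 0" if "?supp A b" "?supp (S - A) b" for b
        by (rule cf_eqI) (use that in auto)
      then show ?thesis using zero_notin_R unfolding R1_def R2_def by blast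
    qed
    moreover have "R1 \<noteq> {} \<and> R2 \<noteq> {}"
    proof -
      obtain a b where "a \<in> A" "b \<in> S - A" using A by blast
      then have "a \<in> R1" "b \<in> R2" using A S_R by (auto simp: R1_def R2_def cf_basis)
      then show ?thesis by blast
    qed
    moreover have "x \<bullet> y = 0" if "x \<in> R1" "y \<in> R2" for x y
    proof -
      have "c \<bullet> y = 0" if "c \<in> A" for c
      proof -
        have "y \<bullet> c = 0"
        proof (rule step[of "S - A"])
          show "?supp (S - A) y" using \<open>y \<in> R2\<close> unfolding R2_def by blast
          show "c \<in> S - (S - A)" using that A by blast
          show "x \<bullet> c = 0" if "x \<in> S - A" for x
            using orth[OF \<open>c \<in> A\<close> that] by (simp add: inner_commute)
        qed
        then show ?thesis by (simp add: inner_commute)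
      qed
      then have "cf x c * (c \<bullet> y) = 0" if "c \<in> S" for c
        using that \<open>x \<in> R1\<close> unfolding R1_def by (cases "c \<in> A") auto
      then show ?thesis unfolding inner_cf[of x y] by (intro sum.neutral) blast
    qed
    ultimately have "\<exists>R1 R2. R1 \<noteq> {} \<and> R2 \<noteq> {} \<and> R1 \<union> R2 = R \<and> R1 \<inter> R2 = {} \<and> (\<forall>x\<in>R1. \<forall>y\<in>R2. x \<bullet> y = 0)"
      by (intro exI[of _ R1] exI[of _ R2]) simp
    then show False using irreducible unfolding irreducible_rs_def by contradiction
  qed
  then obtain a b where ab: "a \<in> A" "b \<in> S - A" "a \<bullet> b \<noteq> 0" by blast
  then have "a \<bullet> b \<le> 0" using S_obtuse[of a b] A by blast
  then show ?thesis using that ab by force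
qed

text \<open>At the edge of the support, connectedness gives a simple root \<open>c\<close> with
  coordinate 0 and a neighbour inside. All terms of \<open>t \<bullet> c\<close> are then
  non-positive and one is negative, against \<open>dom\<close>. Serves the highest root and the
  Perron vector alike.\<close>

lemma full_support:
  assumes nn: "\<And>a. a \<in> S \<Longrightarrow> cf t a \<ge> 0" and nz: "t \<noteq> 0"
    and dom: "\<And>a. a \<in> S \<Longrightarrow> cf t a = 0 \<Longrightarrow> t \<bullet> a \<ge> 0" and a: "a \<in> S"
  shows "cf t a > 0"
proof (rule ccontr)
  assume n: "\<not> cf t a > 0"
  define A where "A = {a\<in>S. cf t a > 0}"
  have "\<exists>a\<in>S. cf t a \<noteq> 0" using nz cf_eqI[of t 0] by auto
  then have "A \<noteq> {}" using nn unfolding A_def by force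
  moreover have "A \<subseteq> S" "A \<noteq> S" using n a unfolding A_def by auto
  ultimately obtain b c where bc: "b \<in> A" "c \<in> S - A" "b \<bullet> c < 0"
    using S_connected[of A] by metis
  have c: "c \<in> S" "cf t c = 0" using bc(2) nn[of c] unfolding A_def by auto
  have "t \<bullet> c = (\<Sum>x\<in>S. cf t x * (x \<bullet> c))" by (rule inner_cf)
  also have "\<dots> = cf t b * (b \<bullet> c) + (\<Sum>x\<in>S - {b}. cf t x * (x \<bullet> c))"
    by (rule sum.remove[OF finite_S]) (use bc(1) in \<open>simp add: A_def\<close>)
  also have "\<dots> < 0"
  proof -
    have "(\<Sum>x\<in>S - {b}. cf t x * (x \<bullet> c)) \<le> 0"
    proof (rule sum_nonpos)
      fix x assume x: "x \<in> S - {b}"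
      show "cf t x * (x \<bullet> c) \<le> 0"
      proof (cases "x = c")
        case True
        then show ?thesis using c by simp
      next
        case False
        have "x \<bullet> c \<le> 0" by (rule S_obtuse) (use x c False in blast)+
        moreover have "cf t x \<ge> 0" by (rule nn) (use x in blast)
        ultimately show ?thesis by (rule mult_nonneg_nonpos[rotated])
      qed
    qed
    moreover have "cf t b * (b \<bullet> c) < 0" using bc by (simp add: A_def mult_pos_neg)
    ultimately show ?thesis by linarith
  qed
  finally show False using dom[OF c] by simp
qed

lemma S_nonempty: "S \<noteq> {}"
  using card_S finite_S by auto

lemma nonneg_comb_inner:
  assumes "nonneg_comb S v" "\<And>a. a \<in> S \<Longrightarrow> a \<bullet> w \<ge> 0" shows "v \<bullet> w \<ge> 0"
  unfolding inner_cf[of v w] by (intro sum_nonneg mult_nonneg_nonneg nonneg_comb_cf assms)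

text \<open>A root of maximal height is dominant, hence of full support. A positive root that no
  simple root can raise is dominant too, so it has positive inner product with the former, and their
  difference is zero or a root that cannot be negative.\<close>

lemma highest_root_ex: "\<exists>t\<in>Pos. \<forall>b\<in>R. nonneg_comb S (t - b)"
proof -
  obtain a0 where a0: "a0 \<in> S" using S_nonempty by blast
  obtain t where t: "t \<in> R" and tmax: "\<And>b. b \<in> R \<Longrightarrow> ht b \<le> ht t"
  proof -
    have "Max (ht ` R) \<in> ht ` R" using finite_R a0 S_R by (intro Max_in) auto
    then obtain t where "t \<in> R" "ht t = Max (ht ` R)" by auto
    then show ?thesis using that[of t] finite_R by simp
  qed
  have tPos: "t \<in> Pos"
    using Pos_cases[OF t] ht_Pos[of "- t"] tmax[of a0] a0 S_R by (auto simp: ht_minus ht_S)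
  have dom: "t \<bullet> a \<ge> 0" if "a \<in> S" for a
  proof (rule ccontr)
    assume n: "\<not> t \<bullet> a \<ge> 0"
    have "t \<noteq> - a" using Pos_not_minus[OF S_Pos[OF that]] tPos by auto
    then have "t + a \<in> R" using add_root[of t a] t that S_R n by auto
    then show False using tmax[of "t + a"] that by (simp add: ht_add ht_S)
  qed
  have full: "cf t a > 0" if "a \<in> S" for a
    by (rule full_support[OF Pos_cf[OF tPos] root_nz[OF t] dom that])
  have "nonneg_comb S (t - b)" if "b \<in> R" for b
    using that
  proof (induction "nat \<lfloor>ht t - ht b\<rfloor>" arbitrary: b rule: less_induct)
    case less
    show ?case
    proof (cases "b \<in> Pos")
      case False
      then have "nonneg_comb S (t + - b)"
        using Pos_cases[OF less.prems] tPos Pos_comb nonneg_comb_add by blast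
      then show ?thesis by simp
    next
      case True
      show ?thesis
      proof (cases "\<exists>a\<in>S. b + a \<in> R")
        case True
        then obtain a where a: "a \<in> S" "b + a \<in> R" by blast
        have "ht (b + a) = ht b + 1" using a by (simp add: ht_add ht_S)
        then have "nat \<lfloor>ht t - ht (b + a)\<rfloor> < nat \<lfloor>ht t - ht b\<rfloor>"
          using tmax[OF a(2)] by linarith
        from less.hyps[OF this a(2)] have "nonneg_comb S ((t - (b + a)) + a)"
          using nonneg_comb_add Pos_comb[OF S_Pos[OF a(1)]] by blast
        then show ?thesis by simp
      next
        case no: False
        have bd: "a \<bullet> b \<ge> 0" if "a \<in> S" for a
        proof (rule ccontr)
          assume n: "\<not> a \<bullet> b \<ge> 0"
          have "b \<noteq> - a" using Pos_not_minus[OF S_Pos[OF that]] \<open>b \<in> Pos\<close> by auto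
          then have "b + a \<in> R" using add_root[of b a] less.prems that S_R n by (auto simp: inner_commute)
          then show False using no that by auto
        qed
        obtain a where a: "a \<in> S" "b \<bullet> a > 0" using acute_simple[OF \<open>b \<in> Pos\<close>] by blast
        have "0 < cf t a * (a \<bullet> b)" using a full by (simp add: inner_commute)
        also have "\<dots> \<le> (\<Sum>x\<in>S. cf t x * (x \<bullet> b))"
          by (rule member_le_sum) (use a finite_S bd less_imp_le[OF full] in auto)
        also have "\<dots> = t \<bullet> b" by (rule inner_cf[symmetric])
        finally have pos: "t \<bullet> b > 0" .
        show ?thesis
        proof (cases "t = b")
          case True
          then show ?thesis by (simp add: nonneg_comb_0)
        next
          case False
          then have r: "t - b \<in> R" using diff_root t less.prems pos by blast
          have "- (t - b) \<notin> Pos"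
            using ht_Pos[of "- (t - b)"] tmax[OF less.prems] by (auto simp: ht_diff ht_minus)
          then show ?thesis using Pos_cases[OF r] Pos_comb by blast
        qed
      qed
    qed
  qed
  then show ?thesis using tPos by blast
qed

abbreviation "\<theta> \<equiv> highest_root R S"

lemma theta_Pos: "\<theta> \<in> Pos" and theta_max: "b \<in> R \<Longrightarrow> nonneg_comb S (\<theta> - b)"
proof -
  obtain t where t: "t \<in> Pos" "\<And>b. b \<in> R \<Longrightarrow> nonneg_comb S (t - b)" using highest_root_ex by blast
  have "\<theta> = t"
    unfolding highest_root_def root_le_def
  proof (rule the_equality)
    show "t \<in> R \<and> (\<forall>\<alpha>\<in>R. nonneg_comb S (t - \<alpha>))" using t Pos_R by blast
    fix u assume u: "u \<in> R \<and> (\<forall>\<alpha>\<in>R. nonneg_comb S (u - \<alpha>))"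
    then have "nonneg_comb S (u - t)" "nonneg_comb S (- (u - t))" using t Pos_R by auto
    then show "u = t" using nonneg_comb_antisym by fastforce
  qed
  then show "\<theta> \<in> Pos" "b \<in> R \<Longrightarrow> nonneg_comb S (\<theta> - b)" using t by auto
qed

lemma theta_R: "\<theta> \<in> R"
  using theta_Pos Pos_R by blast

lemma theta_nz: "\<theta> \<noteq> 0"
  using theta_R root_nz by blast

lemma ht_le_theta: "b \<in> R \<Longrightarrow> ht b \<le> ht \<theta>"
  using ht_nonneg[OF theta_max] by (simp add: ht_diff)

lemma theta_dom:
  assumes "a \<in> S" shows "a \<bullet> \<theta> \<ge> 0"
proof (rule ccontr)
  assume n: "\<not> a \<bullet> \<theta> \<ge> 0"
  have "\<theta> \<noteq> - a" using Pos_not_minus[OF S_Pos[OF assms]] theta_Pos by auto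
  then have "\<theta> + a \<in> R" using add_root[of \<theta> a] theta_R assms S_R n by (auto simp: inner_commute)
  then show False using ht_le_theta[of "\<theta> + a"] assms by (simp add: ht_add ht_S)
qed

lemma theta_dom_Pos: "b \<in> Pos \<Longrightarrow> b \<bullet> \<theta> \<ge> 0"
  using nonneg_comb_inner Pos_comb theta_dom by blast

lemma raise_root:
  assumes b: "b \<in> Pos" and a: "a \<in> S" and neg: "b \<bullet> a < 0"
  shows "refl_root a b \<in> Pos" "ht (refl_root a b) \<ge> ht b + 1"
proof -
  show "refl_root a b \<in> Pos" using refl_simple_Pos[OF b a] neg inner_ge_zero[of a] by (cases "b = a") (auto simp del: inner_ge_zero)
  have "pair b a < 0" using neg pair_nonneg_iff[of a b] S_nz[OF a] by auto
  then have "pair b a \<le> -1" using pair_Ints[of a b] a b S_R Pos_R by (auto elim!: Ints_cases)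
  then show "ht (refl_root a b) \<ge> ht b + 1" using a by (simp add: refl_root_pair ht_diff ht_scale ht_S)
qed

text \<open>Reflecting in a simple root at an obtuse angle raises the height, which
  \<open>\<theta>\<close> bounds. Properties that can be pulled back along such reflections need a
  check only at dominant roots.\<close>

lemma Pos_dominant_induct [consumes 1, case_names raise dominant]:
  assumes "b \<in> Pos"
    and "\<And>b a. b \<in> Pos \<Longrightarrow> a \<in> S \<Longrightarrow> b \<bullet> a < 0 \<Longrightarrow> refl_root a b \<in> Pos \<Longrightarrow> Q (refl_root a b) \<Longrightarrow> Q b"
    and "\<And>b. b \<in> Pos \<Longrightarrow> (\<And>a. a \<in> S \<Longrightarrow> a \<bullet> b \<ge> 0) \<Longrightarrow> Q b"
  shows "Q b"
  using assms(1)
proof (induction "nat \<lfloor>ht \<theta> - ht b\<rfloor>" arbitrary: b rule: less_induct)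
  case less
  show ?case
  proof (cases "\<exists>a\<in>S. b \<bullet> a < 0")
    case True
    then obtain a where a: "a \<in> S" "b \<bullet> a < 0" by blast
    note r = raise_root[OF less.prems a]
    have "nat \<lfloor>ht \<theta> - ht (refl_root a b)\<rfloor> < nat \<lfloor>ht \<theta> - ht b\<rfloor>"
      using r ht_le_theta[of "refl_root a b"] Pos_R[of "refl_root a b"] by linarith
    then show ?thesis using less.hyps r(1) assms(2)[OF less.prems a r(1)] by blast
  next
    case False
    then have "a \<bullet> b \<ge> 0" if "a \<in> S" for a using that by (force simp: inner_commute)
    then show ?thesis using assms(3)[OF less.prems] by blast
  qed
qed

text \<open>Length is constant while a root is raised, and for dominant \<open>b\<close> the vectors
  \<open>\<theta> - b\<close> and \<open>\<theta> + b\<close> have non-negative inner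
  product.\<close>

lemma theta_long:
  assumes "b \<in> R" shows "b \<bullet> b \<le> \<theta> \<bullet> \<theta>"
proof -
  have *: "c \<bullet> c \<le> \<theta> \<bullet> \<theta>" if "c \<in> Pos" for c
    using that
  proof (induction rule: Pos_dominant_induct)
    case (raise b a)
    then show ?case using refl_root_inner[of a b b] S_nz by simp
  next
    case (dominant b)
    have "(\<theta> - b) \<bullet> (\<theta> + b) \<ge> 0"
    proof (rule nonneg_comb_inner)
      show "nonneg_comb S (\<theta> - b)" using theta_max Pos_R dominant(1) by blast
      show "a \<bullet> (\<theta> + b) \<ge> 0" if "a \<in> S" for a
        using theta_dom[OF that] dominant(2)[OF that] by (simp add: inner_add_right)
    qed
    then show ?case by (simp add: inner_add_right inner_diff_left inner_diff_right inner_commute)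
  qed
  show ?thesis using Pos_cases[OF assms] *[of b] *[of "- b"] by auto
qed

lemma dominant_long:
  assumes "b \<in> Pos" "\<And>a. a \<in> S \<Longrightarrow> a \<bullet> b \<ge> 0" "b \<bullet> b = \<theta> \<bullet> \<theta>" shows "b = \<theta>"
proof -
  have "(\<theta> - b) \<bullet> b \<ge> 0" using nonneg_comb_inner theta_max Pos_R assms by blast
  then have "(\<theta> - b) \<bullet> (\<theta> - b) \<le> 0"
    using assms(3) by (simp add: inner_diff_left inner_diff_right inner_commute)
  then show ?thesis by (simp add: order_antisym_conv inner_eq_zero_iff)
qed

section \<open>The grading by the coroot of \<theta> and its degree-one part\<close>

definition dg :: "'a \<Rightarrow> real" where "dg v = pair v \<theta>"

lemma dg_add: "dg (x + y) = dg x + dg y"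
  and dg_diff: "dg (x - y) = dg x - dg y"
  and dg_minus: "dg (- x) = - dg x"
  and dg_scale: "dg (c *\<^sub>R x) = c * dg x"
  by (simp_all add: dg_def pair_add pair_diff pair_scale)

lemma dg_theta: "dg \<theta> = 2"
  by (simp add: dg_def pair_self theta_nz)

lemma dg_eq_0_iff: "dg v = 0 \<longleftrightarrow> v \<bullet> \<theta> = 0"
  by (simp add: dg_def pair_eq_0_iff theta_nz)

lemma dg_Pos: "b \<in> Pos \<Longrightarrow> dg b \<ge> 0"
  by (simp add: dg_def pair_nonneg_iff theta_nz theta_dom_Pos)

text \<open>As \<open>\<theta>\<close> has maximal length, expanding the squared norms of
  \<open>b - \<theta>\<close> and \<open>b + \<theta>\<close> bounds the degree strictly by 2 in
  absolute value unless one of them vanishes; integrality does the rest.\<close>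

lemma dg_cases:
  assumes "b \<in> R" obtains "b = \<theta>" | "b = - \<theta>" | "dg b = 1" | "dg b = 0" | "dg b = -1"
proof -
  have t: "\<theta> \<bullet> \<theta> > 0" using theta_nz by simp
  have "2 * (b \<bullet> \<theta>) < 2 * (\<theta> \<bullet> \<theta>)" if "b \<noteq> \<theta>"
  proof -
    have "0 < (b - \<theta>) \<bullet> (b - \<theta>)" using that by simp
    then show ?thesis using theta_long[OF assms] by (simp add: inner_diff_left inner_diff_right inner_commute)
  qed
  then have 1: "dg b < 2" if "b \<noteq> \<theta>" using that t by (simp add: dg_def pair_def divide_less_eq)
  have "2 * (b \<bullet> \<theta>) > - 2 * (\<theta> \<bullet> \<theta>)" if "b \<noteq> - \<theta>"
  proof -
    have "b + \<theta> \<noteq> 0" using that by (simp add: eq_neg_iff_add_eq_0)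
    then have "0 < (b + \<theta>) \<bullet> (b + \<theta>)" by simp
    then show ?thesis using theta_long[OF assms] by (simp add: inner_add_left inner_add_right inner_commute)
  qed
  then have 2: "dg b > -2" if "b \<noteq> - \<theta>" using that t by (simp add: dg_def pair_def less_divide_eq)
  obtain m where m: "dg b = of_int m" using pair_Ints[OF theta_R assms] by (auto simp: dg_def elim: Ints_cases)
  show ?thesis
  proof (cases "b = \<theta> \<or> b = - \<theta>")
    case True then show ?thesis using that by blast
  next
    case False
    then have "of_int m < (2::real)" "of_int m > (-2::real)" using 1 2 m by auto
    then have "m < 2" "m > -2" by linarith+
    then have "m = -1 \<or> m = 0 \<or> m = 1" by auto
    then show ?thesis using that m by auto
  qed
qed

lemma dg_2: "b \<in> R \<Longrightarrow> dg b = 2 \<Longrightarrow> b = \<theta>"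
  by (erule dg_cases) (auto simp: dg_minus dg_theta)

abbreviation "P \<equiv> delta1 R S"

lemma P_eq: "P = {b\<in>Pos. dg b = 1}"
  by (simp add: delta1_def pair_coroot dg_def)

lemma P_R: "b \<in> P \<longleftrightarrow> b \<in> R \<and> dg b = 1"
  using Pos_R[of b] Pos_cases[of b] dg_Pos[of "- b"] by (auto simp: P_eq dg_minus)

lemma P_Pos: "b \<in> P \<Longrightarrow> b \<in> Pos"
  by (simp add: P_eq)

lemma finite_P: "finite P"
  using finite_Pos by (simp add: P_eq)

lemma theta_diff_P:
  assumes "b \<in> P" shows "\<theta> - b \<in> P"
proof -
  have "b \<in> R" "dg b = 1" using assms P_R by auto
  then have "b \<noteq> \<theta>" "b \<bullet> \<theta> > 0"
    using dg_theta pair_pos_iff[of \<theta> b] theta_nz by (auto simp: dg_def)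
  then have "\<theta> - b \<in> R" using diff_root theta_R \<open>b \<in> R\<close> by (simp add: inner_commute)
  then show ?thesis using \<open>dg b = 1\<close> P_R by (simp add: dg_diff dg_theta)
qed

lemma Pos_split: "Pos = insert \<theta> (P \<union> {b\<in>Pos. dg b = 0})"
proof -
  have "b = \<theta> \<or> dg b = 1 \<or> dg b = 0" if "b \<in> Pos" for b
    using dg_cases[OF Pos_R[OF that]] dg_Pos[OF that] dg_theta by (force simp: dg_minus)
  then show ?thesis using theta_Pos by (auto simp: P_eq)
qed

lemma sum_Pos_split:
  assumes "\<And>b. b \<in> Pos \<Longrightarrow> dg b = 0 \<Longrightarrow> f b = (0::real)"
  shows "sum f Pos = f \<theta> + sum f P"
proof -
  have "sum f Pos = sum f (insert \<theta> P)"
    by (rule sum.mono_neutral_right) (use finite_Pos Pos_split assms theta_Pos P_Pos in auto)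
  also have "\<dots> = f \<theta> + sum f P"
    using finite_P dg_theta by (subst sum.insert) (auto simp: P_eq)
  finally show ?thesis .
qed

section \<open>Sums of positive roots and of positive coroots\<close>

lemma bij_refl_Pos: "a \<in> S \<Longrightarrow> bij_betw (refl_root a) (Pos - {a}) (Pos - {a})"
proof (rule bij_betwI[where g = "refl_root a"])
  assume a: "a \<in> S"
  show "refl_root a \<in> Pos - {a} \<rightarrow> Pos - {a}"
  proof
    fix b assume b: "b \<in> Pos - {a}"
    have "refl_root a b \<noteq> a"
    proof
      assume "refl_root a b = a"
      then have "b = - a" using refl_root_invol[of a b] refl_root_self[of a] S_nz[OF a] by simp
      then show False using b Pos_not_minus[OF S_Pos[OF a]] by auto
    qed
    then show "refl_root a b \<in> Pos - {a}" using refl_simple_Pos a b by auto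
  qed
  then show "refl_root a \<in> Pos - {a} \<rightarrow> Pos - {a}" .
qed (use S_nz refl_root_invol in auto)

text \<open>The sum is twice the Weyl vector. The reflection in \<open>a\<close> permutes the
  summands other than \<open>a\<close>, so their sum is orthogonal to \<open>a\<close>.\<close>

lemma pair_Weyl:
  assumes a: "a \<in> S" shows "pair (\<Sum>b\<in>Pos. b) a = 2"
proof -
  let ?r = "\<Sum>b\<in>Pos. b" and ?r' = "\<Sum>b\<in>Pos - {a}. b"
  have r: "?r = a + ?r'" using S_Pos[OF a] finite_Pos by (simp add: sum.remove)
  have "refl_root a ?r' = ?r'"
    unfolding refl_root_sum using sum.reindex_bij_betw[OF bij_refl_Pos[OF a], of "\<lambda>b. b"] by simp
  then have "pair ?r' a = 0" using S_nz[OF a] by (simp add: refl_root_pair)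
  then show ?thesis using r S_nz[OF a] by (simp add: pair_add pair_self)
qed

lemma coWeyl:
  assumes a: "a \<in> S" shows "a \<bullet> (\<Sum>b\<in>Pos. coroot b) = 2"
proof -
  let ?r' = "\<Sum>b\<in>Pos - {a}. coroot b"
  have r: "(\<Sum>b\<in>Pos. coroot b) = coroot a + ?r'" using S_Pos[OF a] finite_Pos by (simp add: sum.remove)
  have "refl_root a ?r' = ?r'"
    unfolding refl_root_sum
    using sum.reindex_bij_betw[OF bij_refl_Pos[OF a], of coroot] S_nz[OF a] by (simp add: refl_root_coroot)
  then have "?r' \<bullet> a = 0" using S_nz[OF a] by (simp add: refl_root_pair pair_eq_0_iff)
  then show ?thesis using r S_nz[OF a] pair_coroot[of a a] by (simp add: inner_add_right inner_commute pair_self)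
qed

text \<open>Pairing with the sum of the positive coroots doubles the height by
  \<open>coWeyl\<close>; positive roots of degree 0 contribute nothing to the pairing with
  \<open>\<theta>\<close>.\<close>

lemma ht_theta: "2 * ht \<theta> = 2 + (\<Sum>b\<in>P. pair \<theta> b)"
proof -
  have "\<theta> \<bullet> (\<Sum>b\<in>Pos. coroot b) = (\<Sum>a\<in>S. cf \<theta> a * 2)"
    unfolding inner_cf[of \<theta>] by (rule sum.cong) (simp_all add: coWeyl)
  then have "2 * ht \<theta> = (\<Sum>b\<in>Pos. pair \<theta> b)"
    by (simp add: ht_def inner_sum_right pair_coroot sum_distrib_left mult.commute)
  also have "\<dots> = pair \<theta> \<theta> + (\<Sum>b\<in>P. pair \<theta> b)"
    by (rule sum_Pos_split) (auto simp: dg_eq_0_iff pair_def inner_commute)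
  finally show ?thesis by (simp add: pair_self theta_nz)
qed

end

section \<open>Heights and the number of roots\<close>

lemma coeffs_eqI:
  assumes "\<And>c'. (\<forall>\<gamma>. \<gamma> \<notin> B \<longrightarrow> c' \<gamma> = 0) \<Longrightarrow> v = (\<Sum>\<gamma>\<in>B. of_int (c' \<gamma>) *\<^sub>R \<gamma>) \<Longrightarrow> c' = c"
    and "\<forall>\<gamma>. \<gamma> \<notin> B \<longrightarrow> c \<gamma> = 0" "v = (\<Sum>\<gamma>\<in>B. of_int (c \<gamma>) *\<^sub>R \<gamma>)"
  shows "coeffs B v = c"
  unfolding coeffs_def by (rule the_equality) (use assms in blast)+

context based_root_system
begin

lemma height_ht:
  assumes "b \<in> R" shows "of_int (height S b) = ht b"
proof -
  define c where "c a = (if a \<in> S then \<lfloor>cf b a\<rfloor> else 0)" for a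
  have c: "of_int (c a) = cf b a" if "a \<in> S" for a
    using root_cf_Ints[OF assms that] that by (auto simp: c_def elim!: Ints_cases)
  have "coeffs S b = c"
  proof (rule coeffs_eqI)
    have "(\<Sum>a\<in>S. of_int (c a) *\<^sub>R a) = (\<Sum>a\<in>S. cf b a *\<^sub>R a)"
      by (rule sum.cong) (simp_all add: c)
    then show "b = (\<Sum>a\<in>S. of_int (c a) *\<^sub>R a)" by (simp only: cf_expand)
  next
    fix c' :: "'a \<Rightarrow> int" assume z: "\<forall>a. a \<notin> S \<longrightarrow> c' a = 0" and e: "b = (\<Sum>a\<in>S. of_int (c' a) *\<^sub>R a)"
    have "c' a = c a" for a
    proof (cases "a \<in> S")
      case True
      have "of_int (c' a) = cf b a" unfolding e by (rule cf_comb[OF True, symmetric])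
      then show ?thesis using c[OF True] by linarith
    next
      case False then show ?thesis using z by (simp add: c_def)
    qed
    then show "c' = c" by blast
  qed (simp add: c_def)
  then show ?thesis by (simp add: height_def ht_def c)
qed

text \<open>\<open>coheight\<close> needs an integral expansion in simple coroots. Descending by
  simple reflections provides it, since \<open>coroot (refl_root x b)\<close> differs from
  \<open>coroot b\<close> by an integer multiple of \<open>coroot x\<close>.\<close>

lemma coroot_comb:
  assumes "b \<in> Pos" shows "\<exists>c::'a \<Rightarrow> int. coroot b = (\<Sum>a\<in>S. of_int (c a) *\<^sub>R coroot a)"
  using assms
proof (induction "nat \<lfloor>ht b\<rfloor>" arbitrary: b rule: less_induct)
  case less
  show ?case
  proof (cases "b \<in> S")
    case True
    have "(\<Sum>a\<in>S. of_int (if a = b then 1 else 0) *\<^sub>R coroot a) = (\<Sum>a\<in>S. if a = b then coroot a else 0)"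
      by (rule sum.cong) auto
    also have "\<dots> = coroot b" using True finite_S by simp
    finally show ?thesis by (intro exI[of _ "\<lambda>a. if a = b then 1 else 0"]) simp
  next
    case False
    obtain x where x: "x \<in> S" "b \<bullet> x > 0" using acute_simple[OF less.prems] by blast
    have bR: "b \<in> R" "x \<in> R" "x \<noteq> 0" using less.prems x Pos_R S_R S_nz by auto
    have ne: "b \<noteq> x" using x False by auto
    have P': "refl_root x b \<in> Pos" by (rule refl_simple_Pos) (use x ne less.prems in auto)
    have "pair b x > 0" using x bR by (simp add: pair_pos_iff)
    then have "pair b x \<ge> 1" using pair_Ints[of x b] bR by (auto elim!: Ints_cases)
    then have "ht (refl_root x b) \<le> ht b - 1" using x by (simp add: refl_root_pair ht_diff ht_scale ht_S)
    then have "nat \<lfloor>ht (refl_root x b)\<rfloor> < nat \<lfloor>ht b\<rfloor>" using ht_Pos[OF less.prems] by linarith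
    from less.hyps[OF this P'] obtain c where
      c: "coroot (refl_root x b) = (\<Sum>a\<in>S. of_int (c a) *\<^sub>R coroot a)" by blast
    obtain m where m: "pair x b = of_int m" using pair_Ints[of b x] bR by (auto elim: Ints_cases)
    have "coroot (refl_root x b) = coroot b - of_int m *\<^sub>R coroot x"
    proof -
      have "coroot (refl_root x b) = refl_root x (coroot b)" using bR by (simp add: refl_root_coroot)
      also have "\<dots> = coroot b - pair (coroot b) x *\<^sub>R x" by (rule refl_root_pair)
      also have "pair (coroot b) x *\<^sub>R x = pair x b *\<^sub>R coroot x"
        by (simp add: pair_def coroot_def inner_commute)
      finally show ?thesis using m by simp
    qed
    then have "coroot b = (\<Sum>a\<in>S. of_int (c a) *\<^sub>R coroot a) + of_int m *\<^sub>R coroot x" using c by (simp add: algebra_simps)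
    also have "of_int m *\<^sub>R coroot x = (\<Sum>a\<in>S. if a = x then of_int m *\<^sub>R coroot a else 0)"
      using x finite_S by simp
    also have "(\<Sum>a\<in>S. of_int (c a) *\<^sub>R coroot a) + \<dots> = (\<Sum>a\<in>S. of_int (c a + (if a = x then m else 0)) *\<^sub>R coroot a)"
      unfolding sum.distrib[symmetric] by (rule sum.cong) (auto simp: scaleR_left_distrib)
    finally show ?thesis by (rule exI[of _ "\<lambda>a. c a + (if a = x then m else 0)"])
  qed
qed

lemma inj_coroot_S: "inj_on coroot S"
  using coroot_coroot S_nz by (metis inj_onI)

text \<open>Both sides are the pairing of twice the Weyl vector with the coroot of
  \<open>\<theta>\<close>: expanded in simple coroots, and as the sum of the degrees of the positive
  roots. Consequently half of \<open>card P\<close> is the dual Coxeter number minus 2, the size in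
  the statement.\<close>

lemma coheight_theta: "2 * coheight S (coroot \<theta>) = 2 + int (card P)"
proof -
  obtain m :: "'a \<Rightarrow> int" where m: "coroot \<theta> = (\<Sum>a\<in>S. of_int (m a) *\<^sub>R coroot a)"
    using coroot_comb[OF theta_Pos] by blast
  define c where "c g = (if g \<in> coroot ` S then m (coroot g) else 0)" for g
  have c: "c (coroot a) = m a" if "a \<in> S" for a
    using that S_nz[OF that] by (simp add: c_def coroot_coroot)
  have sumc: "(\<Sum>g\<in>coroot ` S. of_int (d g) *\<^sub>R g) = (\<Sum>a\<in>S. (of_int (d (coroot a)) * (2 / (a \<bullet> a))) *\<^sub>R a)" for d :: "'a \<Rightarrow> int"
    unfolding sum.reindex[OF inj_coroot_S] o_def by (simp add: coroot_def)
  have "coeffs (coroot ` S) (coroot \<theta>) = c"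
  proof (rule coeffs_eqI)
    have "(\<Sum>g\<in>coroot ` S. of_int (c g) *\<^sub>R g) = (\<Sum>a\<in>S. of_int (m a) *\<^sub>R coroot a)"
      unfolding sum.reindex[OF inj_coroot_S] o_def by (rule sum.cong) (simp_all add: c)
    then show "coroot \<theta> = (\<Sum>g\<in>coroot ` S. of_int (c g) *\<^sub>R g)" using m by simp
    fix d :: "'a \<Rightarrow> int"
    assume z: "\<forall>g. g \<notin> coroot ` S \<longrightarrow> d g = 0" and e: "coroot \<theta> = (\<Sum>g\<in>coroot ` S. of_int (d g) *\<^sub>R g)"
    have *: "d (coroot a) = c (coroot a)" if "a \<in> S" for a
    proof -
      have "cf (coroot \<theta>) a = of_int (d (coroot a)) * (2 / (a \<bullet> a))"
        unfolding e sumc by (rule cf_comb[OF that])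
      moreover have "cf (coroot \<theta>) a = of_int (c (coroot a)) * (2 / (a \<bullet> a))"
        unfolding \<open>coroot \<theta> = (\<Sum>g\<in>coroot ` S. of_int (c g) *\<^sub>R g)\<close> sumc by (rule cf_comb[OF that])
      ultimately show ?thesis using S_nz[OF that] by simp
    qed
    show "d = c"
    proof
      fix g show "d g = c g" using * z by (cases "g \<in> coroot ` S") (auto simp: c_def)
    qed
  qed (simp add: c_def)
  then have "coheight S (coroot \<theta>) = (\<Sum>a\<in>S. m a)"
    by (simp add: coheight_def sum.reindex[OF inj_coroot_S] c)
  then have "2 * real_of_int (coheight S (coroot \<theta>)) = (\<Sum>a\<in>S. of_int (m a) * 2)"
    by (simp add: sum_distrib_left mult.commute)
  also have "\<dots> = (\<Sum>a\<in>S. of_int (m a) * ((\<Sum>b\<in>Pos. b) \<bullet> coroot a))"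
    by (rule sum.cong) (simp_all add: pair_coroot pair_Weyl)
  also have "\<dots> = (\<Sum>b\<in>Pos. b) \<bullet> coroot \<theta>"
    unfolding m by (simp add: inner_sum_right)
  also have "\<dots> = (\<Sum>b\<in>Pos. dg b)" by (simp add: pair_coroot dg_def pair_sum)
  also have "\<dots> = dg \<theta> + (\<Sum>b\<in>P. dg b)" by (rule sum_Pos_split) simp
  also have "(\<Sum>b\<in>P. dg b) = (\<Sum>b\<in>P. 1)" by (rule sum.cong) (auto simp: P_eq)
  finally have "real_of_int (2 * coheight S (coroot \<theta>)) = real_of_int (2 + int (card P))"
    by (simp add: dg_theta)
  then show ?thesis by linarith
qed

lemma bij_refl_R: "a \<in> R \<Longrightarrow> bij_betw (refl_root a) R R"
  by (rule bij_betwI[where g = "refl_root a"]) (use refl_R refl_root_invol[OF root_nz] in auto)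

text \<open>The operator \<open>v \<mapsto> \<Sum>b\<in>R. pair v b *\<^sub>R b\<close> commutes with all reflections, hence is a scalar;
  comparing its trace with its value at the highest root counts the roots.\<close>

lemma card_R: "real (card R) = real (card S) * (ht \<theta> + 1)"
proof -
  define T where "T v = (\<Sum>b\<in>R. pair v b *\<^sub>R b)" for v
  have T_linear: "linear T"
    by (rule linearI) (simp_all add: T_def pair_add pair_scale scaleR_left_distrib sum.distrib scaleR_sum_right)
  have T_sym: "T v \<bullet> w = v \<bullet> T w" for v w
    by (simp add: T_def inner_sum_left inner_sum_right pair_def inner_commute mult.commute mult.left_commute)
  have T_refl: "T (refl_root a v) = refl_root a (T v)" if "a \<in> R" for a v
  proof -
    have "T (refl_root a v) = (\<Sum>b\<in>R. pair (refl_root a v) (refl_root a b) *\<^sub>R refl_root a b)"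
      unfolding T_def by (rule sum.reindex_bij_betw[OF bij_refl_R[OF that], symmetric])
    also have "\<dots> = (\<Sum>b\<in>R. pair v b *\<^sub>R refl_root a b)"
      using root_nz[OF that] by (simp add: pair_def refl_root_inner)
    finally show ?thesis by (simp add: T_def refl_root_sum refl_root_scale)
  qed
  define k where "k a = pair (T a) a / 2" for a
  have Tk: "T a = k a *\<^sub>R a" if "a \<in> R" for a
  proof -
    have "refl_root a (T a) = - T a"
      using T_refl[OF that, of a] root_nz[OF that] linear_neg[OF T_linear, of a] by (simp add: refl_root_self)
    then have "2 *\<^sub>R T a = pair (T a) a *\<^sub>R a" by (simp add: refl_root_pair scaleR_2 algebra_simps)
    then have "(1/2) *\<^sub>R (2 *\<^sub>R T a) = (1/2) *\<^sub>R (pair (T a) a *\<^sub>R a)" by simp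
    then show ?thesis by (simp add: k_def)
  qed
  obtain a0 where a0: "a0 \<in> S" using S_nonempty by blast
  \<comment> \<open>Symmetry of \<open>T\<close> makes the eigenvalues agree along an edge; the
    diagram is connected.\<close>
  have kk: "k a = k a0" if "a \<in> S" for a
  proof (rule ccontr)
    assume n: "k a \<noteq> k a0"
    define A where "A = {a\<in>S. k a = k a0}"
    have "A \<subseteq> S" "A \<noteq> {}" "A \<noteq> S" using a0 n that unfolding A_def by auto
    then obtain b c where bc: "b \<in> A" "c \<in> S - A" "b \<bullet> c < 0" using S_connected[of A] by metis
    have "T b \<bullet> c = b \<bullet> T c" by (rule T_sym)
    then have "k b = k c" using Tk[of b] Tk[of c] bc S_R unfolding A_def by auto
    then show False using bc unfolding A_def by auto
  qed
  have T: "T v = k a0 *\<^sub>R v" for v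
  proof -
    have "T v = T (\<Sum>a\<in>S. cf v a *\<^sub>R a)" by (simp only: cf_expand)
    also have "\<dots> = (\<Sum>a\<in>S. cf v a *\<^sub>R T a)" by (simp add: linear_sum[OF T_linear] linear_scale[OF T_linear])
    also have "\<dots> = (\<Sum>a\<in>S. k a0 *\<^sub>R (cf v a *\<^sub>R a))"
      by (rule sum.cong) (simp_all add: Tk S_R kk)
    also have "\<dots> = k a0 *\<^sub>R v" by (simp only: scaleR_sum_right[symmetric] cf_expand)
    finally show ?thesis .
  qed
  \<comment> \<open>Two ways to compute the trace: each root contributes a map of rank one and trace
    2.\<close>
  have "2 * real (card R) = k a0 * real (card S)"
  proof -
    have "(\<Sum>b\<in>Basis. T b \<bullet> b) = k a0 * real (card S)" by (simp add: T card_S)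
    moreover have "(\<Sum>b\<in>Basis. T b \<bullet> b) = (\<Sum>g\<in>R. \<Sum>b\<in>Basis. pair b g * (g \<bullet> b))"
      unfolding T_def inner_sum_left by (subst sum.swap) simp
    moreover have "(\<Sum>b\<in>Basis. pair b g * (g \<bullet> b)) = 2" if "g \<in> R" for g
    proof -
      have "(\<Sum>b\<in>Basis. pair b g * (g \<bullet> b)) = 2 / (g \<bullet> g) * (\<Sum>b\<in>Basis. (g \<bullet> b) * (g \<bullet> b))"
        by (simp add: pair_def sum_distrib_left inner_commute mult.assoc)
      then show ?thesis using root_nz[OF that] by (simp add: euclidean_inner[symmetric])
    qed
    ultimately show ?thesis by simp
  qed
  \<comment> \<open>Among the positive roots, \<open>\<theta>\<close> contributes 4 to the degree of
    \<open>T \<theta>\<close> and the degree-one roots together \<open>2 * ht \<theta> - 2\<close>;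
    the negative roots double this.\<close>
  moreover have "k a0 = 2 * ht \<theta> + 2"
  proof -
    have bij: "R = Pos \<union> uminus ` Pos" "Pos \<inter> uminus ` Pos = {}"
      using Pos_cases Pos_R Pos_not_minus by (auto simp: image_iff) (metis minus_minus)
    have "2 * k a0 = dg (T \<theta>)" by (simp add: T dg_scale dg_theta)
    also have "\<dots> = (\<Sum>b\<in>R. pair \<theta> b * dg b)" by (simp add: T_def dg_def pair_sum pair_scale)
    also have "\<dots> = (\<Sum>b\<in>Pos \<union> uminus ` Pos. pair \<theta> b * dg b)"
      by (rule arg_cong[OF bij(1)])
    also have "\<dots> = (\<Sum>b\<in>Pos. pair \<theta> b * dg b) + (\<Sum>b\<in>uminus ` Pos. pair \<theta> b * dg b)"
      by (rule sum.union_disjoint[OF finite_Pos finite_imageI[OF finite_Pos] bij(2)])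
    also have "(\<Sum>b\<in>uminus ` Pos. pair \<theta> b * dg b) = (\<Sum>b\<in>Pos. pair \<theta> b * dg b)"
      by (subst sum.reindex) (simp_all add: dg_minus pair_def inj_on_def)
    also have "(\<Sum>b\<in>Pos. pair \<theta> b * dg b) = 2 * 2 + (\<Sum>b\<in>P. pair \<theta> b * dg b)"
      by (subst sum_Pos_split) (simp_all add: dg_theta pair_self theta_nz)
    also have "(\<Sum>b\<in>P. pair \<theta> b * dg b) = (\<Sum>b\<in>P. pair \<theta> b)"
      by (rule sum.cong) (auto simp: P_eq)
    finally show ?thesis using ht_theta by simp
  qed
  ultimately show ?thesis by (simp add: algebra_simps)
qed

section \<open>The Weyl group\<close>

definition act :: "'a list \<Rightarrow> 'a \<Rightarrow> 'a" where
  "act ws = foldr (\<lambda>a f. refl_root a \<circ> f) ws id"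

lemma act_Nil [simp]: "act [] = id"
  and act_Cons [simp]: "act (a # ws) = refl_root a \<circ> act ws"
  by (simp_all add: act_def)

lemma act_append: "act (xs @ ys) = act xs \<circ> act ys"
  by (induction xs) (simp_all add: o_assoc)

lemma act_linear: "linear (act ws)"
proof (induction ws)
  case Nil
  show ?case using linear_id by (simp add: id_def)
next
  case (Cons a ws)
  show ?case using linear_compose[OF Cons refl_root_linear[of a]] by (simp only: act_Cons)
qed

lemma act_inner: "set ws \<subseteq> S \<Longrightarrow> act ws x \<bullet> act ws y = x \<bullet> y"
  by (induction ws) (simp_all add: refl_root_inner S_nz)

lemma act_R: "set ws \<subseteq> S \<Longrightarrow> b \<in> R \<Longrightarrow> act ws b \<in> R"
  by (induction ws) (simp_all add: refl_R S_R)

lemma act_rev: "set ws \<subseteq> S \<Longrightarrow> act (rev ws) (act ws x) = x"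
proof (induction ws arbitrary: x)
  case (Cons a ws)
  then show ?case by (simp add: act_append refl_root_invol S_nz)
qed simp

text \<open>At the letter \<open>b\<close> that turns the image of \<open>a\<close> negative, that
  image is \<open>b\<close> itself. So \<open>b\<close> in front of the remaining word equals
  \<open>a\<close> behind it, and cancels against the appended \<open>a\<close>.\<close>

lemma act_exchange:
  assumes "set ws \<subseteq> S" "a \<in> S" "act ws a \<notin> Pos"
  shows "\<exists>us. set us \<subseteq> S \<and> length us < length ws \<and> act (ws @ [a]) = act us"
  using assms
proof (induction ws)
  case Nil
  then show ?case using S_Pos by simp
next
  case (Cons b ws)
  show ?case
  proof (cases "act ws a \<in> Pos")
    case False
    then obtain us where us: "set us \<subseteq> S" "length us < length ws" "act (ws @ [a]) = act us"
      using Cons by auto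
    then have "act ((b # ws) @ [a]) = act (b # us)" by (simp add: act_append)
    then show ?thesis using us Cons.prems by (intro exI[of _ "b # us"]) auto
  next
    case True
    then have "act ws a = b"
      using refl_simple_Pos[OF True, of b] Cons.prems by auto
    then have "refl_root b (act ws x) = act ws (refl_root a x)" for x
      using refl_root_conj[OF act_linear act_inner[of ws], of a x] Cons.prems by simp
    then have "act ((b # ws) @ [a]) = act ws"
      using S_nz[OF Cons.prems(2)] by (simp add: act_append fun_eq_iff refl_root_invol)
    then show ?thesis using Cons.prems by (intro exI[of _ ws]) auto
  qed
qed

text \<open>If the word ends in \<open>a\<close>, its prefix sends \<open>a\<close> to a negative
  root, so the exchange property yields a shorter word for the same map.\<close>

lemma act_Pos_id:
  assumes "set ws \<subseteq> S" "\<And>b. b \<in> Pos \<Longrightarrow> act ws b \<in> Pos"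
  shows "act ws = id"
  using assms
proof (induction "length ws" arbitrary: ws rule: less_induct)
  case less
  show ?case
  proof (cases ws rule: rev_cases)
    case Nil
    then show ?thesis by simp
  next
    case (snoc vs a)
    have a: "a \<in> S" and vs: "set vs \<subseteq> S" using less.prems snoc by auto
    have "act ws a = - act vs a"
      using S_nz[OF a] by (simp add: snoc act_append refl_root_self linear_neg[OF act_linear])
    then have "- act vs a \<in> Pos" using less.prems(2)[OF S_Pos[OF a]] by simp
    then have "act vs a \<notin> Pos" using Pos_not_minus by blast
    then obtain us where us: "set us \<subseteq> S" "length us < length vs" "act ws = act us"
      using act_exchange[OF vs a] snoc by auto
    then show ?thesis using less.hyps[of us] less.prems(2) snoc by simp
  qed
qed

definition Wg :: "('a \<Rightarrow> 'a) set" where "Wg = {act ws | ws. set ws \<subseteq> S}"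

lemma Wg_id: "id \<in> Wg"
  unfolding Wg_def by (intro CollectI exI[of _ "[]"]) simp

lemma Wg_comp: "u \<in> Wg \<Longrightarrow> w \<in> Wg \<Longrightarrow> u \<circ> w \<in> Wg"
  unfolding Wg_def by (auto simp: act_append[symmetric]) (metis set_append Un_least)

lemma Wg_refl: "a \<in> S \<Longrightarrow> refl_root a \<in> Wg"
  unfolding Wg_def by (intro CollectI exI[of _ "[a]"]) simp

lemma Wg_linear: "w \<in> Wg \<Longrightarrow> linear w"
  and Wg_inner: "w \<in> Wg \<Longrightarrow> w x \<bullet> w y = x \<bullet> y"
  and Wg_R: "w \<in> Wg \<Longrightarrow> b \<in> R \<Longrightarrow> w b \<in> R"
  by (auto simp: Wg_def act_linear act_inner act_R)

lemma Wg_inv: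
  assumes "w \<in> Wg" obtains u where "u \<in> Wg" "\<And>x. u (w x) = x" "\<And>x. w (u x) = x"
proof -
  obtain ws where ws: "w = act ws" "set ws \<subseteq> S" using assms by (auto simp: Wg_def)
  have "act (rev ws) \<in> Wg" using ws by (auto simp: Wg_def intro!: exI[of _ "rev ws"])
  moreover have "act (rev ws) (w x) = x" "w (act (rev ws) x) = x" for x
    using ws act_rev[of ws x] act_rev[of "rev ws" x] by auto
  ultimately show ?thesis using that by blast
qed

lemma Wg_Pos_id: "w \<in> Wg \<Longrightarrow> (\<And>b. b \<in> Pos \<Longrightarrow> w b \<in> Pos) \<Longrightarrow> w = id"
  using act_Pos_id by (auto simp: Wg_def)

section \<open>Ideals and long roots\<close>

lemma dg_cf: "dg v = (\<Sum>a\<in>S. cf v a * dg a)"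
proof -
  have "dg v = dg (\<Sum>a\<in>S. cf v a *\<^sub>R a)" by (simp only: cf_expand)
  then show ?thesis by (simp add: dg_def pair_sum pair_scale)
qed

lemma dg_support:
  assumes "nonneg_comb S v" "dg v = 0" "a \<in> S" "cf v a \<noteq> 0" shows "dg a = 0"
proof -
  have "(\<Sum>a\<in>S. cf v a * dg a) = 0" unfolding dg_cf[symmetric] by (rule assms(2))
  moreover have "cf v a * dg a \<ge> 0" if "a \<in> S" for a
    using nonneg_comb_cf[OF assms(1) that] dg_Pos[OF S_Pos[OF that]] by simp
  ultimately have "cf v a * dg a = 0"
    using sum_nonneg_eq_0_iff[OF finite_S, of "\<lambda>a. cf v a * dg a"] assms(3) by blast
  then show ?thesis using assms(4) by simp
qed

text \<open>These are the minimal-length representatives of the cosets of the stabiliser of \<open>\<theta>\<close>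
  that keep \<open>\<theta>\<close> positive; \<open>Iw w\<close> is the inversion set of \<open>w\<close>. On ideals, \<open>dual\<close>
  corresponds to \<open>w \<theta> \<mapsto> - w \<theta>\<close>.\<close>

definition good :: "('a \<Rightarrow> 'a) \<Rightarrow> bool" where
  "good w \<longleftrightarrow> w \<in> Wg \<and> (\<forall>b\<in>Pos. dg b = 0 \<longrightarrow> w b \<in> Pos) \<and> w \<theta> \<in> Pos"

definition Iw :: "('a \<Rightarrow> 'a) \<Rightarrow> 'a set" where
  "Iw w = {g\<in>P. w g \<notin> Pos}"

abbreviation "J \<equiv> lower_ideals P (root_le S)"

definition dual :: "'a set \<Rightarrow> 'a set" where
  "dual K = {g\<in>P. \<theta> - g \<notin> K}"

text \<open>The only root of degree 2 is \<open>\<theta>\<close>, so this says that no two elements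
  of \<open>K\<close> add up to a root: the corresponding root vectors commute.\<close>

definition abel :: "'a set \<Rightarrow> bool" where
  "abel K \<longleftrightarrow> (\<forall>g\<in>K. \<theta> - g \<notin> K)"

lemma good_Wg: "good w \<Longrightarrow> w \<in> Wg"
  and good_dg0: "good w \<Longrightarrow> b \<in> Pos \<Longrightarrow> dg b = 0 \<Longrightarrow> w b \<in> Pos"
  and good_theta: "good w \<Longrightarrow> w \<theta> \<in> Pos"
  by (simp_all add: good_def)

lemma Wg_add: "w \<in> Wg \<Longrightarrow> w (x + y) = w x + w y"
  and Wg_diff: "w \<in> Wg \<Longrightarrow> w (x - y) = w x - w y"
  and Wg_minus: "w \<in> Wg \<Longrightarrow> w (- x) = - w x"
  and Wg_scale: "w \<in> Wg \<Longrightarrow> w (c *\<^sub>R x) = c *\<^sub>R w x"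
  using Wg_linear[of w] by (auto simp: linear_add linear_diff linear_neg linear_scale)

lemma J_sub: "K \<in> J \<Longrightarrow> K \<subseteq> P"
  and J_down: "K \<in> J \<Longrightarrow> x \<in> K \<Longrightarrow> y \<in> P \<Longrightarrow> nonneg_comb S (x - y) \<Longrightarrow> y \<in> K"
  by (auto simp: lower_ideals_def root_le_def)

lemma JI: "K \<subseteq> P \<Longrightarrow> (\<And>x y. x \<in> K \<Longrightarrow> y \<in> P \<Longrightarrow> nonneg_comb S (x - y) \<Longrightarrow> y \<in> K) \<Longrightarrow> K \<in> J"
  by (auto simp: lower_ideals_def root_le_def)

lemma finite_J: "finite J"
  by (rule finite_subset[of _ "Pow P"]) (use finite_P J_sub in auto)

lemma good_nonneg:
  assumes w: "good w" and v: "nonneg_comb S v" "dg v = 0" shows "nonneg_comb S (w v)"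
proof -
  have "w v = w (\<Sum>a\<in>S. cf v a *\<^sub>R a)" by (simp only: cf_expand)
  also have "\<dots> = (\<Sum>a\<in>S. cf v a *\<^sub>R w a)"
    using Wg_linear[OF good_Wg[OF w]] by (simp add: linear_sum linear_scale)
  finally have wv: "w v = (\<Sum>a\<in>S. cf v a *\<^sub>R w a)" .
  have "cf (cf v a *\<^sub>R w a) b \<in> \<nat>" if ab: "a \<in> S" "b \<in> S" for a b
  proof (cases "cf v a = 0")
    case False
    have "dg a = 0" by (rule dg_support[OF v ab(1) False])
    then have "nonneg_comb S (w a)" using good_dg0[OF w S_Pos[OF ab(1)]] Pos_comb by blast
    then show ?thesis using v(1) ab by (simp add: nonneg_comb_iff cf_scale)
  qed (simp add: cf_scale)
  then show ?thesis unfolding nonneg_comb_iff wv cf_sum by (intro ballI sum_Nats) blast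
qed

text \<open>Elements of \<open>P\<close> differ by vectors of degree 0, and a good \<open>w\<close>
  keeps non-negative combinations of degree 0 non-negative. So \<open>w\<close> cannot be positive
  at the smaller element and negative at the larger.\<close>

lemma Iw_J:
  assumes w: "good w" shows "Iw w \<in> J"
proof (rule JI)
  fix x y assume x: "x \<in> Iw w" and y: "y \<in> P" and le: "nonneg_comb S (x - y)"
  show "y \<in> Iw w"
  proof (rule ccontr)
    assume "y \<notin> Iw w"
    then have wy: "w y \<in> Pos" using y by (simp add: Iw_def)
    have xP: "x \<in> P" using x by (simp add: Iw_def)
    have "nonneg_comb S (w (x - y))"
      by (rule good_nonneg[OF w le]) (use xP y in \<open>simp add: dg_diff P_eq\<close>)
    then have "nonneg_comb S (w y + w (x - y))" using Pos_comb[OF wy] nonneg_comb_add by blast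
    then have "nonneg_comb S (w x)" using good_Wg[OF w] by (simp add: Wg_diff)
    then have "w x \<in> Pos" using PosI Wg_R[OF good_Wg[OF w]] xP P_R by blast
    then show False using x by (simp add: Iw_def)
  qed
qed (auto simp: Iw_def)

text \<open>The quotient of \<open>w'\<close> by \<open>w\<close> fixes \<open>\<theta>\<close>,
  hence preserves degrees. A positive root that it makes negative would have degree 0, where both
  maps preserve positivity.\<close>

lemma good_uniq:
  assumes w: "good w" and w': "good w'" and eq: "w \<theta> = w' \<theta>" shows "w = w'"
proof -
  note W = good_Wg[OF w] and W' = good_Wg[OF w']
  obtain u where u: "u \<in> Wg" "\<And>x. u (w x) = x" "\<And>x. w (u x) = x" using Wg_inv[OF W] by blast
  have dgu: "dg (u (w' b)) = dg b" for b
  proof -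
    have "u (w' \<theta>) = \<theta>" using eq u(2)[of \<theta>] by simp
    then have "u (w' b) \<bullet> \<theta> = u (w' b) \<bullet> u (w' \<theta>)" by simp
    also have "\<dots> = b \<bullet> \<theta>" using Wg_inner[OF u(1)] Wg_inner[OF W'] by simp
    finally show ?thesis by (simp add: dg_def pair_def)
  qed
  have "u \<circ> w' = id"
  proof (rule Wg_Pos_id)
    show "u \<circ> w' \<in> Wg" using Wg_comp u(1) W' by blast
    fix b assume b: "b \<in> Pos"
    have r: "u (w' b) \<in> R" using Wg_R u(1) W' Pos_R b by blast
    have "u (w' b) \<in> Pos"
    proof (rule ccontr)
      assume n: "u (w' b) \<notin> Pos"
      then have m: "- u (w' b) \<in> Pos" using Pos_cases[OF r] by blast
      then have "dg b = 0" using dg_Pos[OF m] dg_Pos[OF b] by (simp add: dg_minus dgu)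
      then have "w (- u (w' b)) \<in> Pos" using good_dg0[OF w m] by (simp add: dg_minus dgu)
      then have "- w' b \<in> Pos" using u by (simp add: Wg_minus[OF W])
      then show False using good_dg0[OF w' b \<open>dg b = 0\<close>] Pos_not_minus by blast
    qed
    then show "(u \<circ> w') b \<in> Pos" by simp
  qed
  then have "u (w' x) = x" for x by (simp add: fun_eq_iff)
  then have "w x = w' x" for x using u(3)[of "w' x"] by simp
  then show ?thesis by blast
qed

lemma good_uniq_Iw:
  assumes w: "good w" and w': "good w'" and eq: "Iw w = Iw w'" shows "w = w'"
proof -
  note W = good_Wg[OF w] and W' = good_Wg[OF w']
  obtain u where u: "u \<in> Wg" "\<And>x. u (w x) = x" "\<And>x. w (u x) = x" using Wg_inv[OF W] by blast
  have pres: "w d \<in> Pos \<longleftrightarrow> w' d \<in> Pos" if d: "d \<in> Pos" for d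
  proof -
    consider "d = \<theta>" | "d \<in> P" | "dg d = 0" using d Pos_split by blast
    then show ?thesis
    proof cases
      case 1 then show ?thesis using good_theta w w' by simp
    next
      case 2 then show ?thesis using eq by (auto simp: Iw_def)
    next
      case 3 then show ?thesis using good_dg0 w w' d by simp
    qed
  qed
  have "w' \<circ> u = id"
  proof (rule Wg_Pos_id)
    show "w' \<circ> u \<in> Wg" using Wg_comp u(1) W' by blast
    fix b assume b: "b \<in> Pos"
    have r: "u b \<in> R" using Wg_R u(1) Pos_R b by blast
    have "w' (u b) \<in> Pos"
    proof (cases "u b \<in> Pos")
      case True then show ?thesis using pres[OF True] u(3) b by simp
    next
      case False
      then have m: "- u b \<in> Pos" using Pos_cases[OF r] by blast
      have "w (- u b) \<notin> Pos" using u(3) Pos_not_minus[OF b] by (simp add: Wg_minus[OF W])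
      then have "w' (- u b) \<notin> Pos" using pres[OF m] by simp
      then have "- w' (u b) \<notin> Pos" by (simp add: Wg_minus[OF W'])
      then show ?thesis using Pos_minus_iff[OF Wg_R[OF W' r]] by blast
    qed
    then show "(w' \<circ> u) b \<in> Pos" by simp
  qed
  then have "w' (u x) = x" for x by (simp add: fun_eq_iff)
  then have "w x = w' x" for x using u(2)[of x] by metis
  then show ?thesis by blast
qed

lemma refl_simple_Pos_iff:
  assumes b: "b \<in> R" and a: "a \<in> S"
  shows "refl_root a b \<in> Pos \<longleftrightarrow> (b \<in> Pos) \<noteq> (b = a \<or> b = - a)"
proof -
  have aP: "a \<in> Pos" "- a \<notin> Pos" using S_Pos[OF a] Pos_not_minus by auto
  have ra: "refl_root a a = - a" "refl_root a (- a) = a"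
    using S_nz[OF a] by (simp_all add: refl_root_self refl_root_minus)
  consider "b = a" | "b = - a" | "b \<noteq> a" "b \<noteq> - a" "b \<in> Pos" | "b \<noteq> a" "b \<noteq> - a" "- b \<in> Pos" "b \<notin> Pos"
    using Pos_cases[OF b] by blast
  then show ?thesis
  proof cases
    case 4
    then have "- b \<noteq> a" by auto
    then have "- refl_root a b \<in> Pos" using refl_simple_Pos[OF 4(3) a] by (simp add: refl_root_minus)
    then have "refl_root a b \<notin> Pos" using Pos_not_minus by blast
    then show ?thesis using 4 by simp
  qed (use aP ra refl_simple_Pos[OF _ a] in auto)
qed

text \<open>Composing with the reflection changes signs only at the preimages of \<open>a\<close>
  and \<open>- a\<close>. Since \<open>w \<theta>\<close> is neither orthogonal to \<open>a\<close>
  nor equal to it, the preimage of \<open>a\<close> has degree 1 or -1: no root of degree 0 is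
  affected, and up to sign the preimage lies in \<open>P\<close>.\<close>

lemma good_step:
  assumes w: "good w" and a: "a \<in> S" and n0: "w \<theta> \<bullet> a \<noteq> 0" and ne: "w \<theta> \<noteq> a"
  shows "good (refl_root a \<circ> w)"
    and "Iw (refl_root a \<circ> w) = {g\<in>P. (g \<in> Iw w) \<noteq> (w g = a \<or> w g = - a)}"
    and "\<exists>g\<in>P. w g = a \<or> w g = - a"
proof -
  note W = good_Wg[OF w]
  show "good (refl_root a \<circ> w)"
    unfolding good_def
  proof (intro conjI ballI impI)
    show "refl_root a \<circ> w \<in> Wg" using Wg_comp Wg_refl[OF a] W by blast
    show "(refl_root a \<circ> w) \<theta> \<in> Pos" using refl_simple_Pos[OF good_theta[OF w] a ne] by simp
    fix b assume b: "b \<in> Pos" "dg b = 0"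
    have "w b \<bullet> w \<theta> = 0" using b(2) Wg_inner[OF W] by (simp add: dg_eq_0_iff)
    then have "w b \<noteq> a" using n0 by (auto simp: inner_commute)
    then show "(refl_root a \<circ> w) b \<in> Pos" using refl_simple_Pos[OF good_dg0[OF w b] a] by simp
  qed
  show "Iw (refl_root a \<circ> w) = {g\<in>P. (g \<in> Iw w) \<noteq> (w g = a \<or> w g = - a)}"
  proof -
    have "(refl_root a \<circ> w) g \<notin> Pos \<longleftrightarrow> (g \<in> Iw w) \<noteq> (w g = a \<or> w g = - a)" if "g \<in> P" for g
      using refl_simple_Pos_iff[OF Wg_R[OF W] a, of g] that P_R by (auto simp: Iw_def)
    then show ?thesis unfolding Iw_def[of "refl_root a \<circ> w"] by blast
  qed
  obtain u where u: "u \<in> Wg" "\<And>x. u (w x) = x" "\<And>x. w (u x) = x" using Wg_inv[OF W] by blast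
  have uaR: "u a \<in> R" using Wg_R u(1) S_R a by blast
  have "dg (u a) \<noteq> 0"
  proof
    assume "dg (u a) = 0"
    then have "w (u a) \<bullet> w \<theta> = 0" using Wg_inner[OF W] by (simp add: dg_eq_0_iff)
    then show False using n0 u(3) by (simp add: inner_commute)
  qed
  moreover have "u a \<noteq> \<theta>" using ne u(3)[of a] by auto
  moreover have "u a \<noteq> - \<theta>"
  proof
    assume "u a = - \<theta>"
    then have "a = - w \<theta>" using u(3)[of a] by (simp add: Wg_minus[OF W])
    then show False using good_theta[OF w] Pos_not_minus S_Pos[OF a] by blast
  qed
  ultimately have "u a \<in> P \<or> - u a \<in> P"
    by (rule_tac dg_cases[OF uaR]) (use uaR in \<open>auto simp: P_R dg_minus\<close>)
  moreover have "w (u a) = a" "w (- u a) = - a" using u(3) by (simp_all add: Wg_minus[OF W])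
  ultimately show "\<exists>g\<in>P. w g = a \<or> w g = - a" by blast
qed

lemma good_id: "good id"
  by (simp add: good_def Wg_id theta_Pos)

text \<open>The only dominant root of maximal length is \<open>\<theta>\<close>, so \<open>b\<close>
  climbs to \<open>\<theta>\<close> by simple reflections; \<open>good_step\<close> retraces the
  climb starting from \<open>id\<close>.\<close>

lemma long_good:
  assumes "b \<in> Pos" "b \<bullet> b = \<theta> \<bullet> \<theta>" shows "\<exists>w. good w \<and> w \<theta> = b"
  using assms
proof (induction rule: Pos_dominant_induct)
  case (raise b a)
  have anz: "a \<noteq> 0" by (rule S_nz[OF raise(2)])
  obtain w where w: "good w" "w \<theta> = refl_root a b"
    using raise refl_root_inner[OF anz, of b b] by auto
  have "refl_root a b \<bullet> a = - (b \<bullet> a)"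
    using refl_root_adjoint[of a b a] anz by (simp add: refl_root_self)
  then have n0: "w \<theta> \<bullet> a \<noteq> 0" using raise(3) w by simp
  have "w \<theta> \<noteq> a"
  proof
    assume "w \<theta> = a"
    then have "refl_root a (refl_root a b) = - a" using w anz by (simp add: refl_root_self)
    then show False using raise(1) Pos_not_minus[OF S_Pos[OF raise(2)]] anz by (simp add: refl_root_invol)
  qed
  then have "good (refl_root a \<circ> w)" by (rule good_step(1)[OF w(1) raise(2) n0])
  moreover have "(refl_root a \<circ> w) \<theta> = b" using w anz by (simp add: refl_root_invol)
  ultimately show ?case by blast
next
  case (dominant b)
  then have "b = \<theta>" using dominant_long by blast
  then show ?case using good_id by (metis id_apply)
qed

lemma good_long: "good w \<Longrightarrow> w \<theta> \<bullet> w \<theta> = \<theta> \<bullet> \<theta>"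
  using Wg_inner good_Wg by blast

lemma Iw_abel:
  assumes w: "good w" shows "abel (Iw w)"
  unfolding abel_def
proof (intro ballI notI)
  note W = good_Wg[OF w]
  fix g assume "g \<in> Iw w" "\<theta> - g \<in> Iw w"
  then have "w g \<in> R" "w (\<theta> - g) \<in> R" "w g \<notin> Pos" "w (\<theta> - g) \<notin> Pos"
    using Wg_R[OF W] P_R by (auto simp: Iw_def)
  then have "- w g \<in> Pos" "- w (\<theta> - g) \<in> Pos" by (simp_all add: Pos_minus_iff)
  then have "nonneg_comb S (- w g + - w (\<theta> - g))" using nonneg_comb_add Pos_comb by blast
  then have "nonneg_comb S (- w \<theta>)" by (simp add: Wg_diff[OF W])
  then have "- w \<theta> \<in> Pos" using PosI Wg_R[OF W theta_R] by simp
  then show False using good_theta[OF w] Pos_not_minus by blast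
qed

text \<open>Were \<open>w g\<close> a sum of two positive roots, one preimage would have degree at
  least 1. If it is \<open>\<theta>\<close>, then \<open>\<theta> - g\<close> is inverted, against
  abelianness. If it has degree 1, the other preimage is positive of degree 0, so the first lies
  below \<open>g\<close>, hence in the ideal, yet its image is positive.\<close>

lemma addable_simple:
  assumes w: "good w" and g: "g \<in> P" "g \<notin> Iw w" and K: "insert g (Iw w) \<in> J" and ab: "abel (insert g (Iw w))"
  shows "w g \<in> S" "good (refl_root (w g) \<circ> w)" "Iw (refl_root (w g) \<circ> w) = insert g (Iw w)"
proof -
  note W = good_Wg[OF w]
  obtain u where u: "u \<in> Wg" "\<And>x. u (w x) = x" "\<And>x. w (u x) = x" using Wg_inv[OF W] by blast
  have wg: "w g \<in> Pos" using g by (simp add: Iw_def)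
  have gR: "g \<in> R" "dg g = 1" using g P_R by auto
  have tg: "\<theta> - g \<notin> Iw w" using ab by (auto simp: abel_def)
  have no: False if xy: "x \<in> Pos" "y \<in> Pos" "x + y = w g" and d: "dg (u x) \<ge> 1" for x y
  proof -
    have r: "u x \<in> R" "u y \<in> R" using Wg_R[OF u(1)] Pos_R xy by auto
    have s: "u x + u y = g" using u(2)[of g] xy(3) by (simp add: Wg_add[OF u(1), symmetric])
    have "u x = \<theta> \<or> dg (u x) = 1"
      by (rule dg_cases[OF r(1)]) (use d in \<open>auto simp: dg_minus dg_theta\<close>)
    then show False
    proof
      assume "u x = \<theta>"
      then have "\<theta> - g = - u y" using s by (simp add: algebra_simps)
      then have "w (\<theta> - g) = - y" using u(3) by (simp add: Wg_minus[OF W])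
      then have "w (\<theta> - g) \<notin> Pos" using Pos_not_minus[OF xy(2)] by simp
      then show False using tg theta_diff_P[OF g(1)] by (simp add: Iw_def)
    next
      assume d1: "dg (u x) = 1"
      then have xP: "u x \<in> P" using r P_R by blast
      have d0: "dg (u y) = 0" using d1 gR(2) s dg_add[of "u x" "u y"] by simp
      have uy: "u y \<in> Pos"
      proof (rule ccontr)
        assume "u y \<notin> Pos"
        then have m: "- u y \<in> Pos" using Pos_cases[OF r(2)] by blast
        then have "w (- u y) \<in> Pos" using good_dg0[OF w m] d0 by (simp add: dg_minus)
        then show False using u(3) Pos_not_minus[OF xy(2)] by (simp add: Wg_minus[OF W])
      qed
      have "g - u x = u y" using s by (simp add: algebra_simps)
      then have "nonneg_comb S (g - u x)" using Pos_comb[OF uy] by simp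
      then have "u x \<in> insert g (Iw w)" using J_down[OF K _ xP, of g] by blast
      moreover have "u x \<noteq> g" using s root_nz[OF r(2)] by auto
      ultimately have "w (u x) \<notin> Pos" by (auto simp: Iw_def)
      then show False using u(3) xy(1) by simp
    qed
  qed
  show S: "w g \<in> S"
  proof (rule ccontr)
    assume "w g \<notin> S"
    then obtain a where a: "a \<in> S" "w g - a \<in> Pos" using simple_decomp[OF wg] by blast
    define y where "y = w g - a"
    have xy: "a \<in> Pos" "y \<in> Pos" "a + y = w g" using a S_Pos by (auto simp: y_def)
    have r: "u a \<in> R" "u y \<in> R" using Wg_R[OF u(1)] Pos_R xy by auto
    have "u a + u y = g" using u(2)[of g] xy(3) by (simp add: Wg_add[OF u(1), symmetric])
    then have sum1: "dg (u a) + dg (u y) = 1" using gR(2) dg_add[of "u a" "u y"] by simp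
    have "dg (u a) \<ge> 1 \<or> dg (u a) \<le> 0"
      by (rule dg_cases[OF r(1)]) (auto simp: dg_minus dg_theta)
    then show False
    proof
      assume "dg (u a) \<ge> 1" then show False using no[OF xy] by blast
    next
      assume "dg (u a) \<le> 0"
      then have "dg (u y) \<ge> 1" using sum1 by linarith
      then show False using no[OF xy(2,1)] xy(3) by (simp add: add.commute)
    qed
  qed
  have "\<theta> \<noteq> g" using gR(2) dg_theta by auto
  then have ne: "w \<theta> \<noteq> w g" using u(2) by metis
  have "w \<theta> \<bullet> w g = \<theta> \<bullet> g" by (rule Wg_inner[OF W])
  moreover have "g \<bullet> \<theta> \<noteq> 0" using gR(2) dg_eq_0_iff[of g] by simp
  ultimately have n0: "w \<theta> \<bullet> w g \<noteq> 0" by (simp add: inner_commute)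
  note st = good_step[OF w S n0 ne]
  show "good (refl_root (w g) \<circ> w)" by (rule st(1))
  have "w h = w g \<or> w h = - w g \<longleftrightarrow> h = g" if h: "h \<in> P" for h
  proof -
    have "h = g" if "w h = w g" using that u(2) by metis
    moreover have False if "w h = - w g"
    proof -
      have "w h = w (- g)" using that by (simp add: Wg_minus[OF W])
      then have "h = - g" using u(2) by metis
      then show False using h P_Pos Pos_not_minus g(1) by blast
    qed
    ultimately show ?thesis by blast
  qed
  then show "Iw (refl_root (w g) \<circ> w) = insert g (Iw w)"
    unfolding st(2) using g by (auto simp: Iw_def)
qed

lemma remove_max_J:
  assumes K: "K \<in> J" and g: "g \<in> K" and max: "\<And>x. x \<in> K \<Longrightarrow> ht x \<le> ht g" shows "K - {g} \<in> J"
proof (rule JI)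
  fix x y assume x: "x \<in> K - {g}" and y: "y \<in> P" and le: "nonneg_comb S (x - y)"
  have "y \<noteq> g"
  proof
    assume "y = g"
    then have "ht (x - y) = 0" using ht_nonneg[OF le] max[of x] x by (simp add: ht_diff)
    then show False using ht_eq_0[OF le] x \<open>y = g\<close> by auto
  qed
  then show "y \<in> K - {g}" using J_down[OF K _ y le] x by blast
qed (use J_sub[OF K] in blast)

text \<open>Remove an element of maximal height and restore it by \<open>addable_simple\<close>;
  every ideal in between stays abelian.\<close>

lemma abel_good:
  assumes "K \<in> J" "abel K" shows "\<exists>w. good w \<and> Iw w = K"
  using assms
proof (induction "card K" arbitrary: K rule: less_induct)
  case less
  have finK: "finite K" using J_sub[OF less.prems(1)] finite_P finite_subset by blast
  show ?case
  proof (cases "K = {}")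
    case True
    have "Iw id = {}" using P_Pos by (auto simp: Iw_def)
    then show ?thesis using True good_id by blast
  next
    case False
    have "Max (ht ` K) \<in> ht ` K" using False finK by (intro Max_in) auto
    then obtain g where g: "g \<in> K" "ht g = Max (ht ` K)" by auto
    then have "K - {g} \<in> J" using remove_max_J[OF less.prems(1) g(1)] finK by simp
    moreover have "abel (K - {g})" using less.prems(2) by (auto simp: abel_def)
    moreover have "card (K - {g}) < card K" using g finK by (intro card_Diff1_less)
    ultimately obtain w where w: "good w" "Iw w = K - {g}" using less.hyps by blast
    have ins: "insert g (Iw w) = K" using w g by auto
    have "g \<in> P" "g \<notin> Iw w" using J_sub[OF less.prems(1)] g w by auto
    from addable_simple[OF w(1) this] ins less.prems show ?thesis by auto
  qed
qed

text \<open>The smaller ideal belongs to some \<open>v\<close>; adding \<open>g\<close> back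
  composes \<open>v\<close> with the reflection in \<open>v g\<close>. Uniqueness makes the result
  \<open>w\<close>, so \<open>w g\<close> is the negative of \<open>v g\<close>.\<close>

lemma removable_simple:
  assumes w: "good w" and g: "g \<in> Iw w" and K: "Iw w - {g} \<in> J" shows "- w g \<in> S"
proof -
  have "abel (Iw w - {g})" using Iw_abel[OF w] by (auto simp: abel_def)
  then obtain v where v: "good v" "Iw v = Iw w - {g}" using abel_good[OF K] by blast
  have ins: "insert g (Iw v) = Iw w" using v g by auto
  have "g \<in> P" "g \<notin> Iw v" using g v by (auto simp: Iw_def)
  note ad = addable_simple[OF v(1) this, unfolded ins, OF Iw_J[OF w] Iw_abel[OF w]]
  then have "w = refl_root (v g) \<circ> v" using good_uniq_Iw[OF w] by simp
  have "w g = refl_root (v g) (v g)" by (subst \<open>w = _\<close>) simp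
  also have "\<dots> = - v g" by (rule refl_root_self[OF S_nz[OF ad(1)]])
  finally have "- w g = v g" by simp
  then show ?thesis using ad(1) by simp
qed

section \<open>Duality of lower ideals\<close>

lemma dual_sub: "dual K \<subseteq> P"
  by (auto simp: dual_def)

lemma dual_dual: "K \<subseteq> P \<Longrightarrow> dual (dual K) = K"
  using theta_diff_P by (auto simp: dual_def)

lemma dual_J:
  assumes K: "K \<in> J" shows "dual K \<in> J"
proof (rule JI[OF dual_sub])
  fix x y assume x: "x \<in> dual K" and y: "y \<in> P" and le: "nonneg_comb S (x - y)"
  have "\<theta> - y \<notin> K"
  proof
    assume "\<theta> - y \<in> K"
    moreover have "nonneg_comb S ((\<theta> - y) - (\<theta> - x))" using le by simp
    ultimately have "\<theta> - x \<in> K" using J_down[OF K] theta_diff_P x by (auto simp: dual_def)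
    then show False using x by (simp add: dual_def)
  qed
  then show "y \<in> dual K" using y by (simp add: dual_def)
qed

lemma card_dual:
  assumes "K \<subseteq> P" shows "card (dual K) + card K = card P"
proof -
  have "bij_betw (\<lambda>g. \<theta> - g) (dual K) (P - K)"
    by (rule bij_betwI[where g = "\<lambda>g. \<theta> - g"]) (use theta_diff_P in \<open>auto simp: dual_def\<close>)
  then have "card (dual K) = card (P - K)" by (rule bij_betw_same_card)
  moreover have "card (P - K) + card K = card P"
    using card_Diff_subset[OF finite_subset[OF assms finite_P] assms] card_mono[OF finite_P assms] by simp
  ultimately show ?thesis by simp
qed

text \<open>Suppose \<open>K\<close> contains \<open>g\<close> and \<open>\<theta> - g\<close> but
  neither \<open>d\<close> nor \<open>\<theta> - d\<close>. As \<open>g\<close> has positive inner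
  product with \<open>\<theta>\<close>, it is acute to one of the latter two, say \<open>e\<close>,
  so \<open>e\<close> lies above \<open>g\<close>. The complementary pair has the same inner
  product, so \<open>e\<close> also lies below \<open>g\<close>, and \<open>e = g\<close>.\<close>

lemma abel_or_dual:
  assumes K: "K \<in> J" shows "abel K \<or> abel (dual K)"
proof (rule ccontr)
  assume "\<not> ?thesis"
  then obtain g d where g: "g \<in> K" "\<theta> - g \<in> K" and d: "d \<in> dual K" "\<theta> - d \<in> dual K"
    by (auto simp: abel_def)
  have gP: "g \<in> P" "\<theta> - g \<in> P" using g J_sub[OF K] by auto
  have dP: "d \<in> P" "\<theta> - d \<in> P" "\<theta> - d \<notin> K" "d \<notin> K" using d by (auto simp: dual_def)
  have cmp: "nonneg_comb S (y - x)" if "x \<in> K" "x \<in> P" "y \<in> P" "y \<notin> K" "x \<bullet> y > 0" for x y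
  proof -
    have r: "x - y \<in> R" by (rule diff_root) (use that P_R in auto)
    have "x - y \<notin> Pos" using J_down[OF K, of x y] that Pos_comb by blast
    then have "- (x - y) \<in> Pos" using Pos_cases[OF r] by blast
    then show ?thesis using Pos_comb[of "- (x - y)"] by simp
  qed
  have t2: "x \<bullet> \<theta> = \<theta> \<bullet> \<theta> / 2" if "x \<in> P" for x
    using that theta_nz by (simp add: P_R dg_def pair_def field_simps)
  have key: False if e: "e \<in> P" "\<theta> - e \<in> P" "\<theta> - e \<notin> K" "e \<notin> K" and pos: "g \<bullet> e > 0" for e
  proof -
    have 1: "nonneg_comb S (e - g)" using cmp[OF g(1) gP(1) e(1) e(4) pos] .
    have "(\<theta> - g) \<bullet> (\<theta> - e) = g \<bullet> e"
      using t2[OF gP(1)] t2[OF e(1)] by (simp add: inner_diff_left inner_diff_right inner_commute)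
    then have "nonneg_comb S ((\<theta> - e) - (\<theta> - g))" using cmp[OF g(2) gP(2) e(2,3)] pos by simp
    then have "nonneg_comb S (- (e - g))" by simp
    then have "e - g = 0" using nonneg_comb_antisym[OF 1] by blast
    then show False using g(1) e(4) by simp
  qed
  have "g \<bullet> d + g \<bullet> (\<theta> - d) = \<theta> \<bullet> \<theta> / 2" using t2[OF gP(1)] by (simp add: inner_diff_right)
  moreover have "\<theta> \<bullet> \<theta> / 2 > 0" using theta_nz by simp
  ultimately have "g \<bullet> d > 0 \<or> g \<bullet> (\<theta> - d) > 0" by linarith
  then show False
  proof
    assume "g \<bullet> d > 0" then show False using key[OF dP] by blast
  next
    assume "g \<bullet> (\<theta> - d) > 0"
    then show False using key[of "\<theta> - d"] dP by simp
  qed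
qed

lemma abel_sub_dual: "K \<subseteq> P \<Longrightarrow> abel K \<Longrightarrow> K \<subseteq> dual K"
  by (auto simp: abel_def dual_def)

lemma self_dual_iff_card:
  assumes K: "K \<in> J" shows "dual K = K \<longleftrightarrow> 2 * card K = card P"
proof
  assume "dual K = K"
  then show "2 * card K = card P" using card_dual[OF J_sub[OF K]] by simp
next
  assume c: "2 * card K = card P"
  then have ce: "card (dual K) = card K" using card_dual[OF J_sub[OF K]] by simp
  have fin: "finite K" "finite (dual K)" using J_sub[OF K] dual_sub finite_P finite_subset by blast+
  from abel_or_dual[OF K] show "dual K = K"
  proof
    assume "abel K"
    then show ?thesis using abel_sub_dual[OF J_sub[OF K]] card_subset_eq[OF fin(2)] ce by metis
  next
    assume "abel (dual K)"
    then have "dual K \<subseteq> K" using abel_sub_dual[OF dual_sub, of K] dual_dual[OF J_sub[OF K]] by simp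
    then show ?thesis using card_subset_eq[OF fin(1)] ce by metis
  qed
qed

text \<open>Decompositions of \<open>w \<theta>\<close> into two positive roots correspond to pairs
  \<open>g\<close>, \<open>\<theta> - g\<close> of which neither is inverted, which is what
  separates an abelian ideal from its dual.\<close>

lemma self_dual_iff_simple:
  assumes w: "good w" shows "dual (Iw w) = Iw w \<longleftrightarrow> w \<theta> \<in> S"
proof
  note W = good_Wg[OF w]
  assume sd: "dual (Iw w) = Iw w"
  obtain u where u: "u \<in> Wg" "\<And>x. u (w x) = x" "\<And>x. w (u x) = x" using Wg_inv[OF W] by blast
  show "w \<theta> \<in> S"
  proof (rule ccontr)
    assume "w \<theta> \<notin> S"
    then obtain a where a: "a \<in> S" "w \<theta> - a \<in> Pos" using simple_decomp[OF good_theta[OF w]] by blast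
    define y where "y = w \<theta> - a"
    have xy: "a \<in> Pos" "y \<in> Pos" "a + y = w \<theta>" using a S_Pos by (auto simp: y_def)
    have r: "u a \<in> R" "u y \<in> R" using Wg_R[OF u(1)] Pos_R xy by auto
    have s: "u a + u y = \<theta>" using u(2)[of \<theta>] xy(3) by (simp add: Wg_add[OF u(1), symmetric])
    have nz: "u a \<noteq> 0" "u y \<noteq> 0" using r root_nz by auto
    have sum2: "dg (u a) + dg (u y) = 2" using dg_theta s dg_add[of "u a" "u y"] by simp
    have ne: "u a \<noteq> \<theta>" "u y \<noteq> \<theta>" using s nz by auto
    have "dg (u a) \<le> 1" by (rule dg_cases[OF r(1)]) (use ne in \<open>auto simp: dg_minus dg_theta\<close>)
    moreover have "dg (u y) \<le> 1" by (rule dg_cases[OF r(2)]) (use ne in \<open>auto simp: dg_minus dg_theta\<close>)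
    ultimately have "dg (u a) = 1" "dg (u y) = 1" using sum2 by linarith+
    then have P: "u a \<in> P" "u y \<in> P" using r P_R by auto
    have ty: "\<theta> - u a = u y" using s by (simp add: algebra_simps)
    have "u a \<notin> Iw w" "\<theta> - u a \<notin> Iw w" using u(3) xy unfolding ty by (auto simp: Iw_def)
    then have "u a \<in> dual (Iw w) - Iw w" using P by (simp add: dual_def)
    then show False using sd by blast
  qed
next
  note W = good_Wg[OF w]
  assume wS: "w \<theta> \<in> S"
  have "g \<in> Iw w" if g: "g \<in> dual (Iw w)" for g
  proof (rule ccontr)
    assume "g \<notin> Iw w"
    moreover have gP: "g \<in> P" "\<theta> - g \<in> P" "\<theta> - g \<notin> Iw w" using g theta_diff_P by (auto simp: dual_def)
    ultimately have "w g \<in> Pos" "w (\<theta> - g) \<in> Pos" by (auto simp: Iw_def)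
    then have "w g + w (\<theta> - g) \<notin> S" by (rule simple_not_sum)
    then show False using wS by (simp add: Wg_diff[OF W])
  qed
  moreover have "Iw w \<subseteq> dual (Iw w)"
    by (rule abel_sub_dual[OF _ Iw_abel[OF w]]) (auto simp: Iw_def)
  ultimately show "dual (Iw w) = Iw w" by blast
qed

section \<open>Long positive roots and abelian ideals\<close>

definition LP :: "'a set" where "LP = {b\<in>Pos. b \<bullet> b = \<theta> \<bullet> \<theta>}"

text \<open>For \<open>b\<close> in \<open>LP\<close> the choice is forced by
  \<open>good_uniq\<close>.\<close>

definition wv :: "'a \<Rightarrow> 'a \<Rightarrow> 'a" where "wv b = (SOME w. good w \<and> w \<theta> = b)"

definition Idl :: "'a \<Rightarrow> 'a set" where "Idl b = Iw (wv b)"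

lemma wv: "b \<in> LP \<Longrightarrow> good (wv b)" "b \<in> LP \<Longrightarrow> wv b \<theta> = b"
  using someI_ex[OF long_good[of b]] by (auto simp: LP_def wv_def)

lemma wv_eq: "good w \<Longrightarrow> wv (w \<theta>) = w"
  using wv[of "w \<theta>"] good_uniq good_theta good_long by (auto simp: LP_def)

lemma good_LP: "good w \<Longrightarrow> w \<theta> \<in> LP"
  using good_theta good_long by (simp add: LP_def)

lemma Idl_good: "good w \<Longrightarrow> Idl (w \<theta>) = Iw w"
  by (simp add: Idl_def wv_eq)

lemma Idl_J: "b \<in> LP \<Longrightarrow> Idl b \<in> J"
  by (simp add: Idl_def Iw_J wv)

lemma Idl_inj: "b \<in> LP \<Longrightarrow> c \<in> LP \<Longrightarrow> Idl b = Idl c \<Longrightarrow> b = c"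
  unfolding Idl_def using good_uniq_Iw wv by metis

lemma Idl_surj: "K \<in> J \<Longrightarrow> abel K \<Longrightarrow> \<exists>b\<in>LP. Idl b = K"
  using abel_good Idl_good good_LP by metis

lemma Idl_self_dual: "b \<in> LP \<Longrightarrow> dual (Idl b) = Idl b \<longleftrightarrow> b \<in> S"
  using self_dual_iff_simple[of "wv b"] wv by (simp add: Idl_def)

text \<open>An abelian ideal fills at most half of \<open>P\<close> and its dual at least half, so
  equality happens only at exactly half. Hence the ideals of a long root and of its negative are
  glued at simple roots only.\<close>

lemma Idl_dual_eq:
  assumes "b \<in> LP" "c \<in> LP" "Idl b = dual (Idl c)" shows "b = c" "b \<in> S"
proof -
  have sub: "Idl b \<subseteq> P" "Idl c \<subseteq> P" using Idl_J J_sub assms by auto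
  have ab: "abel (Idl b)" "abel (Idl c)" unfolding Idl_def using Iw_abel wv assms(1,2) by blast+
  have "card (Idl c) \<le> card (dual (Idl c))" "card (Idl b) \<le> card (dual (Idl b))"
    using abel_sub_dual sub ab finite_subset[OF dual_sub finite_P] by (auto intro!: card_mono)
  then have "2 * card (Idl b) = card P"
    using card_dual[OF sub(1)] card_dual[OF sub(2)] assms(3) by simp
  then have sd: "dual (Idl b) = Idl b" using self_dual_iff_card Idl_J assms(1) by blast
  then show "b \<in> S" using Idl_self_dual assms(1) by blast
  have "dual (Idl b) = Idl c" using assms(3) dual_dual[OF sub(2)] by simp
  then show "b = c" using Idl_inj assms sd by simp
qed

lemma long_simple_eq: "long_simple R S = S \<inter> LP"
proof -
  have "a \<bullet> a = \<theta> \<bullet> \<theta>" if "a \<in> S" "\<forall>b\<in>R. b \<bullet> b \<le> a \<bullet> a" for a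
  proof (rule order_antisym)
    show "a \<bullet> a \<le> \<theta> \<bullet> \<theta>" by (rule theta_long[OF S_R[OF that(1)]])
    show "\<theta> \<bullet> \<theta> \<le> a \<bullet> a" using that(2) theta_R by blast
  qed
  moreover have "b \<bullet> b \<le> a \<bullet> a" if "a \<bullet> a = \<theta> \<bullet> \<theta>" "b \<in> R" for a b
    unfolding that(1) by (rule theta_long[OF that(2)])
  ultimately show ?thesis unfolding long_simple_def LP_def using S_Pos by blast
qed

lemma self_dual_ideals: "{K\<in>J. dual K = K} = Idl ` long_simple R S"
proof -
  have "K \<in> Idl ` (S \<inter> LP)" if K: "K \<in> J" "dual K = K" for K
  proof -
    have "abel K" using abel_or_dual[OF K(1)] K(2) by simp
    then obtain b where b: "b \<in> LP" "Idl b = K" using Idl_surj K by blast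
    then show ?thesis using Idl_self_dual K by blast
  qed
  moreover have "Idl b \<in> J" "dual (Idl b) = Idl b" if "b \<in> S \<inter> LP" for b
    using that Idl_J Idl_self_dual by auto
  ultimately show ?thesis unfolding long_simple_eq by blast
qed

lemma card_self_dual: "card {K\<in>J. dual K = K} = card (long_simple R S)"
  unfolding self_dual_ideals by (rule card_image) (use Idl_inj long_simple_eq in \<open>auto simp: inj_on_def\<close>)

end

section \<open>The bipartite walk\<close>

text \<open>Chebyshev polynomials of the second kind with the index shifted by one: for
  \<open>l = cos x\<close> the value is \<open>sin (n x) / sin x\<close>.\<close>

fun chebU :: "real \<Rightarrow> nat \<Rightarrow> real" where
  "chebU l 0 = 0"
| "chebU l (Suc 0) = 1"
| "chebU l (Suc (Suc n)) = 2 * l * chebU l (Suc n) - chebU l n"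

text \<open>The first-order condition at a minimum. Dividing by \<open>h + 1\<close> instead of
  \<open>h\<close> makes the test point \<open>- B / s\<close> available also for
  \<open>h = 0\<close>.\<close>

lemma quadratic_linear_coeff_0:
  fixes B h :: real
  assumes nn: "\<And>t. 2 * t * B + t^2 * h \<ge> 0" shows "B = 0"
proof -
  have h: "h \<ge> 0" using nn[of 1] nn[of "-1"] by simp
  define s where "s = h + 1"
  have s: "s > 0" using h by (simp add: s_def)
  have "2 * (- B / s) * B + (- B / s)^2 * h = (B / s)^2 * (h - 2 * s)"
    using s by (simp add: field_simps power2_eq_square)
  then have "(B / s)^2 * (h - 2 * s) \<ge> 0" using nn[of "- B / s"] by simp
  moreover have "h - 2 * s < 0" using h by (simp add: s_def)
  ultimately have "(B / s)^2 \<le> 0" by (simp add: zero_le_mult_iff)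
  then show ?thesis using s by simp
qed

context based_root_system
begin

section \<open>Acyclicity and two-colouring of the Dynkin diagram\<close>

lemma adjacent_angle:
  assumes x: "x \<in> S" and y: "y \<in> S" and ne: "x \<noteq> y" and adj: "x \<bullet> y \<noteq> 0"
  shows "sgn x \<bullet> sgn y \<le> - 1/2"
proof -
  have nz: "x \<noteq> 0" "y \<noteq> 0" using x y S_nz by auto
  have neg: "x \<bullet> y < 0" using S_obtuse[OF x y ne] adj by simp
  have "pair x y < 0" "pair y x < 0"
    using neg nz pair_nonneg_iff[of y x] pair_nonneg_iff[of x y] by (auto simp: inner_commute not_le[symmetric])
  moreover have "pair x y \<in> \<int>" "pair y x \<in> \<int>" using pair_Ints x y S_R by auto
  ultimately have "pair x y \<le> -1" "pair y x \<le> -1" by (auto elim!: Ints_cases)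
  then have "pair x y * pair y x \<ge> 1" using mult_mono[of 1 "- pair x y" 1 "- pair y x"] by simp
  moreover have t: "sgn x \<bullet> sgn y = (x \<bullet> y) / (norm x * norm y)"
    by (simp add: sgn_div_norm divide_inverse mult.commute mult.left_commute)
  moreover have "pair x y * pair y x = 4 * ((x \<bullet> y) / (norm x * norm y))^2"
    by (simp add: pair_def power2_eq_square inner_commute dot_square_norm power_mult_distrib)
  ultimately have "4 * (sgn x \<bullet> sgn y)^2 \<ge> 1" by simp
  then have "(sgn x \<bullet> sgn y)^2 \<ge> (1/2)^2" by (simp add: power2_eq_square)
  moreover have "sgn x \<bullet> sgn y < 0" unfolding t using neg nz by (simp add: divide_neg_pos)
  ultimately show ?thesis using power2_le_imp_le[of "1/2" "- (sgn x \<bullet> sgn y)"] by simp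
qed

text \<open>The sum \<open>v\<close> of the unit vectors is not zero, so some unit vector has
  positive inner product with it. Two neighbours would each subtract at least 1/2 from the
  contribution 1 of the vector itself.\<close>

lemma leaf_exists:
  assumes A: "A \<subseteq> S" "A \<noteq> {}"
  obtains x where "x \<in> A" "\<And>b c. b \<in> A - {x} \<Longrightarrow> c \<in> A - {x} \<Longrightarrow> x \<bullet> b \<noteq> 0 \<Longrightarrow> x \<bullet> c \<noteq> 0 \<Longrightarrow> b = c"
proof -
  have finA: "finite A" using A finite_S finite_subset by blast
  define v where "v = (\<Sum>x\<in>A. sgn x)"
  obtain y where y: "y \<in> A" using A by blast
  have "cf v y = (\<Sum>x\<in>A. if x = y then inverse (norm x) else 0)"
    unfolding v_def cf_sum by (rule sum.cong) (use A in \<open>auto simp: sgn_div_norm cf_scale cf_basis\<close>)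
  also have "\<dots> = inverse (norm y)" using y finA by simp
  finally have "v \<noteq> 0" using y A S_nz[of y] by auto
  then have "0 < v \<bullet> v" by simp
  also have "v \<bullet> v = (\<Sum>x\<in>A. sgn x \<bullet> v)" by (subst v_def) (simp add: inner_sum_left)
  finally have "\<exists>x\<in>A. sgn x \<bullet> v > 0" using sum_nonpos[of A "\<lambda>x. sgn x \<bullet> v"] by force
  then obtain x where x: "x \<in> A" "sgn x \<bullet> v > 0" by blast
  have "b = c" if b: "b \<in> A - {x}" and c: "c \<in> A - {x}" and adj: "x \<bullet> b \<noteq> 0" "x \<bullet> c \<noteq> 0" for b c
  proof (rule ccontr)
    assume bc: "b \<noteq> c"
    have xS: "x \<in> S" "b \<in> S" "c \<in> S" "x \<noteq> b" "x \<noteq> c" using x b c A by auto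
    have "sgn x \<bullet> v = (\<Sum>z\<in>A. sgn x \<bullet> sgn z)" by (simp add: v_def inner_sum_right)
    also have "\<dots> = (\<Sum>z\<in>{x, b, c}. sgn x \<bullet> sgn z) + (\<Sum>z\<in>A - {x, b, c}. sgn x \<bullet> sgn z)"
      by (subst add.commute, rule sum.subset_diff) (use x b c finA in auto)
    also have "(\<Sum>z\<in>{x, b, c}. sgn x \<bullet> sgn z) = sgn x \<bullet> sgn x + sgn x \<bullet> sgn b + sgn x \<bullet> sgn c"
      using xS bc by simp
    also have "sgn x \<bullet> sgn x = 1" using S_nz[OF xS(1)] by (simp add: dot_square_norm norm_sgn)
    finally have e: "sgn x \<bullet> v = 1 + sgn x \<bullet> sgn b + sgn x \<bullet> sgn c + (\<Sum>z\<in>A - {x, b, c}. sgn x \<bullet> sgn z)" .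
    have "(\<Sum>z\<in>A - {x, b, c}. sgn x \<bullet> sgn z) \<le> 0"
    proof (rule sum_nonpos)
      fix z assume "z \<in> A - {x, b, c}"
      then have "x \<bullet> z \<le> 0" using S_obtuse[of x z] A x by auto
      then show "sgn x \<bullet> sgn z \<le> 0" by (simp add: sgn_div_norm mult_nonneg_nonpos)
    qed
    moreover have "sgn x \<bullet> sgn b \<le> - 1/2" "sgn x \<bullet> sgn c \<le> - 1/2"
      using adjacent_angle xS adj by blast+
    ultimately show False using e x(2) by linarith
  qed
  then show ?thesis using that x(1) by blast
qed

text \<open>Peel off a vertex with at most one neighbour, colour the rest, and give it the colour
  opposite to its neighbour.\<close>

lemma colouring_exists:
  assumes "A \<subseteq> S"
  shows "\<exists>col::'a \<Rightarrow> bool. \<forall>a\<in>A. \<forall>b\<in>A. a \<noteq> b \<longrightarrow> a \<bullet> b \<noteq> 0 \<longrightarrow> col a \<noteq> col b"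
  using assms
proof (induction "card A" arbitrary: A rule: less_induct)
  case less
  show ?case
  proof (cases "A = {}")
    case False
    obtain x where x: "x \<in> A" "\<And>b c. b \<in> A - {x} \<Longrightarrow> c \<in> A - {x} \<Longrightarrow> x \<bullet> b \<noteq> 0 \<Longrightarrow> x \<bullet> c \<noteq> 0 \<Longrightarrow> b = c"
      using leaf_exists[OF less.prems False] by blast
    have finA: "finite A" using less.prems finite_S finite_subset by blast
    then have "card (A - {x}) < card A" using x(1) by (intro card_Diff1_less)
    then obtain col where col: "\<forall>a\<in>A - {x}. \<forall>b\<in>A - {x}. a \<noteq> b \<longrightarrow> a \<bullet> b \<noteq> 0 \<longrightarrow> col a \<noteq> (col b::bool)"
      using less.hyps[of "A - {x}"] less.prems by (metis Diff_subset subset_trans)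
    define col' where "col' = col(x := \<exists>b\<in>A - {x}. x \<bullet> b \<noteq> 0 \<and> \<not> col b)"
    have key: "col' x \<noteq> col' b" if "b \<in> A - {x}" "x \<bullet> b \<noteq> 0" for b
    proof -
      have "c = b" if "c \<in> A - {x}" "x \<bullet> c \<noteq> 0" for c
        using x(2)[OF that(1) \<open>b \<in> A - {x}\<close> that(2) \<open>x \<bullet> b \<noteq> 0\<close>] .
      then have "(\<exists>c\<in>A - {x}. x \<bullet> c \<noteq> 0 \<and> \<not> col c) \<longleftrightarrow> \<not> col b" using that by metis
      then show ?thesis using that unfolding col'_def by simp
    qed
    have "col' a \<noteq> col' b" if "a \<in> A" "b \<in> A" "a \<noteq> b" "a \<bullet> b \<noteq> 0" for a b
    proof -
      consider "a = x" | "b = x" | "a \<noteq> x" "b \<noteq> x" by blast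
      then show ?thesis
      proof cases
        case 1 then show ?thesis using key[of b] that by auto
      next
        case 2 then show ?thesis using key[of a] that by (auto simp: inner_commute)
      next
        case 3 then show ?thesis using col that by (auto simp: col'_def)
      qed
    qed
    then show ?thesis by blast
  qed simp
qed

text \<open>A Perron--Frobenius eigenvector of the Cartan matrix, found by maximising a Rayleigh quotient.\<close>

lemma Perron_vector:
  obtains y k where "k > 0" "\<And>a. a \<in> S \<Longrightarrow> cf y a > 0" "\<And>a. a \<in> S \<Longrightarrow> pair y a = k * cf y a"
proof -
  \<comment> \<open>The weights \<open>a \<bullet> a\<close> turn the critical-point equation into
    an eigenvector equation for the Cartan matrix, since \<open>pair\<close> divides by
    them.\<close>
  define G where "G x = (\<Sum>a\<in>S. (cf x a)^2 * (a \<bullet> a))" for x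
  have cf_lin: "linear (\<lambda>x. cf x a)" for a
    by (rule linearI) (simp_all add: cf_add cf_scale)
  have cont: "continuous_on (sphere 0 1) G"
    unfolding G_def by (intro continuous_intros linear_continuous_on cf_lin linear_conv_bounded_linear[THEN iffD1])
  obtain x0 where x0: "norm x0 = 1" and xmax: "\<And>x. norm x = 1 \<Longrightarrow> G x \<le> G x0"
    using continuous_attains_sup[OF compact_sphere _ cont] by auto
  define M where "M = G x0"
  have G_scale: "G (r *\<^sub>R x) = r^2 * G x" for r x
    by (simp add: G_def cf_scale power_mult_distrib sum_distrib_left mult.assoc)
  have bound: "G x \<le> M * (x \<bullet> x)" for x
  proof (cases "x = 0")
    case False
    have "G (x /\<^sub>R norm x) \<le> M" unfolding M_def by (rule xmax) (use False in simp)
    moreover have "G (x /\<^sub>R norm x) = G x / (norm x)^2" by (simp add: G_scale divide_inverse power_inverse mult.commute)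
    moreover have "x \<bullet> x = (norm x)^2" by (rule dot_square_norm)
    ultimately show ?thesis using False by (simp add: divide_le_eq)
  qed (simp add: G_def)
  \<comment> \<open>Absolute values of the coordinates keep \<open>G\<close> and, simple roots being
    mutually obtuse, do not increase the norm; so \<open>y\<close> is a maximiser too.\<close>
  define y where "y = (\<Sum>a\<in>S. \<bar>cf x0 a\<bar> *\<^sub>R a)"
  have cfy: "cf y a = \<bar>cf x0 a\<bar>" if "a \<in> S" for a unfolding y_def by (rule cf_comb[OF that])
  have Gy: "G y = M" unfolding M_def G_def by (rule sum.cong) (simp_all add: cfy)
  have M: "M > 0"
  proof -
    have "\<exists>a\<in>S. cf x0 a \<noteq> 0" using x0 by (metis cf_eqI cf_zero norm_zero zero_neq_one)
    then obtain a where a: "a \<in> S" "cf x0 a \<noteq> 0" by blast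
    then have "0 < (cf x0 a)^2 * (a \<bullet> a)" using S_nz by simp
    also have "\<dots> \<le> M" unfolding M_def G_def
      by (rule member_le_sum) (use a finite_S in auto)
    finally show ?thesis .
  qed
  have yy: "y \<bullet> y \<le> 1"
  proof -
    have "y \<bullet> y = (\<Sum>a\<in>S. \<Sum>b\<in>S. \<bar>cf x0 a\<bar> * (\<bar>cf x0 b\<bar> * (a \<bullet> b)))"
      unfolding y_def inner_sum_left inner_sum_right by (simp add: inner_commute mult.left_commute)
    also have "\<dots> \<le> (\<Sum>a\<in>S. \<Sum>b\<in>S. cf x0 a * (cf x0 b * (a \<bullet> b)))"
    proof (intro sum_mono)
      fix a b assume ab: "a \<in> S" "b \<in> S"
      show "\<bar>cf x0 a\<bar> * (\<bar>cf x0 b\<bar> * (a \<bullet> b)) \<le> cf x0 a * (cf x0 b * (a \<bullet> b))"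
      proof (cases "a = b")
        case False
        have "cf x0 a * cf x0 b \<le> \<bar>cf x0 a\<bar> * \<bar>cf x0 b\<bar>" by (metis abs_ge_self abs_mult)
        then have "(\<bar>cf x0 a\<bar> * \<bar>cf x0 b\<bar>) * (a \<bullet> b) \<le> (cf x0 a * cf x0 b) * (a \<bullet> b)"
          using S_obtuse[OF ab False] by (rule mult_right_mono_neg)
        then show ?thesis by (simp add: mult.assoc)
      qed (simp add: mult.assoc[symmetric] abs_mult_self_eq)
    qed
    also have "\<dots> = x0 \<bullet> x0"
    proof -
      have "x0 \<bullet> x0 = (\<Sum>a\<in>S. cf x0 a * (x0 \<bullet> a))" using inner_cf[of x0 x0] by (simp add: inner_commute)
      also have "\<dots> = (\<Sum>a\<in>S. \<Sum>b\<in>S. cf x0 a * (cf x0 b * (b \<bullet> a)))"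
        by (rule sum.cong) (simp_all add: inner_cf[of x0] sum_distrib_left)
      finally show ?thesis by (simp add: inner_commute)
    qed
    also have "\<dots> = 1" using x0 by (simp add: dot_square_norm)
    finally show ?thesis .
  qed
  have Hy: "M * (y \<bullet> y) - G y = 0"
    using bound[of y] Gy M yy mult_left_mono[of "y \<bullet> y" 1 M] by simp
  \<comment> \<open>The form \<open>M * (x \<bullet> x) - G x\<close> is non-negative and vanishes
    at \<open>y\<close>, so its first variation there is zero.\<close>
  have crit: "M * (y \<bullet> z) = (\<Sum>a\<in>S. cf y a * cf z a * (a \<bullet> a))" for z
  proof -
    define B where "B = M * (y \<bullet> z) - (\<Sum>a\<in>S. cf y a * cf z a * (a \<bullet> a))"
    have "2 * t * B + t^2 * (M * (z \<bullet> z) - G z) \<ge> 0" for t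
    proof -
      have Gt: "G (y + t *\<^sub>R z) = G y + 2 * t * (\<Sum>a\<in>S. cf y a * cf z a * (a \<bullet> a)) + t^2 * G z"
        by (simp add: G_def cf_add cf_scale power2_eq_square sum_distrib_left sum.distrib[symmetric] algebra_simps)
      have It: "(y + t *\<^sub>R z) \<bullet> (y + t *\<^sub>R z) = y \<bullet> y + 2 * t * (y \<bullet> z) + t^2 * (z \<bullet> z)"
        by (simp add: inner_add_left inner_add_right inner_commute power2_eq_square algebra_simps)
      have "M * ((y + t *\<^sub>R z) \<bullet> (y + t *\<^sub>R z)) - G (y + t *\<^sub>R z) \<ge> 0" using bound by simp
      also have "M * ((y + t *\<^sub>R z) \<bullet> (y + t *\<^sub>R z)) - G (y + t *\<^sub>R z)
          = (M * (y \<bullet> y) - G y) + 2 * t * B + t^2 * (M * (z \<bullet> z) - G z)"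
        unfolding Gt It B_def by (simp add: algebra_simps)
      finally show ?thesis using Hy by simp
    qed
    then have "B = 0" by (rule quadratic_linear_coeff_0)
    then show ?thesis by (simp add: B_def)
  qed
  have eig: "pair y a = (2 / M) * cf y a" if a: "a \<in> S" for a
  proof -
    have "(\<Sum>b\<in>S. cf y b * cf a b * (b \<bullet> b)) = (\<Sum>b\<in>S. if b = a then cf y a * (a \<bullet> a) else 0)"
      by (rule sum.cong) (use a in \<open>auto simp: cf_basis\<close>)
    then have "M * (y \<bullet> a) = cf y a * (a \<bullet> a)" using crit[of a] a finite_S by simp
    then show ?thesis using M S_nz[OF a] by (simp add: pair_def field_simps)
  qed
  have "y \<noteq> 0" using Gy M by (auto simp: G_def)
  have "cf y a > 0" if "a \<in> S" for a
  proof (rule full_support[OF _ \<open>y \<noteq> 0\<close> _ that])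
    show "cf y a \<ge> 0" if "a \<in> S" for a using cfy[OF that] by simp
    show "y \<bullet> a \<ge> 0" if "a \<in> S" "cf y a = 0" for a
      using eig[OF that(1)] that S_nz[OF that(1)] by (simp add: pair_eq_0_iff)
  qed
  then show ?thesis using that[of "2 / M" y] M eig by simp
qed

end

section \<open>Products of the reflections of one colour and the plane of the Perron vector\<close>

locale coloured_root_system = based_root_system +
  fixes col :: "'a \<Rightarrow> bool"
  assumes col: "a \<in> S \<Longrightarrow> b \<in> S \<Longrightarrow> a \<noteq> b \<Longrightarrow> a \<bullet> b \<noteq> 0 \<Longrightarrow> col a \<noteq> col b"
begin

text \<open>The product of the reflections in \<open>A\<close>, written as a sum. The two agree for
  pairwise orthogonal roots, whence the requirement \<open>A \<subseteq> cls e\<close>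
  below.\<close>

definition srA :: "'a set \<Rightarrow> 'a \<Rightarrow> 'a" where
  "srA A v = v - (\<Sum>a\<in>A. pair v a *\<^sub>R a)"

definition cls :: "bool \<Rightarrow> 'a set" where "cls e = {a\<in>S. col a = e}"

definition sr :: "bool \<Rightarrow> 'a \<Rightarrow> 'a" where "sr e = srA (cls e)"

lemma finite_cls: "finite (cls e)"
  using finite_S by (simp add: cls_def)

lemma cls_S: "cls e \<subseteq> S"
  by (auto simp: cls_def)

lemma cls_orth: "a \<in> cls e \<Longrightarrow> b \<in> cls e \<Longrightarrow> a \<noteq> b \<Longrightarrow> a \<bullet> b = 0"
  using col[of a b] by (auto simp: cls_def)

lemma srA_empty [simp]: "srA {} v = v"
  by (simp add: srA_def)

lemma pair_sum_orth:
  assumes "A \<subseteq> cls e" "b \<in> cls e" "b \<notin> A" shows "pair (\<Sum>a\<in>A. f a *\<^sub>R a) b = 0"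
  unfolding pair_sum
proof (rule sum.neutral, rule ballI)
  fix a assume "a \<in> A"
  then have "a \<bullet> b = 0" using cls_orth[of a e b] assms by blast
  then show "pair (f a *\<^sub>R a) b = 0" by (simp add: pair_def)
qed

lemma srA_insert:
  assumes A: "insert b A \<subseteq> cls e" "b \<notin> A" shows "srA (insert b A) v = refl_root b (srA A v)"
proof -
  have "finite A" by (rule finite_subset[OF _ finite_cls[of e]]) (use A in blast)
  then have "srA (insert b A) v = srA A v - pair v b *\<^sub>R b" using A(2) by (simp add: srA_def)
  moreover have "pair (srA A v) b = pair v b"
    unfolding srA_def pair_diff using pair_sum_orth[of A e b "pair v"] A by simp
  ultimately show ?thesis by (simp add: refl_root_pair)
qed

lemma srA_facts:
  fixes b v c x y :: 'a
  assumes A: "A \<subseteq> cls e"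
  shows "b \<in> R \<Longrightarrow> srA A b \<in> R" and "srA A (- v) = - srA A v" and "srA A x \<bullet> srA A y = x \<bullet> y"
    and "srA A (srA A v) = v" and "c \<in> cls e \<Longrightarrow> c \<notin> A \<Longrightarrow> srA A c = c"
    and "c \<in> A \<Longrightarrow> srA A c = - c"
proof -
  have "finite A" by (rule finite_subset[OF _ finite_cls[of e]]) (use A in blast)
  then have *: "(b \<in> R \<longrightarrow> srA A b \<in> R) \<and> srA A x \<bullet> srA A y = x \<bullet> y" for b x y
    using A
  proof (induction A arbitrary: b x y)
    case empty
    then show ?case by simp
  next
    case (insert a A)
    have a: "a \<in> S" using insert.prems cls_S by blast
    show ?case unfolding srA_insert[OF insert.prems insert.hyps(2)]
      using insert.IH insert.prems refl_R[OF S_R[OF a]] refl_root_inner[OF S_nz[OF a]] by simp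
  qed
  show "b \<in> R \<Longrightarrow> srA A b \<in> R" "srA A x \<bullet> srA A y = x \<bullet> y" using * by blast+
  show "srA A (- v) = - srA A v" by (simp add: srA_def sum_negf)
  have fin: "finite A" by fact
  have pairA: "pair (srA A v) a = - pair v a" if a: "a \<in> A" for a
  proof -
    have "pair (\<Sum>x\<in>A. pair v x *\<^sub>R x) a = (\<Sum>x\<in>A. if x = a then pair v a * 2 else 0)"
      unfolding pair_sum
    proof (rule sum.cong)
      fix x assume "x \<in> A"
      then show "pair (pair v x *\<^sub>R x) a = (if x = a then pair v a * 2 else 0)"
        using a A cls_orth[of x e a] cls_S[of e] S_nz[of a] by (auto simp: pair_scale pair_self pair_def)
    qed simp
    then show ?thesis using a fin by (simp add: srA_def pair_diff)
  qed
  show "srA A (srA A v) = v"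
  proof -
    have "srA A (srA A v) = srA A v - (\<Sum>a\<in>A. (- pair v a) *\<^sub>R a)"
      unfolding srA_def[of A "srA A v"] using pairA by simp
    then show ?thesis by (simp add: srA_def sum_negf)
  qed
  show "srA A c = c" if "c \<in> cls e" "c \<notin> A"
  proof -
    have "(\<Sum>a\<in>A. pair c a *\<^sub>R a) = 0"
    proof (rule sum.neutral, rule ballI)
      fix a assume "a \<in> A"
      then have "c \<bullet> a = 0" using cls_orth[of c e a] that A by auto
      then show "pair c a *\<^sub>R a = 0" by (simp add: pair_def)
    qed
    then show ?thesis by (simp add: srA_def)
  qed
  show "srA A c = - c" if c: "c \<in> A"
  proof -
    have "(\<Sum>a\<in>A. pair c a *\<^sub>R a) = (\<Sum>a\<in>A. if a = c then 2 *\<^sub>R c else 0)"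
    proof (rule sum.cong)
      fix a assume "a \<in> A"
      then show "pair c a *\<^sub>R a = (if a = c then 2 *\<^sub>R c else 0)"
        using c A cls_orth[of c e a] cls_S[of e] S_nz[of c] by (auto simp: pair_self pair_def)
    qed simp
    then show ?thesis using c fin by (simp add: srA_def scaleR_2)
  qed
qed

lemma srA_Pos:
  assumes A: "A \<subseteq> cls e" and b: "b \<in> Pos" "b \<notin> A" shows "srA A b \<in> Pos"
proof -
  have "finite A" by (rule finite_subset[OF _ finite_cls[of e]]) (use A in blast)
  then show ?thesis using A b
  proof (induction A)
    case (insert a A)
    have a: "a \<in> S" "a \<in> cls e" "A \<subseteq> cls e" using insert.prems cls_S by auto
    have "srA A b \<noteq> a"
    proof
      assume "srA A b = a"
      then have "b = srA A a" using srA_facts(4)[OF a(3), of b] by simp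
      also have "\<dots> = a" using srA_facts(5)[OF a(3) a(2)] insert.hyps by blast
      finally show False using insert.prems by simp
    qed
    then show ?case unfolding srA_insert[OF insert.prems(1) insert.hyps(2)]
      using refl_simple_Pos[OF _ a(1)] insert by auto
  qed simp
qed

lemma sr_invol [simp]: "sr e (sr e v) = v"
  and sr_R: "b \<in> R \<Longrightarrow> sr e b \<in> R"
  and sr_inner: "sr e x \<bullet> sr e y = x \<bullet> y"
  and sr_simple: "a \<in> S \<Longrightarrow> col a = e \<Longrightarrow> sr e a = - a"
  unfolding sr_def using srA_facts[where A = "cls e" and e = e, OF order_refl]
  by (simp_all, simp add: cls_def)

lemma sr_Pos: "b \<in> Pos \<Longrightarrow> \<not> (b \<in> S \<and> col b = e) \<Longrightarrow> sr e b \<in> Pos"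
  unfolding sr_def using srA_Pos[where A = "cls e" and e = e and b = b, OF order_refl] by (simp add: cls_def)

text \<open>The two coloured halves of the Perron vector span a plane, the Coxeter plane, on which
  each colour class acts as a single reflection. Inner products with suitable vectors of this plane
  are positive on the simple roots of one colour and vanish on the other.\<close>

lemma walk_functionals:
  obtains q :: "bool \<Rightarrow> 'a \<Rightarrow> real" and l :: real
  where "l < 1" "\<And>e. linear (q e)"
    "\<And>a. a \<in> S \<Longrightarrow> q (col a) a > 0" "\<And>a. a \<in> S \<Longrightarrow> q (\<not> col a) a = 0"
    "\<And>e v. q e (sr e v) = - q e v + 2 * l * q (\<not> e) v"
    "\<And>e v. q (\<not> e) (sr e v) = q (\<not> e) v"
proof -
  obtain y k where y: "k > 0" "\<And>a. a \<in> S \<Longrightarrow> cf y a > 0" "\<And>a. a \<in> S \<Longrightarrow> pair y a = k * cf y a"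
    by (rule Perron_vector) blast
  \<comment> \<open>So \<open>2 * l\<close> is the Perron eigenvalue of 2 minus the Cartan
    matrix.\<close>
  define l where "l = (2 - k) / 2"
  define X where "X e = (\<Sum>a\<in>cls e. cf y a *\<^sub>R a)" for e
  \<comment> \<open>The factor \<open>l\<close> makes the vector orthogonal to all simple roots of
    the other colour.\<close>
  define q where "q e v = (X e + l *\<^sub>R X (\<not> e)) \<bullet> v" for e v
  have Xsum: "X e + X (\<not> e) = y" for e
  proof -
    have S: "S = cls e \<union> cls (\<not> e)" "cls e \<inter> cls (\<not> e) = {}" by (auto simp: cls_def)
    have "X e + X (\<not> e) = (\<Sum>a\<in>cls e \<union> cls (\<not> e). cf y a *\<^sub>R a)"
      unfolding X_def using S(2) finite_cls by (simp add: sum.union_disjoint)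
    also have "\<dots> = (\<Sum>a\<in>S. cf y a *\<^sub>R a)" by (rule sum.cong[OF S(1)[symmetric]]) simp
    finally show ?thesis by (simp only: cf_expand)
  qed
  have X1: "pair (X e) a = 2 * cf y a" if "a \<in> cls e" for a e
  proof -
    have "pair (X e) a = (\<Sum>b\<in>cls e. if b = a then 2 * cf y a else 0)"
      unfolding X_def pair_sum
    proof (rule sum.cong)
      fix b assume "b \<in> cls e"
      then show "pair (cf y b *\<^sub>R b) a = (if b = a then 2 * cf y a else 0)"
        using that cls_orth[of b e a] cls_S[of e] S_nz[of a] by (auto simp: pair_scale pair_self pair_def)
    qed simp
    then show ?thesis using that finite_cls by simp
  qed
  have X2: "pair (X (\<not> e)) a = - 2 * l * cf y a" if "a \<in> cls e" for a e
  proof -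
    have "pair (X e) a + pair (X (\<not> e)) a = k * cf y a"
      using Xsum[of e] y(3)[of a] that cls_S by (metis pair_add subsetD)
    then show ?thesis using X1[OF that] by (simp add: l_def field_simps)
  qed
  obtain a0 where a0: "a0 \<in> S" using S_nonempty by blast
  have "l \<ge> 0"
  proof -
    have a0c: "a0 \<in> cls (col a0)" using a0 by (simp add: cls_def)
    have "X (\<not> col a0) \<bullet> a0 \<le> 0"
      unfolding X_def inner_sum_left
    proof (rule sum_nonpos)
      fix b assume "b \<in> cls (\<not> col a0)"
      then have "b \<in> S" "b \<noteq> a0" by (auto simp: cls_def)
      then show "cf y b *\<^sub>R b \<bullet> a0 \<le> 0"
        using S_obtuse[OF _ a0] y(2)[of b] by (simp add: mult_nonneg_nonpos less_imp_le)
    qed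
    then have "pair (X (\<not> col a0)) a0 \<le> 0"
      using pair_pos_iff[OF S_nz[OF a0]] by (simp add: not_less[symmetric])
    then have "l * cf y a0 \<ge> 0" using X2[OF a0c] by simp
    then show ?thesis using y(2)[OF a0] by (simp add: zero_le_mult_iff)
  qed
  have l1: "l < 1" using y(1) by (simp add: l_def)
  then have l2: "1 - l^2 > 0" using \<open>l \<ge> 0\<close> by (simp add: power_less_one_iff abs_square_less_1)
  have q1: "q e a = (1 - l^2) * cf y a * (a \<bullet> a)" if "a \<in> cls e" for e a
  proof -
    have anz: "a \<noteq> 0" using that cls_S S_nz by blast
    have "q e a = pair (X e + l *\<^sub>R X (\<not> e)) a * (a \<bullet> a) / 2" unfolding q_def by (rule inner_pair[OF anz])
    also have "pair (X e + l *\<^sub>R X (\<not> e)) a = 2 * (1 - l^2) * cf y a"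
      by (simp add: pair_add pair_scale X1[OF that] X2[OF that] power2_eq_square algebra_simps)
    finally have "2 * q e a = 2 * ((1 - l^2) * cf y a * (a \<bullet> a))" by (simp add: algebra_simps)
    then show ?thesis by linarith
  qed
  have q0: "q (\<not> e) a = 0" if "a \<in> cls e" for e a
  proof -
    have anz: "a \<noteq> 0" using that cls_S S_nz by blast
    have "q (\<not> e) a = pair (X (\<not> e) + l *\<^sub>R X e) a * (a \<bullet> a) / 2"
      unfolding q_def using inner_pair[OF anz] by simp
    also have "pair (X (\<not> e) + l *\<^sub>R X e) a = 0"
      by (simp add: pair_add pair_scale X1[OF that] X2[OF that])
    finally show ?thesis by simp
  qed
  have lin: "linear (q e)" for e
    unfolding q_def by (rule linearI) (simp_all add: inner_add_right)
  have q_sr: "q f (sr e v) = q f v - (\<Sum>a\<in>cls e. pair v a * q f a)" for e f v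
    by (simp add: sr_def srA_def linear_diff[OF lin] linear_sum[OF lin] linear_scale[OF lin])
  show ?thesis
  proof (rule that[OF l1 lin])
    show "q (col a) a > 0" if "a \<in> S" for a
      using q1[of a "col a"] that l2 y(2)[OF that] S_nz[OF that] by (simp add: cls_def)
    show "q (\<not> col a) a = 0" if "a \<in> S" for a
      using q0[of a "col a"] that by (simp add: cls_def)
    show "q (\<not> e) (sr e v) = q (\<not> e) v" for e v
      unfolding q_sr using q0[of _ e] by simp
    show "q e (sr e v) = - q e v + 2 * l * q (\<not> e) v" for e v
    proof -
      have "(\<Sum>a\<in>cls e. pair v a * q e a) = (\<Sum>a\<in>cls e. 2 * (1 - l^2) * (cf y a * (a \<bullet> v)))"
      proof (rule sum.cong)
        fix a assume a: "a \<in> cls e"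
        then have anz: "a \<noteq> 0" using cls_S S_nz by blast
        show "pair v a * q e a = 2 * (1 - l^2) * (cf y a * (a \<bullet> v))"
          unfolding q1[OF a] inner_commute[of a v] inner_pair[OF anz, of v] by (simp add: algebra_simps)
      qed simp
      also have "\<dots> = 2 * (1 - l^2) * (X e \<bullet> v)" by (simp add: X_def inner_sum_left sum_distrib_left)
      finally show ?thesis unfolding q_sr by (simp add: q_def inner_add_left power2_eq_square algebra_simps)
    qed
  qed
qed

end

lemma sum_shift_periodic:
  fixes z :: "nat \<Rightarrow> real"
  assumes "z T = z 0" shows "(\<Sum>i<T. z (Suc i)) = (\<Sum>i<T. z i)"
proof -
  have "z 0 + (\<Sum>i<T. z (Suc i)) = (\<Sum>i<T. z i) + z T"
    using sum.lessThan_Suc_shift[of z T] by simp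
  then show ?thesis using assms by simp
qed

section \<open>The walk on roots paired with a colour\<close>

context coloured_root_system
begin

definition phi :: "'a \<times> bool \<Rightarrow> 'a \<times> bool" where
  "phi s = (sr (snd s) (fst s), \<not> snd s)"

text \<open>Time reversal: the class applied last becomes the one applied next.\<close>

definition rho :: "'a \<times> bool \<Rightarrow> 'a \<times> bool" where
  "rho s = (fst s, \<not> snd s)"

text \<open>The moment just after a sign change: the class of \<open>a\<close> itself was the last
  one applied.\<close>

definition start :: "'a \<Rightarrow> 'a \<times> bool" where
  "start a = (a, \<not> col a)"

lemma rho_rho [simp]: "rho (rho s) = s"
  by (simp add: rho_def)

lemma fst_rho [simp]: "fst (rho s) = fst s"
  by (simp add: rho_def)

lemma phi_rho_phi [simp]: "phi (rho (phi s)) = rho s"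
  by (simp add: phi_def rho_def)

lemma phi_reversal: "(phi ^^ n) (rho ((phi ^^ n) s)) = rho s"
proof (induction n arbitrary: s)
  case (Suc n)
  have "(phi ^^ Suc n) (rho ((phi ^^ Suc n) s)) = (phi ^^ n) (phi (rho (phi ((phi ^^ n) s))))"
    by (simp add: funpow_swap1)
  then show ?case using Suc by simp
qed simp

lemma inj_phi: "inj phi"
  by (rule injI) (metis phi_rho_phi rho_rho)

lemma phi_R: "fst s \<in> R \<Longrightarrow> fst ((phi ^^ n) s) \<in> R"
  by (induction n) (simp_all add: phi_def sr_R)

lemma phi_periodic:
  assumes "fst s \<in> R" obtains n where "n > 0" "(phi ^^ n) s = s"
proof -
  have "finite {t. \<exists>n. t = (phi ^^ n) s}"
  proof (rule finite_subset)
    show "{t. \<exists>n. t = (phi ^^ n) s} \<subseteq> R \<times> UNIV"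
    proof
      fix t assume "t \<in> {t. \<exists>n. t = (phi ^^ n) s}"
      then have "fst t \<in> R" using phi_R[OF assms] by blast
      then show "t \<in> R \<times> UNIV" by (simp add: mem_Times_iff)
    qed
  qed (simp add: finite_R)
  then show ?thesis using funpow_inj_finite[OF inj_phi] that by blast
qed

text \<open>The positive functionals turn every walk into a solution of the Chebyshev recurrence,
  so that the number of steps from one sign change to the next is the same for all walks.\<close>

lemma walk_exists:
  obtains H :: nat where
    "H > 0"
    "\<And>a t. a \<in> S \<Longrightarrow> t < H \<Longrightarrow> fst ((phi ^^ t) (start a)) \<in> Pos"
    "\<And>a t. a \<in> S \<Longrightarrow> Suc t < H \<Longrightarrow> fst ((phi ^^ t) (start a)) \<in> S \<Longrightarrow>
        col (fst ((phi ^^ t) (start a))) \<noteq> snd ((phi ^^ t) (start a))"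
    "\<And>a. a \<in> S \<Longrightarrow> \<exists>b\<in>S. (phi ^^ (H - 1)) (start a) = rho (start b)"
    "bij_betw (\<lambda>(a, t). (phi ^^ t) (start a)) (S \<times> {..<H}) (Pos \<times> UNIV)"
proof -
  obtain q :: "bool \<Rightarrow> 'a \<Rightarrow> real" and l :: real where l: "l < 1" and lin: "\<And>e. linear (q e)"
    and qpos: "\<And>a. a \<in> S \<Longrightarrow> q (col a) a > 0" and q0: "\<And>a. a \<in> S \<Longrightarrow> q (\<not> col a) a = 0"
    and q1: "\<And>e v. q e (sr e v) = - q e v + 2 * l * q (\<not> e) v"
    and q2: "\<And>e v. q (\<not> e) (sr e v) = q (\<not> e) v"
    by (rule walk_functionals) blast
  have q_cf: "q e v = (\<Sum>a\<in>S. cf v a * q e a)" for e v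
  proof -
    have "q e v = q e (\<Sum>a\<in>S. cf v a *\<^sub>R a)" by (simp only: cf_expand)
    then show ?thesis by (simp add: linear_sum[OF lin] linear_scale[OF lin])
  qed
  have qS: "q e a \<ge> 0" if "a \<in> S" for e a
    using q0[OF that] qpos[OF that] by (cases "col a"; cases e) simp_all
  have qPos: "q e b \<ge> 0" if "b \<in> Pos" for e b
    unfolding q_cf[of e b] using Pos_cf[OF that] qS by (intro sum_nonneg mult_nonneg_nonneg)
  have PosI': "b \<in> Pos" if "b \<in> R" "q e b > 0" for e b
  proof (rule ccontr)
    assume "b \<notin> Pos"
    then have "- b \<in> Pos" using Pos_cases that by blast
    then have "q e (- b) \<ge> 0" by (rule qPos)
    then show False using that linear_neg[OF lin] by simp
  qed
  have supp: "cf b a = 0" if b: "b \<in> Pos" and z: "q e b = 0" and a: "a \<in> S" "col a = e" for a b e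
  proof -
    have "cf b a * q e a = 0"
    proof -
      have "(\<Sum>a\<in>S. cf b a * q e a) = 0" using z q_cf[of e b] by simp
      then have "\<forall>a\<in>S. cf b a * q e a = 0"
        using sum_nonneg_eq_0_iff[OF finite_S, of "\<lambda>a. cf b a * q e a"] Pos_cf[OF b] qS by (simp add: mult_nonneg_nonneg)
      then show ?thesis using a by blast
    qed
    then show ?thesis using qpos[OF a(1)] a(2) by simp
  qed
  \<comment> \<open>Read with the colour to be applied next, the functionals obey the Chebyshev
    recurrence along the walk and vanish at every start.\<close>
  define z where "z s = q (snd s) (fst s)" for s :: "'a \<times> bool"
  have z1: "z (phi s) = q (\<not> snd s) (fst s)" for s by (simp add: z_def phi_def q2)
  have zrec: "z (phi (phi s)) = 2 * l * z (phi s) - z s" for s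
    using q2[of "\<not> snd s" "sr (snd s) (fst s)"] q2[of "snd s" "fst s"] q1[of "snd s" "fst s"]
    by (simp add: z1) (simp add: z_def phi_def)
  have zU: "z ((phi ^^ t) (start a)) = q (col a) a * chebU l t" if a: "a \<in> S" for a t
  proof -
    have "z ((phi ^^ t) (start a)) = q (col a) a * chebU l t
        \<and> z ((phi ^^ Suc t) (start a)) = q (col a) a * chebU l (Suc t)"
    proof (induction t)
      case 0
      have "z (start a) = 0" using q0[OF a] by (simp add: z_def start_def)
      moreover have "z (phi (start a)) = q (col a) a" unfolding z1 by (simp add: start_def)
      ultimately show ?case by simp
    next
      case (Suc t)
      have "z ((phi ^^ Suc (Suc t)) (start a)) = 2 * l * z ((phi ^^ Suc t) (start a)) - z ((phi ^^ t) (start a))"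
        using zrec[of "(phi ^^ t) (start a)"] by simp
      also have "\<dots> = q (col a) a * chebU l (Suc (Suc t))"
        using Suc by (simp add: algebra_simps)
      finally show ?case using Suc by blast
    qed
    then show ?thesis by blast
  qed
  have startR: "a \<in> S \<Longrightarrow> fst (start a) \<in> R" for a by (simp add: start_def S_R)
  have U_sign: "chebU l t > 0 \<longleftrightarrow> z ((phi ^^ t) (start a)) > 0" "chebU l t = 0 \<longleftrightarrow> z ((phi ^^ t) (start a)) = 0"
    if "a \<in> S" for a t
    using zU[OF that] qpos[OF that] by (auto simp: zero_less_mult_iff)
  obtain a0 where a0: "a0 \<in> S" using S_nonempty by blast
  \<comment> \<open>This depends on \<open>l\<close> alone, which is why all walks have the same
    length.\<close>
  define H where "H = (LEAST t. t \<ge> 1 \<and> chebU l t \<le> 0)"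
  have "H \<ge> 1 \<and> chebU l H \<le> 0"
  proof -
    obtain n where n: "n > 0" "(phi ^^ n) (start a0) = start a0" using phi_periodic[OF startR[OF a0]] by blast
    then have "z ((phi ^^ n) (start a0)) = z ((phi ^^ 0) (start a0))" by simp
    then have "chebU l n = 0" using zU[OF a0, of n] zU[OF a0, of 0] qpos[OF a0] by simp
    then have "n \<ge> 1 \<and> chebU l n \<le> 0" using n(1) by simp
    then show ?thesis unfolding H_def by (rule LeastI)
  qed
  then have H: "H \<ge> 1" "chebU l H \<le> 0" by auto
  have Upos: "chebU l t > 0" if "t \<ge> 1" "t < H" for t
    using not_less_Least[of t "\<lambda>t. t \<ge> 1 \<and> chebU l t \<le> 0"] that unfolding H_def by auto
  have pos: "fst ((phi ^^ t) (start a)) \<in> Pos" if a: "a \<in> S" and t: "t < H" for a t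
  proof (cases "t = 0")
    case True then show ?thesis using S_Pos[OF a] by (simp add: start_def)
  next
    case False
    then have "z ((phi ^^ t) (start a)) > 0" using U_sign(1)[OF a] Upos[of t] t by simp
    then show ?thesis using PosI' phi_R[OF startR[OF a]] by (simp add: z_def)
  qed
  \<comment> \<open>The value at time \<open>H\<close> is not positive, yet it is a functional
    applied to the still positive root of the preceding state; so it is 0. The support of that root
    then has a single colour, hence is orthogonal.\<close>
  have last: "\<exists>b\<in>S. (phi ^^ (H - 1)) (start a) = rho (start b)" if a: "a \<in> S" for a
  proof -
    let ?s = "(phi ^^ (H - 1)) (start a)"
    have b: "fst ?s \<in> Pos" using pos[OF a, of "H - 1"] H(1) by simp
    have HS: "Suc (H - 1) = H" using H(1) by simp
    have "z ((phi ^^ H) (start a)) = q (\<not> snd ?s) (fst ?s)" using z1[of ?s] HS by (metis funpow.simps(2) o_apply)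
    moreover have "z ((phi ^^ H) (start a)) \<le> 0"
      using zU[OF a, of H] H(2) qpos[OF a] by (simp add: mult_nonneg_nonpos less_imp_le)
    ultimately have z0: "q (\<not> snd ?s) (fst ?s) = 0" using qPos[OF b, of "\<not> snd ?s"] by linarith
    have "fst ?s \<in> S"
    proof (rule orthogonal_support_simple[OF b])
      fix x y assume xy: "x \<in> S" "y \<in> S" "cf (fst ?s) x \<noteq> 0" "cf (fst ?s) y \<noteq> 0" "x \<noteq> y"
      have "col x \<noteq> (\<not> snd ?s)" "col y \<noteq> (\<not> snd ?s)"
        using supp[OF b z0] xy by blast+
      then show "x \<bullet> y = 0" using col[OF xy(1,2,5)] by auto
    qed
    moreover have "col (fst ?s) = snd ?s"
    proof (rule ccontr)
      assume "col (fst ?s) \<noteq> snd ?s"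
      then have "cf (fst ?s) (fst ?s) = 0" using supp[OF b z0 \<open>fst ?s \<in> S\<close>] by blast
      then show False using cf_basis[OF \<open>fst ?s \<in> S\<close>] by simp
    qed
    ultimately show ?thesis by (intro bexI[of _ "fst ?s"]) (auto simp: rho_def start_def prod_eq_iff)
  qed
  have mid: "col (fst ((phi ^^ t) (start a))) \<noteq> snd ((phi ^^ t) (start a))"
    if a: "a \<in> S" and t: "Suc t < H" and s: "fst ((phi ^^ t) (start a)) \<in> S" for a t
  proof
    let ?s = "(phi ^^ t) (start a)"
    assume c: "col (fst ?s) = snd ?s"
    have "z (phi ?s) > 0" using U_sign(1)[OF a, of "Suc t"] Upos[of "Suc t"] t by simp
    moreover have "z (phi ?s) = 0" unfolding z1 using q0[OF s] c by simp
    ultimately show False by simp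
  qed
  have inj: "inj_on (\<lambda>(a, t). (phi ^^ t) (start a)) (S \<times> {..<H})"
  proof -
    have le: "t = t' \<and> a = a'"
      if a: "a \<in> S" "a' \<in> S" and t: "t \<le> t'" "t' < H" and eq: "(phi ^^ t) (start a) = (phi ^^ t') (start a')" for a a' t t'
    proof -
      have "(phi ^^ t') (start a') = (phi ^^ t) ((phi ^^ (t' - t)) (start a'))"
        using t by (simp add: funpow_add[symmetric, THEN fun_cong, unfolded o_apply])
      then have s: "start a = (phi ^^ (t' - t)) (start a')"
        using eq inj_fn[OF inj_phi, of t] by (simp add: inj_eq)
      have "z (start a) = 0" using U_sign(2)[OF a(1), of 0] by simp
      then have "chebU l (t' - t) = 0" using U_sign(2)[OF a(2)] s by simp
      then have "t' - t = 0" using Upos[of "t' - t"] t by force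
      then show ?thesis using s t by (simp add: start_def)
    qed
    show ?thesis
    proof (rule inj_onI, clarify)
      fix a t a' t' assume "a \<in> S" "a' \<in> S" "t < H" "t' < H" "(phi ^^ t) (start a) = (phi ^^ t') (start a')"
      then show "a = a' \<and> t = t'" using le[of a a' t t'] le[of a' a t' t] by (cases "t \<le> t'") auto
    qed
  qed
  have surj: "\<exists>a\<in>S. \<exists>t<H. (phi ^^ t) (start a) = s" if s: "fst s \<in> Pos" for s
  proof -
    \<comment> \<open>Run backwards from \<open>s\<close> until the first sign change. A simple root
      sits there, and its walk leads forward to \<open>s\<close>.\<close>
    let ?r = "rho s"
    have rR: "fst ?r \<in> R" using Pos_R[OF s] by simp
    \<comment> \<open>Summing the recurrence over a period of an always positive walk gives
      \<open>Z = 2 l Z - Z\<close>, so \<open>Z = 0\<close> as \<open>l < 1\<close>. Then both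
      functionals vanish at the positive root, which kills all its coordinates.\<close>
    have "\<exists>n. fst ((phi ^^ n) ?r) \<notin> Pos"
    proof (rule ccontr)
      assume "\<not> ?thesis"
      then have all: "fst ((phi ^^ n) ?r) \<in> Pos" for n by blast
      obtain T where T: "T > 0" "(phi ^^ T) ?r = ?r" using phi_periodic[OF rR] by blast
      define f where "f i = z ((phi ^^ i) ?r)" for i
      have fpos: "f i \<ge> 0" for i unfolding f_def z_def by (rule qPos[OF all])
      have per: "f T = f 0" "f (Suc T) = f (Suc 0)" using T(2) by (simp_all add: f_def)
      have rec: "f (Suc (Suc i)) = 2 * l * f (Suc i) - f i" for i
        using zrec[of "(phi ^^ i) ?r"] by (simp add: f_def)
      define Z where "Z = (\<Sum>i<T. f i)"
      have s1: "(\<Sum>i<T. f (Suc i)) = Z" unfolding Z_def by (rule sum_shift_periodic[OF per(1)])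
      have s2: "(\<Sum>i<T. f (Suc (Suc i))) = Z"
        using sum_shift_periodic[of "\<lambda>i. f (Suc i)" T] per(2) s1 by simp
      have "(\<Sum>i<T. f (Suc (Suc i))) = 2 * l * (\<Sum>i<T. f (Suc i)) - (\<Sum>i<T. f i)"
        unfolding rec by (simp add: sum_subtractf sum_distrib_left)
      then have "Z * (1 - l) = 0" using s1 s2 by (simp add: Z_def[symmetric] algebra_simps)
      then have "Z = 0" using l by simp
      then have z0: "f i = 0" if "i < T" for i
        using sum_nonneg_eq_0_iff[of "{..<T}" f] fpos that unfolding Z_def by simp
      have "f 0 = 0" using z0 T(1) by simp
      have "f 1 = 0" using z0[of 1] per(1) \<open>f 0 = 0\<close> T(1) by (cases "T = 1") auto
      have "q (snd ?r) (fst s) = 0" using \<open>f 0 = 0\<close> by (simp add: f_def z_def)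
      moreover have "q (\<not> snd ?r) (fst s) = 0" using \<open>f 1 = 0\<close> z1[of ?r] by (simp add: f_def)
      ultimately have "cf (fst s) a = 0" if "a \<in> S" for a
        using supp[OF s _ that] by (cases "col a = snd ?r") auto
      then have "fst s = 0" using cf_eqI[of "fst s" 0] by simp
      then show False using root_nz Pos_R[OF s] by blast
    qed
    then have "\<exists>n. fst ((phi ^^ n) ?r) \<notin> Pos \<and> (\<forall>m<n. fst ((phi ^^ m) ?r) \<in> Pos)"
      using exists_least_iff[of "\<lambda>n. fst ((phi ^^ n) ?r) \<notin> Pos"] by auto
    then obtain n where n: "fst ((phi ^^ n) ?r) \<notin> Pos" "\<And>m. m < n \<Longrightarrow> fst ((phi ^^ m) ?r) \<in> Pos" by blast
    then have "n \<noteq> 0" using s by (metis fst_rho funpow_0)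
    then obtain m where m: "n = Suc m" by (cases n) auto
    define c where "c = (phi ^^ m) ?r"
    have cP: "fst c \<in> Pos" using n(2) m by (simp add: c_def)
    have "sr (snd c) (fst c) \<notin> Pos" using n(1) m by (simp add: c_def phi_def)
    then have cS: "fst c \<in> S" "col (fst c) = snd c" using sr_Pos[OF cP] by blast+
    then have cst: "c = rho (start (fst c))" by (simp add: rho_def start_def prod_eq_iff)
    have rev: "(phi ^^ i) (start (fst c)) = rho ((phi ^^ (m - i)) ?r)" if "i \<le> m" for i
    proof -
      have "(phi ^^ m) ?r = (phi ^^ i) ((phi ^^ (m - i)) ?r)"
        using that by (simp add: funpow_add[symmetric, THEN fun_cong, unfolded o_apply])
      then have "start (fst c) = rho ((phi ^^ i) ((phi ^^ (m - i)) ?r))"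
        using cst by (metis c_def rho_rho)
      then show ?thesis by (simp add: phi_reversal)
    qed
    have "(phi ^^ m) (start (fst c)) = s" using rev[of m] by simp
    moreover have "m < H"
    proof (rule ccontr)
      assume "\<not> m < H"
      then have Hm: "H \<le> m" by simp
      obtain b where b: "b \<in> S" "(phi ^^ (H - 1)) (start (fst c)) = rho (start b)" using last[OF cS(1)] by blast
      have "(phi ^^ H) (start (fst c)) = phi (rho (start b))"
        using b(2) H(1) by (metis One_nat_def Suc_pred' funpow.simps(2) less_eq_Suc_le o_apply)
      also have "fst \<dots> = - b" using sr_simple[OF b(1)] by (simp add: phi_def rho_def start_def)
      finally have "fst ((phi ^^ H) (start (fst c))) = - b" .
      moreover have "fst ((phi ^^ H) (start (fst c))) \<in> Pos" using rev[OF Hm] n(2)[of "m - H"] m by simp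
      ultimately show False using Pos_not_minus[OF S_Pos[OF b(1)]] by simp
    qed
    ultimately show ?thesis using cS(1) by blast
  qed
  have "bij_betw (\<lambda>(a, t). (phi ^^ t) (start a)) (S \<times> {..<H}) (Pos \<times> UNIV)"
    unfolding bij_betw_def
  proof (intro conjI inj equalityI subsetI)
    fix s assume "s \<in> (\<lambda>(a, t). (phi ^^ t) (start a)) ` (S \<times> {..<H})"
    then show "s \<in> Pos \<times> UNIV" using pos by (auto simp: mem_Times_iff)
  next
    fix s :: "'a \<times> bool" assume "s \<in> Pos \<times> UNIV"
    then have "fst s \<in> Pos" by (simp add: mem_Times_iff)
    from surj[OF this] obtain a t where "a \<in> S" "t < H" "(phi ^^ t) (start a) = s" by blast
    then show "s \<in> (\<lambda>(a, t). (phi ^^ t) (start a)) ` (S \<times> {..<H})"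
      by (intro image_eqI[of _ _ "(a, t)"]) auto
  qed
  then show ?thesis using that[of H] H(1) pos mid last by simp
qed

definition hh :: nat where "hh = nat (coxeter_number R S)"

lemma hh_height: "real hh = ht \<theta> + 1" and hh_coxeter: "int hh = coxeter_number R S"
proof -
  have "real_of_int (coxeter_number R S) = ht \<theta> + 1"
    using height_ht[OF theta_R] by (simp add: coxeter_number_def)
  moreover have "ht \<theta> \<ge> 1" by (rule ht_Pos[OF theta_Pos])
  ultimately show "real hh = ht \<theta> + 1" "int hh = coxeter_number R S" unfolding hh_def by linarith+
qed

text \<open>Counting states identifies the length:
  \<open>card S * H = 2 * card Pos = card R\<close>, to be compared with
  \<open>card_R\<close>.\<close>

lemma walk:
  shows "hh \<ge> 2"
    and "\<And>a t. a \<in> S \<Longrightarrow> t < hh \<Longrightarrow> fst ((phi ^^ t) (start a)) \<in> Pos"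
    and "\<And>a t. a \<in> S \<Longrightarrow> Suc t < hh \<Longrightarrow> fst ((phi ^^ t) (start a)) \<in> S \<Longrightarrow>
        col (fst ((phi ^^ t) (start a))) \<noteq> snd ((phi ^^ t) (start a))"
    and "\<And>a. a \<in> S \<Longrightarrow> \<exists>b\<in>S. (phi ^^ (hh - 1)) (start a) = rho (start b)"
    and "bij_betw (\<lambda>(a, t). (phi ^^ t) (start a)) (S \<times> {..<hh}) (Pos \<times> UNIV)"
proof -
  obtain H :: nat where H: "H > 0"
    "\<And>a t. a \<in> S \<Longrightarrow> t < H \<Longrightarrow> fst ((phi ^^ t) (start a)) \<in> Pos"
    "\<And>a t. a \<in> S \<Longrightarrow> Suc t < H \<Longrightarrow> fst ((phi ^^ t) (start a)) \<in> S \<Longrightarrow>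
        col (fst ((phi ^^ t) (start a))) \<noteq> snd ((phi ^^ t) (start a))"
    "\<And>a. a \<in> S \<Longrightarrow> \<exists>b\<in>S. (phi ^^ (H - 1)) (start a) = rho (start b)"
    "bij_betw (\<lambda>(a, t). (phi ^^ t) (start a)) (S \<times> {..<H}) (Pos \<times> UNIV)"
    by (rule walk_exists) blast
  have "card S * H = 2 * card Pos"
    using bij_betw_same_card[OF H(5)] by (simp add: card_cartesian_product)
  moreover have "card R = 2 * card Pos"
  proof -
    have "R = Pos \<union> uminus ` Pos"
    proof (intro equalityI subsetI)
      fix b assume "b \<in> R"
      then have "b \<in> Pos \<or> - b \<in> Pos" by (rule Pos_cases)
      then show "b \<in> Pos \<union> uminus ` Pos" by (auto intro: image_eqI[of b uminus "- b"])
    qed (use Pos_R minus_R in auto)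
    moreover have "Pos \<inter> uminus ` Pos = {}" using Pos_not_minus by auto
    ultimately have "card R = card Pos + card (uminus ` Pos)"
      using card_Un_disjoint[OF finite_Pos finite_imageI[OF finite_Pos]] by metis
    then show ?thesis by (simp add: card_image)
  qed
  ultimately have "real (card S) * real H = real (card S) * real hh"
    using card_R hh_height by (metis of_nat_mult)
  then have Hh: "H = hh" using finite_S S_nonempty by simp
  show "hh \<ge> 2" using hh_height ht_Pos[OF theta_Pos] by linarith
  show "\<And>a t. a \<in> S \<Longrightarrow> t < hh \<Longrightarrow> fst ((phi ^^ t) (start a)) \<in> Pos"
    "\<And>a t. a \<in> S \<Longrightarrow> Suc t < hh \<Longrightarrow> fst ((phi ^^ t) (start a)) \<in> S \<Longrightarrow>
        col (fst ((phi ^^ t) (start a))) \<noteq> snd ((phi ^^ t) (start a))"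
    "\<And>a. a \<in> S \<Longrightarrow> \<exists>b\<in>S. (phi ^^ (hh - 1)) (start a) = rho (start b)"
    "bij_betw (\<lambda>(a, t). (phi ^^ t) (start a)) (S \<times> {..<hh}) (Pos \<times> UNIV)"
    using H unfolding Hh by blast+
qed

end

section \<open>The reverse operator on a graded poset\<close>

lemma orbit_of_self: "x \<in> orbit_of f x"
  unfolding orbit_of_def by (intro CollectI exI[of _ 0]) simp

lemma funpow_mod_period:
  assumes "(f ^^ n) x = x" shows "(f ^^ (k mod n)) x = (f ^^ k) x"
proof -
  have per: "(f ^^ (n * j)) x = x" for j
  proof (induction j)
    case (Suc j)
    then show ?case using assms by (simp add: funpow_add)
  qed simp
  have "(f ^^ k) x = (f ^^ (k mod n + n * (k div n))) x" by simp
  also have "\<dots> = (f ^^ (k mod n)) x" unfolding funpow_add using per by simp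
  finally show ?thesis by simp
qed

lemma orbit_of_periodic:
  assumes "n > 0" "(f ^^ n) x = x" shows "orbit_of f x = (\<lambda>k. (f ^^ k) x) ` {..<n}"
proof
  show "orbit_of f x \<subseteq> (\<lambda>k. (f ^^ k) x) ` {..<n}"
  proof
    fix y assume "y \<in> orbit_of f x"
    then obtain k where "y = (f ^^ k) x" by (auto simp: orbit_of_def)
    then have "y = (f ^^ (k mod n)) x" using funpow_mod_period[OF assms(2)] by metis
    then show "y \<in> (\<lambda>k. (f ^^ k) x) ` {..<n}" using assms(1) by auto
  qed
qed (auto simp: orbit_of_def)

lemma card_orbit_of:
  assumes n: "n > 0" "(f ^^ n) x = x" and min: "\<And>k. 0 < k \<Longrightarrow> k < n \<Longrightarrow> (f ^^ k) x \<noteq> x"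
  shows "card (orbit_of f x) = n"
proof -
  have "inj_on (\<lambda>k. (f ^^ k) x) {..<n}"
  proof (rule linorder_inj_onI)
    fix i j assume ij: "i < j" "i \<in> {..<n}" "j \<in> {..<n}"
    show "(f ^^ i) x \<noteq> (f ^^ j) x"
    proof
      assume eq: "(f ^^ i) x = (f ^^ j) x"
      have "(f ^^ (n - j + i)) x = (f ^^ (n - j + j)) x" using eq by (simp only: funpow_add o_apply)
      then have "(f ^^ (n - j + i)) x = x" using n ij by simp
      moreover have "0 < n - j + i" "n - j + i < n" using ij(1) ij(3)[simplified] by linarith+
      ultimately show False using min[of "n - j + i"] by simp
    qed
  qed (rule linear)
  then show ?thesis unfolding orbit_of_periodic[OF n] by (simp add: card_image)
qed

lemma orbit_of_eq:
  assumes "n > 0" "(f ^^ n) x = x" "y \<in> orbit_of f x" shows "orbit_of f y = orbit_of f x"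
proof -
  obtain k where k: "k < n" "y = (f ^^ k) x" using assms(3) unfolding orbit_of_periodic[OF assms(1,2)] by auto
  have x: "x = (f ^^ (n - k)) y"
    using k assms(2) funpow_add[of "n - k" k f] by simp
  have "(f ^^ j) y \<in> orbit_of f x" for j
    unfolding orbit_of_def k(2) by (intro CollectI exI[of _ "j + k"]) (simp add: funpow_add)
  moreover have "(f ^^ j) x \<in> orbit_of f y" for j
    unfolding orbit_of_def by (subst x) (intro CollectI exI[of _ "j + (n - k)"], simp add: funpow_add)
  ultimately show ?thesis by (auto simp: orbit_of_def[of f x] orbit_of_def[of f y])
qed

lemma orbits_count:
  assumes fin: "finite A" and maps: "\<And>x. x \<in> A \<Longrightarrow> f x \<in> A" and n: "n > 0"
    and per: "\<And>x. x \<in> A \<Longrightarrow> (f ^^ n) x = x"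
    and min: "\<And>x k. x \<in> A \<Longrightarrow> 0 < k \<Longrightarrow> k < n \<Longrightarrow> (f ^^ k) x \<noteq> x"
  shows "\<And>Ob. Ob \<in> orbits f A \<Longrightarrow> card Ob = n" and "n * card (orbits f A) = card A"
proof -
  have stay: "(f ^^ k) x \<in> A" if "x \<in> A" for k x using that maps by (induction k) auto
  show c: "card Ob = n" if "Ob \<in> orbits f A" for Ob
    using that card_orbit_of[OF n per min] by (auto simp: orbits_def)
  have "\<Union> (orbits f A) = A"
    using stay orbit_of_self[of _ f] by (auto simp: orbits_def orbit_of_def[abs_def])
  moreover have "n * card (orbits f A) = card (\<Union> (orbits f A))"
  proof (rule card_partition)
    show "finite (orbits f A)" using fin by (simp add: orbits_def)
    show "finite (\<Union> (orbits f A))" using fin calculation by simp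
    show "card c = n" if "c \<in> orbits f A" for c using c that .
    fix c1 c2 assume c12: "c1 \<in> orbits f A" "c2 \<in> orbits f A" "c1 \<noteq> c2"
    show "c1 \<inter> c2 = {}"
    proof (rule ccontr)
      assume "c1 \<inter> c2 \<noteq> {}"
      then obtain y where y: "y \<in> c1" "y \<in> c2" by blast
      obtain x1 where x1: "x1 \<in> A" "c1 = orbit_of f x1" using c12(1) unfolding orbits_def by blast
      obtain x2 where x2: "x2 \<in> A" "c2 = orbit_of f x2" using c12(2) unfolding orbits_def by blast
      have "orbit_of f y = c1" using orbit_of_eq[OF n per[OF x1(1)]] y(1) x1(2) by simp
      moreover have "orbit_of f y = c2" using orbit_of_eq[OF n per[OF x2(1)]] y(2) x2(2) by simp
      ultimately show False using c12(3) by simp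
    qed
  qed
  ultimately show "n * card (orbits f A) = card A" by simp
qed

lemma lower_idealsD:
  "K \<in> lower_ideals P le \<Longrightarrow> x \<in> K \<Longrightarrow> x \<in> P"
  "K \<in> lower_ideals P le \<Longrightarrow> x \<in> K \<Longrightarrow> y \<in> P \<Longrightarrow> le y x \<Longrightarrow> y \<in> K"
  by (auto simp: lower_ideals_def)

section \<open>Toggles by parity of the rank, and their conjugacy with the reverse operator\<close>

locale graded_poset =
  fixes P :: "'b set" and le :: "'b \<Rightarrow> 'b \<Rightarrow> bool" and F :: "'b \<Rightarrow> int"
  assumes finite_P: "finite P"
    and le_refl: "x \<in> P \<Longrightarrow> le x x"
    and le_antisym: "x \<in> P \<Longrightarrow> y \<in> P \<Longrightarrow> le x y \<Longrightarrow> le y x \<Longrightarrow> x = y"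
    and le_trans: "x \<in> P \<Longrightarrow> y \<in> P \<Longrightarrow> z \<in> P \<Longrightarrow> le x y \<Longrightarrow> le y z \<Longrightarrow> le x z"
    and up: "x \<in> P \<Longrightarrow> y \<in> P \<Longrightarrow> le x y \<Longrightarrow> x \<noteq> y \<Longrightarrow> \<exists>z\<in>P. le x z \<and> le z y \<and> F z = F x + 1"
    and down: "x \<in> P \<Longrightarrow> y \<in> P \<Longrightarrow> le x y \<Longrightarrow> x \<noteq> y \<Longrightarrow> \<exists>z\<in>P. le x z \<and> le z y \<and> F z = F y - 1"
    and F_mono: "x \<in> P \<Longrightarrow> y \<in> P \<Longrightarrow> le x y \<Longrightarrow> x \<noteq> y \<Longrightarrow> F x < F y"
begin

abbreviation "JJ \<equiv> lower_ideals P le"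
abbreviation "XX \<equiv> panyushev P le"

definition lt :: "'b \<Rightarrow> 'b \<Rightarrow> bool" where "lt x y \<longleftrightarrow> le x y \<and> x \<noteq> y"

text \<open>Maximal members leave and minimal non-members enter. Covers change \<open>F\<close> by
  one, so elements of equal parity do not interfere and can be toggled simultaneously.\<close>

definition tau :: "bool \<Rightarrow> 'b set \<Rightarrow> 'b set" where
  "tau e K = {g\<in>P. if even (F g) = e then (if g \<in> K then \<exists>g'\<in>K. lt g g' else \<forall>g'\<in>P. lt g' g \<longrightarrow> g' \<in> K)
                   else g \<in> K}"

lemma finite_JJ: "finite JJ"
  by (rule finite_subset[of _ "Pow P"]) (use finite_P in \<open>auto simp: lower_ideals_def\<close>)

lemma JJ_covers:
  assumes sub: "K \<subseteq> P" and cov: "\<And>x y. x \<in> K \<Longrightarrow> y \<in> P \<Longrightarrow> lt y x \<Longrightarrow> F y = F x - 1 \<Longrightarrow> y \<in> K"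
  shows "K \<in> JJ"
proof -
  have "y \<in> K" if "x \<in> K" "y \<in> P" "le y x" for x y
    using that
  proof (induction "nat (F x - F y)" arbitrary: x rule: less_induct)
    case less
    have xP: "x \<in> P" using less.prems sub by blast
    show ?case
    proof (cases "y = x")
      case False
      obtain z where z: "z \<in> P" "le y z" "le z x" "F z = F x - 1"
        using down[OF less.prems(2) xP less.prems(3) False] by blast
      then have "z \<noteq> x" by auto
      then have zK: "z \<in> K" using cov[OF less.prems(1) z(1) _ z(4)] z(3) by (simp add: lt_def)
      have "F y < F x" using F_mono[OF less.prems(2) xP less.prems(3) False] .
      then have "nat (F z - F y) < nat (F x - F y)" using z(4) by linarith
      then show ?thesis using less.hyps zK less.prems(2) z(2) by blast
    qed (use less in simp)
  qed
  then show ?thesis using sub by (auto simp: lower_ideals_def)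
qed

lemma tau_JJ:
  assumes K: "K \<in> JJ" shows "tau e K \<in> JJ"
proof (rule JJ_covers)
  fix x y assume x: "x \<in> tau e K" and y: "y \<in> P" "lt y x" "F y = F x - 1"
  have xP: "x \<in> P" using x by (simp add: tau_def)
  have par: "even (F y) \<noteq> even (F x)" using y(3) by simp
  have le: "le y x" using y(2) by (simp add: lt_def)
  show "y \<in> tau e K"
  proof (cases "even (F x) = e")
    case True
    then have "x \<in> K \<or> (\<forall>g'\<in>P. lt g' x \<longrightarrow> g' \<in> K)" using x by (auto simp: tau_def split: if_splits)
    then have "y \<in> K" using lower_idealsD(2)[OF K _ y(1) le] y by blast
    then show ?thesis using True par y(1) by (auto simp: tau_def)
  next
    case False
    then have "x \<in> K" using x by (auto simp: tau_def)
    then have "y \<in> K" using lower_idealsD(2)[OF K _ y(1) le] by blast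
    then show ?thesis using False par y(1,2) \<open>x \<in> K\<close> by (auto simp: tau_def)
  qed
qed (auto simp: tau_def)

text \<open>Membership of \<open>g\<close> in \<open>XX K\<close> depends only on the next higher
  rank of \<open>XX K\<close> and the next lower rank of \<open>K\<close>. Read from the top rank
  downwards, this recursion determines \<open>XX K\<close>.\<close>

lemma row_rule:
  assumes K: "K \<in> JJ" and g: "g \<in> P"
  shows "g \<in> XX K \<longleftrightarrow> (\<exists>g'\<in>XX K. lt g g' \<and> F g' = F g + 1) \<or>
    (g \<notin> K \<and> (\<forall>g'\<in>P. lt g' g \<longrightarrow> F g' = F g - 1 \<longrightarrow> g' \<in> K))"
proof
  assume "g \<in> XX K"
  then obtain x where x: "x \<in> minimal_elems (P - K) le" "le g x" by (auto simp: panyushev_def)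
  have xP: "x \<in> P" "x \<notin> K" and xmin: "\<And>y. y \<in> P \<Longrightarrow> y \<notin> K \<Longrightarrow> le y x \<Longrightarrow> y = x"
    using x by (auto simp: minimal_elems_def)
  show "(\<exists>g'\<in>XX K. lt g g' \<and> F g' = F g + 1) \<or>
    (g \<notin> K \<and> (\<forall>g'\<in>P. lt g' g \<longrightarrow> F g' = F g - 1 \<longrightarrow> g' \<in> K))"
  proof (cases "x = g")
    case True
    then show ?thesis using xP xmin by (auto simp: lt_def)
  next
    case False
    obtain z where z: "z \<in> P" "le g z" "le z x" "F z = F g + 1" using up[OF g xP(1) x(2)] False by blast
    then have "z \<in> XX K" using x(1) by (auto simp: panyushev_def)
    moreover have "lt g z" using z by (auto simp: lt_def)
    ultimately show ?thesis using z(4) by blast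
  qed
next
  assume "(\<exists>g'\<in>XX K. lt g g' \<and> F g' = F g + 1) \<or>
    (g \<notin> K \<and> (\<forall>g'\<in>P. lt g' g \<longrightarrow> F g' = F g - 1 \<longrightarrow> g' \<in> K))"
  then show "g \<in> XX K"
  proof
    assume "\<exists>g'\<in>XX K. lt g g' \<and> F g' = F g + 1"
    then obtain g' x where *: "g' \<in> P" "lt g g'" "x \<in> minimal_elems (P - K) le" "le g' x"
      by (auto simp: panyushev_def)
    then have "le g x" using le_trans[OF g *(1)] by (auto simp: lt_def minimal_elems_def)
    then show ?thesis using g * by (auto simp: panyushev_def)
  next
    assume *: "g \<notin> K \<and> (\<forall>g'\<in>P. lt g' g \<longrightarrow> F g' = F g - 1 \<longrightarrow> g' \<in> K)"
    have "y = g" if y: "y \<in> P" "y \<notin> K" "le y g" for y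
    proof (rule ccontr)
      assume ne: "y \<noteq> g"
      obtain z where z: "z \<in> P" "le y z" "le z g" "F z = F g - 1" using down[OF y(1) g y(3) ne] by blast
      then have "z \<in> K" using * by (auto simp: lt_def)
      then show False using lower_idealsD(2)[OF K _ y(1) z(2)] y(2) by blast
    qed
    then have "g \<in> minimal_elems (P - K) le" using g * by (auto simp: minimal_elems_def)
    then show ?thesis using g le_refl by (auto simp: panyushev_def)
  qed
qed

lemma row_rule_unique:
  assumes K: "K \<in> JJ" and Y: "Y \<subseteq> P"
    and rule: "\<And>g. g \<in> P \<Longrightarrow> g \<in> Y \<longleftrightarrow> (\<exists>g'\<in>Y. lt g g' \<and> F g' = F g + 1) \<or>
      (g \<notin> K \<and> (\<forall>g'\<in>P. lt g' g \<longrightarrow> F g' = F g - 1 \<longrightarrow> g' \<in> K))"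
  shows "XX K = Y"
proof -
  define M where "M = Max (F ` P)"
  have M: "F g \<le> M" if "g \<in> P" for g unfolding M_def using that finite_P by simp
  have XP: "XX K \<subseteq> P" by (auto simp: panyushev_def)
  have "g \<in> XX K \<longleftrightarrow> g \<in> Y" if "g \<in> P" for g
    using that
  proof (induction "nat (M - F g)" arbitrary: g rule: less_induct)
    case less
    have "g' \<in> XX K \<longleftrightarrow> g' \<in> Y" if "g' \<in> P" "F g' = F g + 1" for g'
      by (rule less.hyps) (use that M[OF that(1)] in linarith)+
    then have "(\<exists>g'\<in>XX K. lt g g' \<and> F g' = F g + 1) \<longleftrightarrow> (\<exists>g'\<in>Y. lt g g' \<and> F g' = F g + 1)"
      using XP Y by blast
    then show ?case unfolding row_rule[OF K less.prems] rule[OF less.prems] by simp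
  qed
  then show ?thesis using XP Y by blast
qed

fun kw :: "'b set \<Rightarrow> nat \<Rightarrow> 'b set" where
  "kw K 0 = K"
| "kw K (Suc s) = tau (even s) (kw K s)"

definition TT :: "'b set \<Rightarrow> 'b set" where "TT K = tau False (tau True K)"

lemma kw_JJ: "K \<in> JJ \<Longrightarrow> kw K s \<in> JJ"
  by (induction s) (simp_all add: tau_JJ)

lemma kw_TT: "kw (TT K) s = kw K (s + 2)"
  by (induction s) (simp_all add: TT_def)

lemma kw_TT_pow: "kw ((TT ^^ m) K) s = kw K (s + 2 * m)"
  by (induction m arbitrary: s) (simp_all add: kw_TT)

lemma kw_even: "kw K (2 * m) = (TT ^^ m) K"
  using kw_TT_pow[of m K 0] by simp

lemma TT_JJ: "K \<in> JJ \<Longrightarrow> TT K \<in> JJ"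
  by (simp add: TT_def tau_JJ)

lemma kw_same: "even (F g) \<noteq> even s \<Longrightarrow> g \<in> P \<Longrightarrow> g \<in> kw K (Suc s) \<longleftrightarrow> g \<in> kw K s"
  by (auto simp: tau_def)

lemma kw_update: "even (F g) = even s \<Longrightarrow> g \<in> P \<Longrightarrow> g \<in> kw K (Suc s) \<longleftrightarrow>
    (if g \<in> kw K s then \<exists>g'\<in>kw K s. lt g g' else \<forall>g'\<in>P. lt g' g \<longrightarrow> g' \<in> kw K s)"
  by (auto simp: tau_def)

text \<open>The space-time diagram of the alternating toggles, cut along the slices \<open>s = N - F g\<close>,
  evolves by the reverse operator.\<close>

definition NN :: int where "NN = 2 * (\<Sum>g\<in>P. \<bar>F g\<bar>) + 1"

definition Th :: "'b set \<Rightarrow> 'b set" where "Th K = {g\<in>P. g \<in> kw K (nat (NN - F g))}"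

text \<open>An element is toggled in the step leaving time \<open>s\<close> when \<open>s\<close>
  and its rank have equal parity. With \<open>NN\<close> odd this is the step arriving at time
  \<open>NN - F g\<close>, so the slice reads each element just after its update; the bound makes
  that time positive.\<close>

lemma NN: "odd NN" "g \<in> P \<Longrightarrow> F g < NN"
proof -
  show "odd NN" by (simp add: NN_def)
  assume "g \<in> P"
  then have "\<bar>F g\<bar> \<le> (\<Sum>g\<in>P. \<bar>F g\<bar>)" using finite_P by (intro member_le_sum) auto
  then show "F g < NN" unfolding NN_def by linarith
qed

text \<open>One rank lower means one time step later: \<open>y\<close> is present at the time of
  \<open>x\<close>, and in the next step it cannot leave because \<open>x\<close> lies above
  it.\<close>

lemma Th_JJ:
  assumes K: "K \<in> JJ" shows "Th K \<in> JJ"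
proof (rule JJ_covers)
  fix x y assume x: "x \<in> Th K" and y: "y \<in> P" "lt y x" "F y = F x - 1"
  have xP: "x \<in> P" and xk: "x \<in> kw K (nat (NN - F x))" using x by (auto simp: Th_def)
  define s where "s = nat (NN - F x)"
  have s: "int s = NN - F x" using NN(2)[OF xP] by (simp add: s_def)
  have ys: "nat (NN - F y) = Suc s" using s y(3) by linarith
  have "even (int s) \<longleftrightarrow> odd (F x)" unfolding s using NN(1) by simp
  then have par: "even (F y) = even s" using y(3) by simp
  have "y \<in> kw K s"
    using lower_idealsD(2)[OF kw_JJ[OF K] xk[folded s_def] y(1)] y(2) by (simp add: lt_def)
  then have "y \<in> kw K (Suc s)" using kw_update[OF par y(1)] xk y(2) by (auto simp: s_def)
  then show "y \<in> Th K" using y(1) ys by (simp add: Th_def)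
qed (auto simp: Th_def)

text \<open>The toggle of \<open>g\<close> between two consecutive slices looks at the rank above,
  already on the new slice, and at the rank below, still on the old one. That is
  \<open>row_rule\<close>.\<close>

lemma Th_equivariant:
  assumes K: "K \<in> JJ" shows "XX (Th K) = Th (TT K)"
proof (rule row_rule_unique[OF Th_JJ[OF K]])
  show "Th (TT K) \<subseteq> P" by (auto simp: Th_def)
  fix g assume g: "g \<in> P"
  have ThT: "x \<in> Th (TT K) \<longleftrightarrow> x \<in> kw K (nat (NN + 2 - F x))" if "x \<in> P" for x
  proof -
    have "nat (NN - F x) + 2 = nat (NN + 2 - F x)" using NN(2)[OF that] by linarith
    then show ?thesis using that by (simp only: Th_def kw_TT mem_Collect_eq simp_thms)
  qed
  \<comment> \<open>The time at which \<open>g\<close> is toggled, halfway between its times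
    \<open>NN - F g\<close> and \<open>NN + 2 - F g\<close> on the two slices.\<close>
  define s where "s = nat (NN + 1 - F g)"
  have s: "int s = NN + 1 - F g" using NN(2)[OF g] by (simp add: s_def)
  have "even (int s) \<longleftrightarrow> even (F g)" unfolding s using NN(1) by simp
  then have par: "even (F g) = even s" by simp
  have gY: "g \<in> Th (TT K) \<longleftrightarrow> g \<in> kw K (Suc s)"
  proof -
    have "nat (NN + 2 - F g) = Suc s" using s by linarith
    then show ?thesis using ThT[OF g] by simp
  qed
  have gTh: "g \<in> kw K s \<longleftrightarrow> g \<in> Th K"
  proof -
    obtain r where r: "s = Suc r" using s NN(2)[OF g] by (cases s) auto
    have "nat (NN - F g) = r" using s r by linarith
    then have "g \<in> Th K \<longleftrightarrow> g \<in> kw K r" using g by (simp add: Th_def)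
    also have "\<dots> \<longleftrightarrow> g \<in> kw K (Suc r)" using kw_same[of g r K] par r g by auto
    finally show ?thesis using r by simp
  qed
  note ideal = kw_JJ[OF K, of s]
  have C: "(\<exists>g'\<in>kw K s. lt g g') \<longleftrightarrow> (\<exists>g'\<in>Th (TT K). lt g g' \<and> F g' = F g + 1)"
  proof
    assume "\<exists>g'\<in>kw K s. lt g g'"
    then obtain g' where g': "g' \<in> kw K s" "lt g g'" by blast
    have g'P: "g' \<in> P" using lower_idealsD(1)[OF ideal g'(1)] .
    obtain z where z: "z \<in> P" "le g z" "le z g'" "F z = F g + 1"
      using up[OF g g'P] g'(2) by (auto simp: lt_def)
    have "z \<in> kw K s" using lower_idealsD(2)[OF ideal g'(1) z(1,3)] .
    moreover have "nat (NN + 2 - F z) = s" using s z(4) by linarith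
    ultimately have "z \<in> Th (TT K)" using ThT[OF z(1)] by simp
    moreover have "lt g z" using z by (auto simp: lt_def)
    ultimately show "\<exists>g'\<in>Th (TT K). lt g g' \<and> F g' = F g + 1" using z(4) by blast
  next
    assume "\<exists>g'\<in>Th (TT K). lt g g' \<and> F g' = F g + 1"
    then obtain z where z: "z \<in> Th (TT K)" "lt g z" "F z = F g + 1" by blast
    have "nat (NN + 2 - F z) = s" using s z(3) by linarith
    moreover have "z \<in> P" using z(1) by (simp add: Th_def)
    ultimately have "z \<in> kw K s" using ThT z(1) by auto
    then show "\<exists>g'\<in>kw K s. lt g g'" using z(2) by blast
  qed
  have Thlow: "z \<in> Th K \<longleftrightarrow> z \<in> kw K s" if "z \<in> P" "F z = F g - 1" for z
  proof -
    have "nat (NN - F z) = s" using s that(2) by linarith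
    then show ?thesis using that(1) by (simp add: Th_def)
  qed
  have D: "(\<forall>g'\<in>P. lt g' g \<longrightarrow> g' \<in> kw K s) \<longleftrightarrow> (\<forall>g'\<in>P. lt g' g \<longrightarrow> F g' = F g - 1 \<longrightarrow> g' \<in> Th K)"
  proof
    assume *: "\<forall>g'\<in>P. lt g' g \<longrightarrow> F g' = F g - 1 \<longrightarrow> g' \<in> Th K"
    show "\<forall>g'\<in>P. lt g' g \<longrightarrow> g' \<in> kw K s"
    proof (intro ballI impI)
      fix g' assume g': "g' \<in> P" "lt g' g"
      then obtain z where z: "z \<in> P" "le g' z" "le z g" "F z = F g - 1"
        using down[OF g'(1) g] by (auto simp: lt_def)
      then have "lt z g" by (auto simp: lt_def)
      then have "z \<in> kw K s" using * z Thlow by blast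
      then show "g' \<in> kw K s" using lower_idealsD(2)[OF ideal _ g'(1) z(2)] by blast
    qed
  qed (use Thlow in blast)
  have "g \<in> kw K s" if "\<exists>g'\<in>kw K s. lt g g'"
    using that lower_idealsD(2)[OF ideal _ g] by (auto simp: lt_def)
  then show "g \<in> Th (TT K) \<longleftrightarrow> (\<exists>g'\<in>Th (TT K). lt g g' \<and> F g' = F g + 1) \<or>
      (g \<notin> Th K \<and> (\<forall>g'\<in>P. lt g' g \<longrightarrow> F g' = F g - 1 \<longrightarrow> g' \<in> Th K))"
    unfolding gY kw_update[OF par g] C[symmetric] D[symmetric] gTh[symmetric] by auto
qed

lemma TT_pow_JJ: "K \<in> JJ \<Longrightarrow> (TT ^^ m) K \<in> JJ"
  by (induction m) (simp_all add: TT_JJ)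

lemma Th_TT_pow: "K \<in> JJ \<Longrightarrow> (XX ^^ m) (Th K) = Th ((TT ^^ m) K)"
  by (induction m) (simp_all add: Th_equivariant TT_pow_JJ)

text \<open>Equal slices have equal later slices, and elements do not change between their updates,
  so all late rows of the diagram agree. By periodicity \<open>K\<close> itself is a late
  row.\<close>

lemma Th_bij:
  assumes p: "p > 0" and per: "\<And>K. K \<in> JJ \<Longrightarrow> (TT ^^ p) K = K"
  shows "bij_betw Th JJ JJ"
proof -
  have "K = K'" if K: "K \<in> JJ" "K' \<in> JJ" and eq: "Th K = Th K'" for K K'
  proof -
    have eqt: "Th ((TT ^^ t) K) = Th ((TT ^^ t) K')" for t
      using Th_TT_pow[OF K(1), of t] Th_TT_pow[OF K(2), of t] eq by simp
    have slice: "g \<in> kw K s \<longleftrightarrow> g \<in> kw K' s" if g: "g \<in> P" and s: "NN - F g \<le> int s" for g s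
    proof -
      define r where "r = nat (NN - F g)"
      have r: "int r = NN - F g" using NN(2)[OF g] by (simp add: r_def)
      have at: "g \<in> kw K (r + 2 * t) \<longleftrightarrow> g \<in> kw K' (r + 2 * t)" for t
        using eqt[of t] g by (auto simp: Th_def kw_TT_pow r_def)
      have "even (int r) \<longleftrightarrow> odd (F g)" unfolding r using NN(1) by simp
      then have par: "even (F g) \<noteq> even (r + 2 * t)" for t by simp
      define t where "t = (s - r) div 2"
      have "r \<le> s" using s r by linarith
      then have "s = r + 2 * t \<or> s = Suc (r + 2 * t)" unfolding t_def by presburger
      then show ?thesis using at[of t] kw_same[OF par[of t] g] by blast
    qed
    \<comment> \<open>A multiple of the period \<open>p\<close> such that time \<open>2 * m\<close>
      lies beyond the slice everywhere.\<close>
    define m where "m = p * nat NN + p * (\<Sum>g\<in>P. nat \<bar>F g\<bar>)"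
    have big: "NN - F g \<le> int (2 * m)" if g: "g \<in> P" for g
    proof -
      have "nat \<bar>F g\<bar> \<le> (\<Sum>g\<in>P. nat \<bar>F g\<bar>)" using g finite_P by (intro member_le_sum) auto
      also have "\<dots> \<le> p * (\<Sum>g\<in>P. nat \<bar>F g\<bar>)" using p by simp
      finally have "nat \<bar>F g\<bar> \<le> p * (\<Sum>g\<in>P. nat \<bar>F g\<bar>)" .
      moreover have "nat NN \<le> p * nat NN" using p by simp
      moreover obtain A B where AB: "A = p * nat NN" "B = p * (\<Sum>g\<in>P. nat \<bar>F g\<bar>)" by blast
      ultimately have "nat \<bar>F g\<bar> \<le> B" "nat NN \<le> A" by simp_all
      then have "\<bar>F g\<bar> \<le> int B" "NN \<le> int A" by (simp_all add: nat_le_iff)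
      moreover have "- F g \<le> \<bar>F g\<bar>" by simp
      ultimately have "NN - F g \<le> int (2 * (A + B))" by simp
      then show ?thesis unfolding m_def AB .
    qed
    have full: "(TT ^^ m) L = L" if L: "L \<in> JJ" for L
    proof -
      have "m mod p = 0" by (simp add: m_def)
      then show ?thesis using funpow_mod_period[OF per[OF L], of m] by simp
    qed
    have "g \<in> K \<longleftrightarrow> g \<in> K'" if "g \<in> P" for g
      using slice[OF that big[OF that]] unfolding kw_even full[OF K(1)] full[OF K(2)] .
    moreover have "K \<subseteq> P" "K' \<subseteq> P" using K by (simp_all add: lower_ideals_def)
    ultimately show "K = K'" by blast
  qed
  then have "inj_on Th JJ" by (rule inj_onI) blast
  moreover have "Th ` JJ \<subseteq> JJ" using Th_JJ by blast
  ultimately show ?thesis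
    using endo_inj_surj[OF finite_JJ] by (auto simp: bij_betw_def)
qed

lemma row_period:
  assumes p: "p > 0" and per: "\<And>K. K \<in> JJ \<Longrightarrow> (TT ^^ p) K = K"
    and min: "\<And>K k. K \<in> JJ \<Longrightarrow> 0 < k \<Longrightarrow> k < p \<Longrightarrow> (TT ^^ k) K \<noteq> K"
    and I: "I \<in> JJ"
  shows "(XX ^^ p) I = I" and "0 < k \<Longrightarrow> k < p \<Longrightarrow> (XX ^^ k) I \<noteq> I"
proof -
  have bij: "bij_betw Th JJ JJ" by (rule Th_bij[OF p per])
  then obtain K where K: "K \<in> JJ" "I = Th K" using I by (auto simp: bij_betw_def)
  show "(XX ^^ p) I = I" using Th_TT_pow[OF K(1), of p] per[OF K(1)] K(2) by simp
  assume k: "0 < k" "k < p"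
  show "(XX ^^ k) I \<noteq> I"
    using Th_TT_pow[OF K(1), of k] min[OF K(1) k] K TT_pow_JJ[OF K(1), of k] bij
    by (auto simp: bij_betw_def inj_on_def)
qed

lemma row_JJ: "XX K \<in> JJ"
  unfolding lower_ideals_def
proof (intro CollectI conjI ballI impI)
  fix x y assume x: "x \<in> XX K" and y: "y \<in> P" "le y x"
  then obtain m where m: "x \<in> P" "m \<in> minimal_elems (P - K) le" "le x m" by (auto simp: panyushev_def)
  then have "le y m" using le_trans[OF y(1) m(1) _ y(2) m(3)] by (simp add: minimal_elems_def)
  then show "y \<in> XX K" using y(1) m(2) by (auto simp: panyushev_def)
qed (auto simp: panyushev_def)

end

context coloured_root_system
begin

section \<open>Labels and toggles\<close>

definition lat :: "'a \<Rightarrow> bool" where "lat v \<longleftrightarrow> (\<forall>a\<in>S. cf v a \<in> \<int>)"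

text \<open>Weighting the simple roots orthogonal to \<open>\<theta>\<close> by 1 makes \<open>Fi\<close> a rank function on \<open>P\<close>;
  the other weights fix its parity on the minimal elements.\<close>

definition wt :: "'a \<Rightarrow> int" where "wt a = (if dg a = 0 \<or> \<not> col a then 1 else 0)"

definition Fi :: "'a \<Rightarrow> int" where "Fi v = (\<Sum>a\<in>S. \<lfloor>cf v a\<rfloor> * wt a)"

definition dgi :: "'a \<Rightarrow> int" where "dgi v = \<lfloor>dg v\<rfloor>"

lemma lat_R: "b \<in> R \<Longrightarrow> lat b"
  by (simp add: lat_def root_cf_Ints)

lemma lat_diff: "lat x \<Longrightarrow> lat y \<Longrightarrow> lat (x - y)"
  by (simp add: lat_def cf_diff)

lemma lat_scale: "lat x \<Longrightarrow> lat (of_int m *\<^sub>R x)"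
  by (simp add: lat_def cf_scale)

lemma Fi_of_int: "lat v \<Longrightarrow> real_of_int (Fi v) = (\<Sum>a\<in>S. cf v a * of_int (wt a))"
  unfolding Fi_def of_int_sum of_int_mult lat_def
  by (rule sum.cong) (auto elim!: Ints_cases dest!: bspec)

lemma Fi_diff:
  assumes "lat x" "lat y" shows "Fi (x - y) = Fi x - Fi y"
proof -
  have "real_of_int (Fi (x - y)) = real_of_int (Fi x - Fi y)"
    using assms lat_diff by (simp add: Fi_of_int cf_diff left_diff_distrib sum_subtractf)
  then show ?thesis by linarith
qed

lemma Fi_scale:
  assumes "lat x" shows "Fi (of_int m *\<^sub>R x) = m * Fi x"
proof -
  have "real_of_int (Fi (of_int m *\<^sub>R x)) = real_of_int (m * Fi x)"
    using assms lat_scale by (simp add: Fi_of_int cf_scale sum_distrib_left mult.assoc)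
  then show ?thesis by linarith
qed

lemma lat_0: "lat 0" by (simp add: lat_def)

lemma Fi_0: "Fi 0 = 0" by (simp add: Fi_def)

lemma lat_minus: "lat x \<Longrightarrow> lat (- x)"
  using lat_diff[OF lat_0] by simp

lemma Fi_minus: "lat x \<Longrightarrow> Fi (- x) = - Fi x"
  using Fi_diff[OF lat_0, of x] Fi_0 by simp

lemma Fi_S: "a \<in> S \<Longrightarrow> Fi a = wt a"
proof -
  assume a: "a \<in> S"
  have "Fi a = (\<Sum>b\<in>S. if b = a then wt a else 0)"
    unfolding Fi_def by (rule sum.cong) (use a in \<open>auto simp: cf_basis\<close>)
  then show ?thesis using a finite_S by simp
qed

lemma dgi: "b \<in> R \<Longrightarrow> of_int (dgi b) = dg b"
  using pair_Ints[OF theta_R] by (auto simp: dgi_def dg_def elim!: Ints_cases)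

text \<open>The parity of \<open>Fi g\<close> turns out to be the colour of the simple root labelling \<open>g\<close>
  in every abelian ideal. Reflections fixing \<open>w \<theta>\<close> destroy the invariant, whence the
  hypothesis \<open>odd (dgi y)\<close> in the step.\<close>

definition Inv :: "('a \<Rightarrow> 'a) \<Rightarrow> bool" where
  "Inv w \<longleftrightarrow> (\<forall>x\<in>R. \<forall>a\<in>S. w x = a \<longrightarrow> (even (Fi x) \<longleftrightarrow> odd (dgi x) \<and> col a))"

text \<open>\<open>wt\<close> is designed to make this base case true. A simple
  \<open>\<theta>\<close> would have degree 2, which the weights do not cover.\<close>

lemma Inv_id:
  assumes "\<theta> \<notin> S" shows "Inv id"
  unfolding Inv_def
proof (intro ballI impI)
  fix x a assume x: "x \<in> R" and a: "a \<in> S" "id x = a"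
  have xa: "x = a" using a by simp
  have "dg a \<noteq> 2" using dg_2[OF S_R[OF a(1)]] assms a(1) by auto
  then have "dg a = 0 \<or> dg a = 1"
    by (rule_tac dg_cases[OF S_R[OF a(1)]]) (use dg_Pos[OF S_Pos[OF a(1)]] dg_theta in \<open>auto simp: dg_minus\<close>)
  then show "even (Fi x) \<longleftrightarrow> odd (dgi x) \<and> col a"
    unfolding xa Fi_S[OF a(1)] by (auto simp: wt_def dgi_def)
qed

lemma Inv_step:
  assumes w: "good w" and inv: "Inv w" and b: "b \<in> S" and y: "y \<in> R" "w y = b" "odd (dgi y)"
  shows "Inv (refl_root b \<circ> w)"
  unfolding Inv_def
proof (intro ballI impI)
  note W = good_Wg[OF w]
  obtain u where u: "u \<in> Wg" "\<And>x. u (w x) = x" "\<And>x. w (u x) = x" using Wg_inv[OF W] by blast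
  fix x a assume x: "x \<in> R" and a: "a \<in> S" and eq: "(refl_root b \<circ> w) x = a"
  have wx: "w x = refl_root b a" using eq refl_root_invol[OF S_nz[OF b]] by (metis o_apply)
  obtain m where m: "pair a b = of_int m" using pair_Ints[OF S_R[OF b] S_R[OF a]] by (auto elim: Ints_cases)
  have yFi: "even (Fi y) \<longleftrightarrow> col b" using inv y b unfolding Inv_def by blast
  show "even (Fi x) \<longleftrightarrow> odd (dgi x) \<and> col a"
  proof (cases "a = b")
    case True
    have "w x = w (- y)" using wx True y(2) S_nz[OF b] by (simp add: refl_root_self Wg_minus[OF W])
    then have xy: "x = - y" using u(2) by metis
    have "real_of_int (dgi x) = real_of_int (- dgi y)" using dgi[OF x] dgi[OF y(1)] xy by (simp add: dg_minus)
    then have "dgi x = - dgi y" by linarith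
    moreover have "Fi x = - Fi y" unfolding xy by (rule Fi_minus[OF lat_R[OF y(1)]])
    ultimately show ?thesis using yFi y(3) True by simp
  next
    case False
    define x' where "x' = x + of_int m *\<^sub>R y"
    have wx': "w x' = a"
      using wx m y(2) by (simp add: x'_def Wg_add[OF W] Wg_scale[OF W] refl_root_pair)
    have x'R: "x' \<in> R" using u(2)[of x'] wx' Wg_R[OF u(1) S_R[OF a]] by simp
    have inv': "even (Fi x') \<longleftrightarrow> odd (dgi x') \<and> col a" using inv x'R a wx' unfolding Inv_def by blast
    have xx: "x = x' - of_int m *\<^sub>R y" by (simp add: x'_def)
    have Fx: "Fi x = Fi x' - m * Fi y"
      unfolding xx using Fi_diff[OF lat_R[OF x'R] lat_scale[OF lat_R[OF y(1)]]] Fi_scale[OF lat_R[OF y(1)]] by simp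
    have "dg x = dg x' - of_int m * dg y" by (simp add: xx dg_diff dg_scale)
    then have "real_of_int (dgi x) = real_of_int (dgi x' - m * dgi y)" using dgi x x'R y(1) by simp
    then have dx: "dgi x = dgi x' - m * dgi y" by linarith
    show ?thesis
    proof (cases "even m")
      case True
      then show ?thesis using Fx dx inv' by simp
    next
      \<comment> \<open>Now \<open>a\<close> and \<open>b\<close> are adjacent, of different
        colours, and the degree changes parity. \<open>Fi\<close> changes parity just when
        \<open>col b\<close> fails, that is when \<open>col a\<close> holds, which is what the
        invariant demands.\<close>
      case odd: False
      then have "a \<bullet> b \<noteq> 0" using m S_nz[OF b] by (auto simp: pair_def)
      then have "col a \<noteq> col b" using col[OF a b False] by blast
      then show ?thesis using Fx dx inv' yFi y(3) odd by auto
    qed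
  qed
qed

text \<open>Build the ideal one element \<open>g\<close> at a time: each addition reflects in a root
  whose preimage \<open>g\<close> has degree 1, as \<open>Inv_step\<close> requires.\<close>

lemma Inv_good:
  assumes t: "\<theta> \<notin> S" and w: "good w" shows "Inv w"
  using w
proof (induction "card (Iw w)" arbitrary: w rule: less_induct)
  case less
  have fin: "finite (Iw w)" using finite_P by (simp add: Iw_def)
  show ?case
  proof (cases "Iw w = {}")
    case True
    have "Iw id = {}" using P_Pos by (auto simp: Iw_def)
    then have "w = id" using good_uniq_Iw[OF less.prems good_id] True by simp
    then show ?thesis using Inv_id[OF t] by simp
  next
    case False
    have "Max (ht ` Iw w) \<in> ht ` Iw w" using False fin by (intro Max_in) auto
    then obtain g where g: "g \<in> Iw w" "ht g = Max (ht ` Iw w)" by auto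
    then have KJ: "Iw w - {g} \<in> J" using remove_max_J[OF Iw_J[OF less.prems] g(1)] fin by simp
    have "abel (Iw w - {g})" using Iw_abel[OF less.prems] by (auto simp: abel_def)
    then obtain v where v: "good v" "Iw v = Iw w - {g}" using abel_good[OF KJ] by blast
    have ins: "insert g (Iw v) = Iw w" using v g by auto
    have g': "g \<in> P" "g \<notin> Iw v" using g v by (auto simp: Iw_def)
    note ad = addable_simple[OF v(1) g', unfolded ins, OF Iw_J[OF less.prems] Iw_abel[OF less.prems]]
    have weq: "refl_root (v g) \<circ> v = w" using good_uniq_Iw[OF ad(2) less.prems ad(3)] .
    have "card (Iw v) < card (Iw w)" unfolding v(2) using g(1) fin by (intro card_Diff1_less)
    then have "Inv v" using less.hyps v(1) by blast
    moreover have "dgi g = 1" "g \<in> R" using g' P_R by (auto simp: dgi_def)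
    ultimately have "Inv (refl_root (v g) \<circ> v)" using Inv_step[OF v(1) _ ad(1)] by simp
    then show ?thesis unfolding weq .
  qed
qed

lemma P_theta: "g \<in> P \<Longrightarrow> \<theta> \<notin> S"
  using simple_not_sum[OF P_Pos P_Pos[OF theta_diff_P], of g g] by simp

lemma label_parity:
  assumes w: "good w" and g: "g \<in> P" and a: "a \<in> S" and eq: "w g = a \<or> w g = - a"
  shows "even (Fi g) = col a"
proof -
  note inv = Inv_good[OF P_theta[OF g] w]
  have gR: "g \<in> R" "dg g = 1" using g P_R by auto
  from eq show ?thesis
  proof
    assume "w g = a"
    moreover have "dgi g = 1" using gR by (simp add: dgi_def)
    ultimately show ?thesis using inv gR a unfolding Inv_def by force
  next
    assume "w g = - a"
    then have "w (- g) = a" by (simp add: Wg_minus[OF good_Wg[OF w]])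
    moreover have "- g \<in> R" using gR by simp
    moreover have "dgi (- g) = - 1"
    proof -
      have "real_of_int (dgi (- g)) = - 1" using dgi[OF \<open>- g \<in> R\<close>] gR by (simp add: dg_minus)
      then show ?thesis by linarith
    qed
    ultimately have "even (Fi (- g)) = col a" using inv a unfolding Inv_def by force
    then show ?thesis using Fi_minus[OF lat_R[OF gR(1)]] by simp
  qed
qed

text \<open>A root of least height in \<open>LP\<close> is simple, since otherwise a simple
  reflection would lower it within \<open>LP\<close>.\<close>

lemma long_simple_exists: "\<exists>a. a \<in> S \<and> a \<in> LP"
proof -
  have fin: "finite LP" "LP \<noteq> {}" using finite_Pos theta_Pos by (auto simp: LP_def)
  then have "Min (ht ` LP) \<in> ht ` LP" by (intro Min_in) auto
  then obtain b where b: "b \<in> LP" "ht b = Min (ht ` LP)" by auto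
  have bP: "b \<in> Pos" using b(1) by (simp add: LP_def)
  have "b \<in> S"
  proof (rule ccontr)
    assume n: "b \<notin> S"
    obtain a where a: "a \<in> S" "b \<bullet> a > 0" using acute_simple[OF bP] by blast
    have "refl_root a b \<in> Pos" using refl_simple_Pos[OF bP a(1)] a n by auto
    then have "refl_root a b \<in> LP" using b(1) refl_root_inner[OF S_nz[OF a(1)]] by (simp add: LP_def)
    then have "ht b \<le> ht (refl_root a b)" using b(2) fin by simp
    moreover have "pair b a > 0" using a S_nz by (simp add: pair_pos_iff)
    ultimately show False using a(1) by (simp add: refl_root_pair ht_diff ht_scale ht_S)
  qed
  then show ?thesis using b(1) by blast
qed

text \<open>Apply the invariant to a \<open>w\<close> that makes \<open>\<theta>\<close> simple: its
  degree 2 is even. Consequently \<open>g \<mapsto> \<theta> - g\<close> exchanges the two parities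
  on \<open>P\<close>.\<close>

lemma odd_Fi_theta:
  assumes "\<theta> \<notin> S" shows "odd (Fi \<theta>)"
proof -
  obtain a where a: "a \<in> S" "a \<in> LP" using long_simple_exists by blast
  have "Inv (wv a)" using Inv_good[OF assms wv(1)[OF a(2)]] .
  then have "even (Fi \<theta>) \<longleftrightarrow> odd (dgi \<theta>) \<and> col a" using theta_R a wv(2)[OF a(2)] unfolding Inv_def by blast
  moreover have "dgi \<theta> = 2" by (simp add: dgi_def dg_theta)
  ultimately show ?thesis by simp
qed

lemma Fi_theta_diff: "g \<in> P \<Longrightarrow> Fi (\<theta> - g) = Fi \<theta> - Fi g"
  using Fi_diff lat_R theta_R P_R by blast

lemma even_Fi_theta_diff: "g \<in> P \<Longrightarrow> even (Fi (\<theta> - g)) = odd (Fi g)"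
  using Fi_theta_diff[of g] odd_Fi_theta[OF P_theta] by simp

text \<open>Some simple root \<open>a\<close> in the expansion of \<open>y - x\<close> is acute to
  it, so \<open>a\<close> is obtuse to \<open>x\<close> or acute to \<open>y\<close>. Either
  \<open>x + a\<close> is a root, or \<open>y - a\<close> is and the interval gets shorter.\<close>

lemma cover_up:
  assumes "x \<in> P" "y \<in> P" "nonneg_comb S (y - x)" "x \<noteq> y"
  shows "\<exists>a\<in>S. dg a = 0 \<and> x + a \<in> P \<and> nonneg_comb S (y - x - a)"
  using assms
proof (induction "nat \<lfloor>ht (y - x)\<rfloor>" arbitrary: y rule: less_induct)
  case less
  define v where "v = y - x"
  have v: "nonneg_comb S v" "v \<noteq> 0" "dg v = 0"
    using less.prems by (auto simp: v_def dg_diff P_eq)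
  have "0 < v \<bullet> v" using v by simp
  also have "v \<bullet> v = (\<Sum>a\<in>S. cf v a * (a \<bullet> v))" by (rule inner_cf)
  finally have "\<exists>a\<in>S. cf v a * (a \<bullet> v) > 0"
    using sum_nonpos[of S "\<lambda>a. cf v a * (a \<bullet> v)"] by force
  then obtain a where a: "a \<in> S" "cf v a * (a \<bullet> v) > 0" by blast
  have "cf v a \<in> \<nat>" using v(1) a(1) by (simp add: nonneg_comb_iff)
  then have ca: "cf v a \<ge> 1" "a \<bullet> v > 0" using a(2) by (auto elim!: Nats_cases simp: zero_less_mult_iff)
  have da: "dg a = 0" by (rule dg_support[OF v(1,3) a(1)]) (use ca in simp)
  have va: "nonneg_comb S (v - a)"
    unfolding nonneg_comb_iff
  proof
    fix c assume c: "c \<in> S"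
    have "cf v c \<in> \<nat>" using v(1) c by (simp add: nonneg_comb_iff)
    then obtain n where n: "cf v c = of_nat n" by (rule Nats_cases)
    show "cf (v - a) c \<in> \<nat>"
    proof (cases "c = a")
      case True
      then have "n \<ge> 1" using n ca by simp
      then have "cf (v - a) c = of_nat (n - 1)" using n True a(1) by (simp add: cf_diff cf_basis of_nat_diff)
      then show ?thesis by simp
    next
      case False
      then have "cf (v - a) c = of_nat n" using n a(1) by (simp add: cf_diff cf_basis)
      then show ?thesis by simp
    qed
  qed
  have xR: "x \<in> R" "dg x = 1" "y \<in> R" "dg y = 1" using less.prems P_R by auto
  show ?case
  proof (cases "x \<bullet> a < 0")
    case True
    have "x \<noteq> - a" using xR(2) da by (auto simp: dg_minus)
    then have "x + a \<in> R" using add_root[OF xR(1) S_R[OF a(1)]] True by blast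
    then have "x + a \<in> P" using P_R xR da by (simp add: dg_add)
    then show ?thesis using a(1) da va by (auto simp: v_def)
  next
    case False
    have "y \<bullet> a > 0" using False ca(2) by (simp add: v_def inner_diff_right inner_commute)
    moreover have "y \<noteq> a" using xR da by auto
    ultimately have "y - a \<in> R" using diff_root[OF xR(3) S_R[OF a(1)]] by blast
    then have yP: "y - a \<in> P" using P_R xR da by (simp add: dg_diff)
    show ?thesis
    proof (cases "y - a = x")
      case True
      then have "x + a = y" by auto
      then show ?thesis using a(1) da va less.prems(2) by (auto simp: v_def)
    next
      case False
      have nn: "nonneg_comb S (y - a - x)" using va by (simp add: v_def algebra_simps)
      have hts: "ht (y - a - x) = ht (y - x) - 1" using a(1) by (simp add: ht_diff ht_S)
      have "ht (y - a - x) \<ge> 0" by (rule ht_nonneg[OF nn])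
      then have "nat \<lfloor>ht (y - a - x)\<rfloor> < nat \<lfloor>ht (y - x)\<rfloor>" using hts by linarith
      from less.hyps[OF this less.prems(1) yP nn] False
      obtain c where c: "c \<in> S" "dg c = 0" "x + c \<in> P" "nonneg_comb S (y - a - x - c)" by blast
      have "nonneg_comb S ((y - a - x - c) + a)" using c(4) nonneg_comb_add Pos_comb[OF S_Pos[OF a(1)]] by blast
      then have "nonneg_comb S (y - x - c)" by (simp add: algebra_simps)
      then show ?thesis using c by blast
    qed
  qed
qed

lemma Fi_add_simple:
  assumes "x \<in> R" "a \<in> S" "dg a = 0" "x + a \<in> R" shows "Fi (x + a) = Fi x + 1"
proof -
  have "Fi x = Fi (x + a) - Fi a" using Fi_diff[OF lat_R[OF assms(4)] lat_R[OF S_R[OF assms(2)]]] by simp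
  then show ?thesis using Fi_S[OF assms(2)] assms(3) by (simp add: wt_def)
qed

sublocale gp: graded_poset P "root_le S" Fi
proof
  show "finite P" by (rule finite_P)
  show "root_le S x x" for x by (simp add: root_le_def nonneg_comb_0)
  show "x = y" if "root_le S x y" "root_le S y x" for x y
    using nonneg_comb_antisym[of "y - x"] that by (simp add: root_le_def)
  show "root_le S x z" if "root_le S x y" "root_le S y z" for x y z
    using nonneg_comb_add[of "y - x" "z - y"] that by (simp add: root_le_def)
  show up: "\<exists>z\<in>P. root_le S x z \<and> root_le S z y \<and> Fi z = Fi x + 1"
    if xy: "x \<in> P" "y \<in> P" "root_le S x y" "x \<noteq> y" for x y
  proof -
    obtain a where a: "a \<in> S" "dg a = 0" "x + a \<in> P" "nonneg_comb S (y - x - a)"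
      using cover_up[OF xy(1,2) _ xy(4)] xy(3) by (auto simp: root_le_def)
    have "Fi (x + a) = Fi x + 1" by (rule Fi_add_simple) (use a xy P_R in auto)
    moreover have "root_le S x (x + a)" using Pos_comb[OF S_Pos[OF a(1)]] by (simp add: root_le_def)
    moreover have "root_le S (x + a) y" using a(4) by (simp add: root_le_def diff_diff_eq)
    ultimately show ?thesis using a(3) by blast
  qed
  \<comment> \<open>Obtained from the upward case through the order-reversing involution
    \<open>g \<mapsto> \<theta> - g\<close>.\<close>
  show "\<exists>z\<in>P. root_le S x z \<and> root_le S z y \<and> Fi z = Fi y - 1"
    if xy: "x \<in> P" "y \<in> P" "root_le S x y" "x \<noteq> y" for x y
  proof -
    have "root_le S (\<theta> - y) (\<theta> - x)" using xy(3) by (simp add: root_le_def)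
    then obtain z where z: "z \<in> P" "root_le S (\<theta> - y) z" "root_le S z (\<theta> - x)" "Fi z = Fi (\<theta> - y) + 1"
      using up[OF theta_diff_P[OF xy(2)] theta_diff_P[OF xy(1)]] xy(4) by auto
    have "Fi (\<theta> - z) = Fi y - 1" using z(4) Fi_theta_diff[OF z(1)] Fi_theta_diff[OF xy(2)] by simp
    moreover have "root_le S x (\<theta> - z)" "root_le S (\<theta> - z) y"
      using z(2,3) by (simp_all add: root_le_def algebra_simps)
    ultimately show ?thesis using theta_diff_P[OF z(1)] by blast
  qed
  show "Fi x < Fi y" if xy: "x \<in> P" "y \<in> P" "root_le S x y" "x \<noteq> y" for x y
    using xy
  proof (induction "nat \<lfloor>ht (y - x)\<rfloor>" arbitrary: x rule: less_induct)
    case less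
    obtain a where a: "a \<in> S" "dg a = 0" "x + a \<in> P" "nonneg_comb S (y - x - a)"
      using cover_up[OF less.prems(1,2) _ less.prems(4)] less.prems(3) by (auto simp: root_le_def)
    have F: "Fi (x + a) = Fi x + 1" by (rule Fi_add_simple) (use a less.prems P_R in auto)
    show ?case
    proof (cases "x + a = y")
      case True then show ?thesis using F by simp
    next
      case False
      have le: "root_le S (x + a) y" using a(4) by (simp add: root_le_def diff_diff_eq)
      have hts: "ht (y - (x + a)) = ht (y - x) - 1" using a(1) by (simp add: ht_diff ht_add ht_S)
      have "ht (y - (x + a)) \<ge> 0" using le ht_nonneg by (simp add: root_le_def)
      then have "nat \<lfloor>ht (y - (x + a))\<rfloor> < nat \<lfloor>ht (y - x)\<rfloor>" using hts by linarith
      then have "Fi (x + a) < Fi y" using less.hyps a(3) less.prems(2) le False by blast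
      then show ?thesis using F by simp
    qed
  qed
qed

section \<open>Comparison of toggles with duality and with reflections\<close>

lemma root_le_theta_diff: "root_le S (\<theta> - x) (\<theta> - y) = root_le S y x"
  by (simp add: root_le_def)

lemma lt_theta_diff: "gp.lt (\<theta> - x) (\<theta> - y) = gp.lt y x"
  by (auto simp: gp.lt_def root_le_theta_diff)

text \<open>Duality exchanges maximal members with minimal non-members, and the involution behind it
  flips the parity of the rank.\<close>

lemma tau_dual:
  assumes K: "K \<subseteq> P" shows "gp.tau (\<not> e) (dual K) = dual (gp.tau e K)"
proof -
  have inv: "\<theta> - (\<theta> - x) = x" for x by simp
  have "g \<in> gp.tau (\<not> e) (dual K) \<longleftrightarrow> g \<in> dual (gp.tau e K)" if g: "g \<in> P" for g
  proof -
    let ?h = "\<theta> - g"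
    have h: "?h \<in> P" by (rule theta_diff_P[OF g])
    have par: "even (Fi ?h) = odd (Fi g)" by (rule even_Fi_theta_diff[OF g])
    have 1: "(\<exists>g'\<in>dual K. gp.lt g g') \<longleftrightarrow> \<not> (\<forall>h'\<in>P. gp.lt h' ?h \<longrightarrow> h' \<in> K)"
    proof
      assume "\<exists>g'\<in>dual K. gp.lt g g'"
      then obtain g' where g': "g' \<in> P" "\<theta> - g' \<notin> K" "gp.lt g g'" by (auto simp: dual_def)
      then show "\<not> (\<forall>h'\<in>P. gp.lt h' ?h \<longrightarrow> h' \<in> K)"
        using theta_diff_P[OF g'(1)] lt_theta_diff[of g' g] by blast
    next
      assume "\<not> (\<forall>h'\<in>P. gp.lt h' ?h \<longrightarrow> h' \<in> K)"
      then obtain h' where h': "h' \<in> P" "gp.lt h' ?h" "h' \<notin> K" by blast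
      then have "\<theta> - h' \<in> dual K" using theta_diff_P by (simp add: dual_def)
      moreover have "gp.lt g (\<theta> - h')" using h'(2) lt_theta_diff[of ?h h'] by simp
      ultimately show "\<exists>g'\<in>dual K. gp.lt g g'" by blast
    qed
    have 2: "(\<forall>g'\<in>P. gp.lt g' g \<longrightarrow> g' \<in> dual K) \<longleftrightarrow> \<not> (\<exists>h'\<in>K. gp.lt ?h h')"
    proof
      assume *: "\<forall>g'\<in>P. gp.lt g' g \<longrightarrow> g' \<in> dual K"
      show "\<not> (\<exists>h'\<in>K. gp.lt ?h h')"
      proof
        assume "\<exists>h'\<in>K. gp.lt ?h h'"
        then obtain h' where h': "h' \<in> K" "gp.lt ?h h'" by blast
        have "h' \<in> P" using h'(1) K by blast
        then have "\<theta> - h' \<in> P" by (rule theta_diff_P)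
        moreover have "gp.lt (\<theta> - h') g" using h'(2) lt_theta_diff[of h' ?h] by simp
        ultimately have "\<theta> - h' \<in> dual K" using * by blast
        then show False using h'(1) by (simp add: dual_def)
      qed
    next
      assume *: "\<not> (\<exists>h'\<in>K. gp.lt ?h h')"
      show "\<forall>g'\<in>P. gp.lt g' g \<longrightarrow> g' \<in> dual K"
        using * lt_theta_diff by (auto simp: dual_def)
    qed
    have gd: "g \<in> dual K \<longleftrightarrow> ?h \<notin> K" using g by (simp add: dual_def)
    have "g \<in> gp.tau (\<not> e) (dual K) \<longleftrightarrow> (if even (Fi g) = (\<not> e) then
        (if g \<in> dual K then \<exists>g'\<in>dual K. gp.lt g g' else \<forall>g'\<in>P. gp.lt g' g \<longrightarrow> g' \<in> dual K) else g \<in> dual K)"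
      using g by (simp add: gp.tau_def)
    also have "\<dots> \<longleftrightarrow> \<not> (if even (Fi ?h) = e then
        (if ?h \<in> K then \<exists>h'\<in>K. gp.lt ?h h' else \<forall>h'\<in>P. gp.lt h' ?h \<longrightarrow> h' \<in> K) else ?h \<in> K)"
      unfolding 1 2 gd par by auto
    also have "\<dots> \<longleftrightarrow> ?h \<notin> gp.tau e K" using h by (simp add: gp.tau_def)
    also have "\<dots> \<longleftrightarrow> g \<in> dual (gp.tau e K)" using g by (simp add: dual_def)
    finally show ?thesis .
  qed
  moreover have "gp.tau (\<not> e) (dual K) \<subseteq> P" by (auto simp: gp.tau_def)
  ultimately show ?thesis using dual_sub by blast
qed

text \<open>Orthogonal simple reflections fix each other's roots, so each \<open>a\<close> in
  \<open>A\<close> still meets the element that it labelled at the start, and no element carries two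
  labels; \<open>good_step\<close> can be iterated.\<close>

lemma srA_step:
  assumes w: "good w" and e: "\<not> (w \<theta> \<in> S \<and> col (w \<theta>) = e)"
    and A: "A \<subseteq> cls e" "\<And>a. a \<in> A \<Longrightarrow> w \<theta> \<bullet> a \<noteq> 0"
  shows "good (srA A \<circ> w) \<and> Iw (srA A \<circ> w) = {g\<in>P. (g \<in> Iw w) \<noteq> (\<exists>a\<in>A. w g = a \<or> w g = - a)}"
proof -
  have "finite A" by (rule finite_subset[OF A(1) finite_cls])
  then show ?thesis using A
  proof (induction A)
    case empty
    have "srA {} \<circ> w = w" by (simp add: fun_eq_iff)
    then show ?case using w by (auto simp: Iw_def)
  next
    case (insert a A)
    have sub: "A \<subseteq> cls e" and a: "a \<in> cls e" "a \<in> S" "a \<notin> A" using insert cls_S by auto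
    have IH: "good (srA A \<circ> w)" "Iw (srA A \<circ> w) = {g\<in>P. (g \<in> Iw w) \<noteq> (\<exists>a\<in>A. w g = a \<or> w g = - a)}"
    proof -
      have "w \<theta> \<bullet> x \<noteq> 0" if "x \<in> A" for x using insert.prems(2) that by blast
      note IH = insert.IH[OF sub this]
      show "good (srA A \<circ> w)" by (rule IH[THEN conjunct1])
      show "Iw (srA A \<circ> w) = {g\<in>P. (g \<in> Iw w) \<noteq> (\<exists>a\<in>A. w g = a \<or> w g = - a)}" by (rule IH[THEN conjunct2])
    qed
    have fixa: "srA A a = a" by (rule srA_facts(5)[OF sub a(1,3)])
    have "(srA A \<circ> w) \<theta> \<bullet> a = w \<theta> \<bullet> a"
      using srA_facts(3)[OF sub, of "w \<theta>" a] fixa by simp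
    then have n0: "(srA A \<circ> w) \<theta> \<bullet> a \<noteq> 0" using insert.prems(2)[of a] by simp
    have iff: "srA A x = a \<longleftrightarrow> x = a" "srA A x = - a \<longleftrightarrow> x = - a" for x
      using srA_facts(4)[OF sub, of x] fixa srA_facts(2)[OF sub, of a] by metis+
    have ne: "(srA A \<circ> w) \<theta> \<noteq> a"
      using iff(1)[of "w \<theta>"] e a by (auto simp: cls_def)
    note st = good_step[OF IH(1) a(2) n0 ne]
    have comp: "srA (insert a A) \<circ> w = refl_root a \<circ> (srA A \<circ> w)"
      using srA_insert[OF insert.prems(1) a(3)] by (simp add: fun_eq_iff)
    have excl: "\<not> (\<exists>c\<in>A. w g = c \<or> w g = - c)" if "w g = a \<or> w g = - a" for g
    proof
      assume "\<exists>c\<in>A. w g = c \<or> w g = - c"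
      then obtain c where c: "c \<in> A" "w g = c \<or> w g = - c" by blast
      have cS: "c \<in> S" using c(1) sub cls_S by blast
      have "c = a \<or> c = - a" using c(2) that by auto
      then show False
        using c(1) a(3) Pos_not_minus[OF S_Pos[OF a(2)]] S_Pos[OF cS] by auto
    qed
    have "g \<in> Iw (srA (insert a A) \<circ> w) \<longleftrightarrow> g \<in> P \<and> (g \<in> Iw w) \<noteq> (\<exists>c\<in>insert a A. w g = c \<or> w g = - c)" for g
    proof -
      have "g \<in> Iw (srA (insert a A) \<circ> w) \<longleftrightarrow>
          g \<in> P \<and> (g \<in> Iw (srA A \<circ> w)) \<noteq> ((srA A \<circ> w) g = a \<or> (srA A \<circ> w) g = - a)"
        unfolding comp by (subst st(2)) (rule mem_Collect_eq)
      moreover have "g \<in> Iw (srA A \<circ> w) \<longleftrightarrow> g \<in> P \<and> (g \<in> Iw w) \<noteq> (\<exists>c\<in>A. w g = c \<or> w g = - c)"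
        by (subst IH(2)) (rule mem_Collect_eq)
      moreover have "(srA A \<circ> w) g = a \<longleftrightarrow> w g = a" "(srA A \<circ> w) g = - a \<longleftrightarrow> w g = - a"
        unfolding o_apply by (rule iff)+
      moreover note excl[of g]
      ultimately show ?thesis by blast
    qed
    then have "Iw (srA (insert a A) \<circ> w) = {g\<in>P. (g \<in> Iw w) \<noteq> (\<exists>c\<in>insert a A. w g = c \<or> w g = - c)}"
      by blast
    moreover have "good (srA (insert a A) \<circ> w)" unfolding comp by (rule st(1))
    ultimately show ?case by blast
  qed
qed

lemma max_removable:
  assumes K: "K \<in> J" and g: "g \<in> K" and max: "\<not> (\<exists>g'\<in>K. gp.lt g g')" shows "K - {g} \<in> J"
proof (rule JI)
  fix x y assume x: "x \<in> K - {g}" and y: "y \<in> P" and le: "nonneg_comb S (x - y)"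
  have "y \<in> K" using J_down[OF K _ y le] x by blast
  moreover have "y \<noteq> g" using max x le by (auto simp: gp.lt_def root_le_def)
  ultimately show "y \<in> K - {g}" by simp
qed (use J_sub[OF K] in auto)

lemma min_addable:
  assumes K: "K \<in> J" and g: "g \<in> P" and min: "\<forall>g'\<in>P. gp.lt g' g \<longrightarrow> g' \<in> K" shows "insert g K \<in> J"
proof (rule JI)
  fix x y assume x: "x \<in> insert g K" and y: "y \<in> P" and le: "nonneg_comb S (x - y)"
  show "y \<in> insert g K"
  proof (cases "x = g")
    case True
    then show ?thesis using min y le by (auto simp: gp.lt_def root_le_def)
  next
    case False
    then show ?thesis using J_down[OF K _ y le] x by blast
  qed
qed (use J_sub[OF K] g in auto)

lemma theta_neq_twice: "g \<in> P \<Longrightarrow> \<theta> - g \<noteq> g"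
proof
  assume g: "g \<in> P" and "\<theta> - g = g"
  then have "2 *\<^sub>R g = \<theta>" by (simp add: scaleR_2 algebra_simps)
  then have "2 = (1::real) \<or> 2 = (-1::real)" using scale_R[of g 2] g P_R theta_R by auto
  then show False by simp
qed

text \<open>A label makes the ideal with \<open>g\<close> switched an ideal again, so
  \<open>g\<close> is maximal inside or minimal outside. Conversely \<open>removable_simple\<close>
  and \<open>addable_simple\<close> produce the label, provided the enlarged ideal is
  abelian.\<close>

lemma label_of_toggle:
  assumes w: "good w" and e: "\<not> (w \<theta> \<in> S \<and> col (w \<theta>) = e)"
    and g: "g \<in> P" and par: "even (Fi g) = e"
  shows "g \<in> gp.tau e (Iw w) \<longleftrightarrow> (g \<in> Iw w) \<noteq> (\<exists>a\<in>S. w g = a \<or> w g = - a)"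
proof -
  note W = good_Wg[OF w]
  have inn: "w \<theta> \<bullet> w g \<noteq> 0"
    using g dg_eq_0_iff[of g] Wg_inner[OF W] by (simp add: P_R inner_commute)
  have toggle: "Iw (refl_root a \<circ> w) \<in> J"
      "Iw (refl_root a \<circ> w) = (if g \<in> Iw w then Iw w - {g} else insert g (Iw w))"
    if a: "a \<in> S" "w g = a \<or> w g = - a" for a
  proof -
    have n0: "w \<theta> \<bullet> a \<noteq> 0" using inn a(2) by auto
    have "col a = e" using label_parity[OF w g a] par by simp
    then have ne: "w \<theta> \<noteq> a" using e a(1) by auto
    note st = good_step[OF w a(1) n0 ne]
    show "Iw (refl_root a \<circ> w) \<in> J" by (rule Iw_J[OF st(1)])
    obtain u where u: "u \<in> Wg" "\<And>x. u (w x) = x" "\<And>x. w (u x) = x" using Wg_inv[OF W] by blast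
    have uniq: "h = g" if h: "h \<in> P" "w h = a \<or> w h = - a" for h
    proof -
      have "w h = w g \<or> w h = - w g" using h(2) a(2) by auto
      then have "w h = w g \<or> w h = w (- g)" by (simp add: Wg_minus[OF W])
      then have "h = g \<or> h = - g" using u(2) by metis
      then show ?thesis using P_Pos[OF h(1)] Pos_not_minus[OF P_Pos[OF g]] by blast
    qed
    have "Iw (refl_root a \<circ> w) = {h\<in>P. (h \<in> Iw w) \<noteq> (h = g)}"
      unfolding st(2) using uniq a(2) by blast
    also have "\<dots> = (if g \<in> Iw w then Iw w - {g} else insert g (Iw w))"
    proof -
      have "Iw w \<subseteq> P" by (auto simp: Iw_def)
      then show ?thesis using g by auto
    qed
    finally show "Iw (refl_root a \<circ> w) = (if g \<in> Iw w then Iw w - {g} else insert g (Iw w))" .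
  qed
  show ?thesis
  proof (cases "g \<in> Iw w")
    case True
    have "(\<exists>g'\<in>Iw w. gp.lt g g') \<longleftrightarrow> \<not> (\<exists>a\<in>S. w g = a \<or> w g = - a)"
    proof
      assume "\<exists>g'\<in>Iw w. gp.lt g g'"
      then obtain g' where g': "g' \<in> Iw w" "gp.lt g g'" by blast
      show "\<not> (\<exists>a\<in>S. w g = a \<or> w g = - a)"
      proof
        assume "\<exists>a\<in>S. w g = a \<or> w g = - a"
        then have "Iw w - {g} \<in> J" using toggle True by auto
        moreover have "g' \<in> Iw w - {g}" "nonneg_comb S (g' - g)" using g' by (auto simp: gp.lt_def root_le_def)
        ultimately have "g \<in> Iw w - {g}" using J_down g by blast
        then show False by simp
      qed
    next
      assume n: "\<not> (\<exists>a\<in>S. w g = a \<or> w g = - a)"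
      show "\<exists>g'\<in>Iw w. gp.lt g g'"
      proof (rule ccontr)
        assume "\<not> ?thesis"
        then have "- w g \<in> S"
          using removable_simple[OF w True max_removable[OF Iw_J[OF w] True]] by blast
        then show False using n by (metis minus_minus)
      qed
    qed
    then show ?thesis using True g par by (simp add: gp.tau_def)
  next
    case False
    have "(\<forall>g'\<in>P. gp.lt g' g \<longrightarrow> g' \<in> Iw w) \<longleftrightarrow> (\<exists>a\<in>S. w g = a \<or> w g = - a)"
    proof
      assume "\<exists>a\<in>S. w g = a \<or> w g = - a"
      then have ins: "insert g (Iw w) \<in> J" using toggle False by auto
      show "\<forall>g'\<in>P. gp.lt g' g \<longrightarrow> g' \<in> Iw w"
      proof (intro ballI impI)
        fix g' assume "g' \<in> P" "gp.lt g' g"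
        then have "g' \<in> insert g (Iw w)" "g' \<noteq> g"
          using J_down[OF ins, of g g'] by (auto simp: gp.lt_def root_le_def)
        then show "g' \<in> Iw w" by blast
      qed
    next
      assume min: "\<forall>g'\<in>P. gp.lt g' g \<longrightarrow> g' \<in> Iw w"
      have ins: "insert g (Iw w) \<in> J" by (rule min_addable[OF Iw_J[OF w] g min])
      show "\<exists>a\<in>S. w g = a \<or> w g = - a"
      proof (cases "abel (insert g (Iw w))")
        case True
        then show ?thesis using addable_simple(1)[OF w g False ins] by blast
      next
        \<comment> \<open>This case contradicts the parities. Counting shows that
          \<open>Iw w\<close> is self-dual, so \<open>w \<theta>\<close> is simple, of colour
          different from \<open>e\<close> by hypothesis. Its partner \<open>d\<close> carries a
          label not orthogonal to \<open>w \<theta>\<close>, hence of colour \<open>e\<close>; but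
          the rank of \<open>d\<close> has parity opposite to that of \<open>g\<close>.\<close>
        case nab: False
        define d where "d = \<theta> - g"
        have dP: "d \<in> P" unfolding d_def by (rule theta_diff_P[OF g])
        have sub: "Iw w \<subseteq> P" "insert g (Iw w) \<subseteq> P" using J_sub[OF Iw_J[OF w]] g by auto
        have fin: "finite (Iw w)" using finite_subset[OF sub(1) finite_P] .
        have dI: "d \<in> Iw w"
        proof (rule ccontr)
          assume nd: "d \<notin> Iw w"
          have "\<theta> - x \<notin> insert g (Iw w)" if "x \<in> insert g (Iw w)" for x
          proof (cases "x = g")
            case True
            then show ?thesis using nd theta_neq_twice[OF g] by (simp add: d_def)
          next
            case False
            then have x: "x \<in> Iw w" using that by simp
            have "\<theta> - x \<noteq> g" using x nd by (auto simp: d_def)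
            then show ?thesis using x Iw_abel[OF w] by (auto simp: abel_def)
          qed
          then show False using nab by (auto simp: abel_def)
        qed
        have "abel (dual (insert g (Iw w)))" using abel_or_dual[OF ins] nab by blast
        then have "dual (insert g (Iw w)) \<subseteq> insert g (Iw w)"
          using abel_sub_dual[OF dual_sub, of "insert g (Iw w)"] dual_dual[OF sub(2)] by simp
        moreover have "g \<notin> dual (insert g (Iw w))" using dI by (simp add: dual_def d_def)
        moreover have "d \<notin> dual (insert g (Iw w))" by (simp add: dual_def d_def)
        ultimately have "dual (insert g (Iw w)) \<subseteq> Iw w - {d}" by blast
        then have "card (dual (insert g (Iw w))) \<le> card (Iw w - {d})" using fin by (intro card_mono) auto
        moreover have "Suc (card (Iw w - {d})) = card (Iw w)" by (rule card_Suc_Diff1[OF fin dI])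
        ultimately have "card (dual (insert g (Iw w))) + 1 \<le> card (Iw w)" by linarith
        moreover have "card (dual (insert g (Iw w))) + card (insert g (Iw w)) = card P"
          by (rule card_dual[OF sub(2)])
        moreover have "card (insert g (Iw w)) = Suc (card (Iw w))" using False fin by simp
        moreover have "card (Iw w) \<le> card (dual (Iw w))"
          using abel_sub_dual[OF sub(1) Iw_abel[OF w]] finite_subset[OF dual_sub finite_P] by (intro card_mono)
        moreover have "card (dual (Iw w)) + card (Iw w) = card P" by (rule card_dual[OF sub(1)])
        ultimately have "2 * card (Iw w) = card P" by linarith
        then have sd: "dual (Iw w) = Iw w" using self_dual_iff_card[OF Iw_J[OF w]] by blast
        then have bS: "w \<theta> \<in> S" using self_dual_iff_simple[OF w] by blast
        have "dual (insert g (Iw w)) = dual (Iw w) - {d}" by (auto simp: dual_def d_def)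
        then have "Iw w - {d} \<in> J" using dual_J[OF ins] sd by simp
        then have a: "- w d \<in> S" by (rule removable_simple[OF w dI])
        have "w \<theta> \<bullet> w d = \<theta> \<bullet> d" by (rule Wg_inner[OF W])
        moreover have "d \<bullet> \<theta> > 0" using dP by (simp add: P_R dg_def flip: pair_pos_iff[OF theta_nz])
        ultimately have neg: "w \<theta> \<bullet> (- w d) < 0" by (simp add: inner_commute)
        then have "w \<theta> \<noteq> - w d" by (metis inner_ge_zero not_less)
        then have "col (w \<theta>) \<noteq> col (- w d)" using col[OF bS a] neg by auto
        then have "col (- w d) = e" using e bS by auto
        moreover have "even (Fi d) = col (- w d)" by (rule label_parity[OF w dP a]) simp
        moreover have "even (Fi d) = odd (Fi g)" unfolding d_def by (rule even_Fi_theta_diff[OF g])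
        ultimately show ?thesis using par by simp
      qed
    qed
    then show ?thesis using False g par by (simp add: gp.tau_def)
  qed
qed

lemma Idl_step:
  assumes b: "b \<in> LP" and e: "\<not> (b \<in> S \<and> col b = e)"
  shows "sr e b \<in> LP" "Idl (sr e b) = gp.tau e (Idl b)"
proof -
  define w where "w = wv b"
  have w: "good w" "w \<theta> = b" using wv[OF b] by (auto simp: w_def)
  note W = good_Wg[OF w(1)]
  have e': "\<not> (w \<theta> \<in> S \<and> col (w \<theta>) = e)" using e w(2) by simp
  \<comment> \<open>Reflections orthogonal to \<open>b\<close> are dropped: they fix
    \<open>b\<close>, and by uniqueness composing with one of them would not give a good
    element.\<close>
  define A where "A = {a\<in>cls e. b \<bullet> a \<noteq> 0}"
  have srA: "srA A b = sr e b"
  proof -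
    have "(\<Sum>a\<in>cls e. pair b a *\<^sub>R a) = (\<Sum>a\<in>A. pair b a *\<^sub>R a)"
      by (rule sum.mono_neutral_right) (use finite_cls in \<open>auto simp: A_def pair_def\<close>)
    then show ?thesis by (simp add: sr_def srA_def)
  qed
  have "A \<subseteq> cls e" "\<And>a. a \<in> A \<Longrightarrow> w \<theta> \<bullet> a \<noteq> 0" using w(2) by (auto simp: A_def)
  note st = srA_step[OF w(1) e' this]
  have th: "(srA A \<circ> w) \<theta> = sr e b" using srA w(2) by simp
  show "sr e b \<in> LP" using good_LP[of "srA A \<circ> w"] st th by metis
  have "Idl (sr e b) = Iw (srA A \<circ> w)" using Idl_good[of "srA A \<circ> w"] st th by metis
  also have "\<dots> = {g\<in>P. (g \<in> Iw w) \<noteq> (\<exists>a\<in>A. w g = a \<or> w g = - a)}" using st by blast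
  also have "\<dots> = gp.tau e (Iw w)"
  proof -
    have "(g \<in> Iw w) \<noteq> (\<exists>a\<in>A. w g = a \<or> w g = - a) \<longleftrightarrow> g \<in> gp.tau e (Iw w)" if g: "g \<in> P" for g
    proof (cases "even (Fi g) = e")
      case True
      have "(\<exists>a\<in>A. w g = a \<or> w g = - a) \<longleftrightarrow> (\<exists>a\<in>S. w g = a \<or> w g = - a)"
      proof
        assume "\<exists>a\<in>S. w g = a \<or> w g = - a"
        then obtain a where a: "a \<in> S" "w g = a \<or> w g = - a" by blast
        have "col a = e" using label_parity[OF w(1) g a] True by simp
        moreover have "w \<theta> \<bullet> w g \<noteq> 0"
          using g dg_eq_0_iff[of g] Wg_inner[OF W] by (simp add: P_R inner_commute)
        then have "b \<bullet> a \<noteq> 0" using a(2) w(2) by auto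
        ultimately show "\<exists>a\<in>A. w g = a \<or> w g = - a" using a by (auto simp: A_def cls_def)
      qed (use cls_S in \<open>auto simp: A_def\<close>)
      then show ?thesis using label_of_toggle[OF w(1) e' g True] by simp
    next
      case False
      have "\<not> (\<exists>a\<in>A. w g = a \<or> w g = - a)"
      proof
        assume "\<exists>a\<in>A. w g = a \<or> w g = - a"
        then obtain a where a: "a \<in> A" "w g = a \<or> w g = - a" by blast
        then have "a \<in> S" "col a = e" by (auto simp: A_def cls_def)
        then show False using label_parity[OF w(1) g _ a(2)] False by simp
      qed
      then show ?thesis using False g by (simp add: gp.tau_def)
    qed
    moreover have "gp.tau e (Iw w) \<subseteq> P" by (auto simp: gp.tau_def)
    ultimately show ?thesis by blast
  qed
  finally show "Idl (sr e b) = gp.tau e (Idl b)" by (simp add: Idl_def w_def)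
qed

end

section \<open>Orbits of the reverse operator\<close>

lemma funpow_commute: "(f ^^ m) ((f ^^ n) x) = (f ^^ n) ((f ^^ m) x)"
  by (metis add.commute comp_apply funpow_add)

context coloured_root_system
begin

definition psi :: "'a set \<times> bool \<Rightarrow> 'a set \<times> bool" where
  "psi s = (gp.tau (snd s) (fst s), \<not> snd s)"

text \<open>Duality exchanges the two classes of toggles, so the colour must flip along with it for
  \<open>DD\<close> to commute with \<open>psi\<close>.\<close>

definition DD :: "'a set \<times> bool \<Rightarrow> 'a set \<times> bool" where
  "DD s = (dual (fst s), \<not> snd s)"

definition ideal_start :: "'a \<Rightarrow> 'a set \<times> bool" where
  "ideal_start a = (Idl a, \<not> col a)"

definition image_state :: "'a \<times> bool \<Rightarrow> 'a set \<times> bool" where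
  "image_state s = (Idl (fst s), snd s)"

lemma psi_J: "fst s \<in> J \<Longrightarrow> fst ((psi ^^ n) s) \<in> J"
  by (induction n) (simp_all add: psi_def gp.tau_JJ)

lemma psi_DD: "fst s \<in> J \<Longrightarrow> (psi ^^ n) (DD s) = DD ((psi ^^ n) s)"
proof (induction n)
  case (Suc n)
  have "fst ((psi ^^ n) s) \<subseteq> P" using J_sub[OF psi_J[OF Suc.prems]] .
  then have "psi (DD ((psi ^^ n) s)) = DD (psi ((psi ^^ n) s))"
    using tau_dual[of "fst ((psi ^^ n) s)" "snd ((psi ^^ n) s)"] by (simp add: psi_def DD_def)
  then show ?case using Suc by simp
qed simp

lemma DD_DD: "fst s \<in> J \<Longrightarrow> DD (DD s) = s"
  using dual_dual[OF J_sub] by (simp add: DD_def)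

lemma phi_LP_norm: "fst ((phi ^^ n) s) \<bullet> fst ((phi ^^ n) s) = fst s \<bullet> fst s"
  by (induction n) (simp_all add: phi_def sr_inner)

lemma walk_LP:
  assumes a: "a \<in> S" "a \<in> LP" and t: "t < hh" shows "fst ((phi ^^ t) (start a)) \<in> LP"
  using walk(2)[OF a(1) t] phi_LP_norm[of t "start a"] a(2) by (simp add: LP_def start_def)

lemma psi_walk:
  assumes a: "a \<in> S" "a \<in> LP" shows "t < hh \<Longrightarrow> (psi ^^ t) (ideal_start a) = image_state ((phi ^^ t) (start a))"
proof (induction t)
  case 0
  show ?case by (simp add: ideal_start_def image_state_def start_def)
next
  case (Suc t)
  let ?s = "(phi ^^ t) (start a)"
  have LP: "fst ?s \<in> LP" using walk_LP[OF a] Suc.prems by simp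
  have "\<not> (fst ?s \<in> S \<and> col (fst ?s) = snd ?s)" using walk(3)[OF a(1) Suc.prems] by blast
  then have "Idl (sr (snd ?s) (fst ?s)) = gp.tau (snd ?s) (Idl (fst ?s))" by (rule Idl_step(2)[OF LP])
  then have "psi (image_state ?s) = image_state (phi ?s)"
    by (simp add: psi_def image_state_def phi_def)
  then show ?case using Suc by simp
qed

lemma ideal_start_J: "a \<in> LP \<Longrightarrow> fst (ideal_start a) \<in> J"
  by (simp add: ideal_start_def Idl_J)

text \<open>The walk from \<open>a\<close> ends at a simple root \<open>b\<close>; reversing time shows that the walk from
  \<open>b\<close> ends at \<open>a\<close>, so that two walks close up to one orbit.\<close>

lemma walk_partner:
  assumes a: "a \<in> S" "a \<in> LP"
  obtains b where "b \<in> S" "b \<in> LP" "(psi ^^ (hh - 1)) (ideal_start a) = DD (ideal_start b)"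
    "(psi ^^ (hh - 1)) (ideal_start b) = DD (ideal_start a)"
proof -
  have lt: "hh - 1 < hh" using walk(1) by simp
  obtain b where b: "b \<in> S" "(phi ^^ (hh - 1)) (start a) = rho (start b)" using walk(4)[OF a(1)] by blast
  have bLP: "b \<in> LP" using walk_LP[OF a lt] b(2) by (simp add: rho_def start_def)
  have "(phi ^^ (hh - 1)) (rho ((phi ^^ (hh - 1)) (start a))) = rho (start a)" by (rule phi_reversal)
  then have ret: "(phi ^^ (hh - 1)) (start b) = rho (start a)" unfolding b(2) by simp
  \<comment> \<open>At a simple root the ideal is self-dual, so time reversal of the root state and
    duality of the ideal state coincide. Here the half-step of the sign change disappears.\<close>
  have img: "image_state (rho (start c)) = DD (ideal_start c)" if "c \<in> S" "c \<in> LP" for c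
    using Idl_self_dual[OF that(2)] that(1) by (simp add: image_state_def rho_def start_def DD_def ideal_start_def)
  show ?thesis
  proof (rule that[OF b(1) bLP])
    show "(psi ^^ (hh - 1)) (ideal_start a) = DD (ideal_start b)"
      using psi_walk[OF a lt] b(2) img[OF b(1) bLP] by simp
    show "(psi ^^ (hh - 1)) (ideal_start b) = DD (ideal_start a)"
      using psi_walk[OF b(1) bLP lt] ret img[OF a] by simp
  qed
qed

definition n2 :: nat where "n2 = 2 * (hh - 1)"

lemma n2: "n2 > 0" "hh \<le> n2" "n2 = (hh - 1) + (hh - 1)"
  using walk(1) by (auto simp: n2_def)

lemma psi_period_start:
  assumes a: "a \<in> S" "a \<in> LP" shows "(psi ^^ n2) (ideal_start a) = ideal_start a"
proof -
  obtain b where b: "b \<in> S" "b \<in> LP" "(psi ^^ (hh - 1)) (ideal_start a) = DD (ideal_start b)"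
    "(psi ^^ (hh - 1)) (ideal_start b) = DD (ideal_start a)" using walk_partner[OF a] .
  have "(psi ^^ n2) (ideal_start a) = (psi ^^ (hh - 1)) ((psi ^^ (hh - 1)) (ideal_start a))"
    unfolding n2(3) funpow_add by simp
  also have "\<dots> = DD (DD (ideal_start a))"
    unfolding b(3) psi_DD[OF ideal_start_J[OF b(2)]] b(4) ..
  also have "\<dots> = ideal_start a" by (rule DD_DD[OF ideal_start_J[OF a(2)]])
  finally show ?thesis .
qed

text \<open>Abelian ideals lie on the walks of roots. Any other state is the dual of such a state,
  and duality amounts to a shift by half a period on the orbit of the partner.\<close>

lemma psi_cover:
  assumes K: "fst s \<in> J" shows "\<exists>a\<in>S \<inter> LP. \<exists>t<n2. (psi ^^ t) (ideal_start a) = s"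
proof -
  have ab: "\<exists>a\<in>S \<inter> LP. \<exists>t<hh. (psi ^^ t) (ideal_start a) = r" if rJ: "fst r \<in> J" and ab: "abel (fst r)" for r
  proof -
    obtain b where b: "b \<in> LP" "Idl b = fst r" using Idl_surj[OF rJ ab] by blast
    have "(b, snd r) \<in> Pos \<times> UNIV" using b(1) by (simp add: LP_def)
    also have "Pos \<times> UNIV = (\<lambda>(a, t). (phi ^^ t) (start a)) ` (S \<times> {..<hh})"
      using walk(5) by (simp add: bij_betw_def)
    finally obtain a t where at: "a \<in> S" "t < hh" "(b, snd r) = (phi ^^ t) (start a)" by auto
    have "a \<bullet> a = b \<bullet> b" using phi_LP_norm[of t "start a"] unfolding at(3)[symmetric] by (simp add: start_def)
    then have aLP: "a \<in> LP" using b(1) S_Pos[OF at(1)] by (simp add: LP_def)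
    have "(psi ^^ t) (ideal_start a) = r"
      using psi_walk[OF at(1) aLP at(2)] b(2) unfolding at(3)[symmetric] by (simp add: image_state_def prod_eq_iff)
    then show ?thesis using at aLP by blast
  qed
  from abel_or_dual[OF K] show ?thesis
  proof
    assume "abel (fst s)"
    then obtain a t where "a \<in> S \<inter> LP" "t < hh" "(psi ^^ t) (ideal_start a) = s" using ab[OF K] by blast
    then show ?thesis using n2(2) by (intro bexI[of _ a] exI[of _ t]) auto
  next
    assume "abel (dual (fst s))"
    then have "abel (fst (DD s))" "fst (DD s) \<in> J" using dual_J[OF K] by (simp_all add: DD_def)
    then obtain a t where at: "a \<in> S \<inter> LP" "t < hh" "(psi ^^ t) (ideal_start a) = DD s" using ab by blast
    obtain b where b: "b \<in> S" "b \<in> LP" "(psi ^^ (hh - 1)) (ideal_start a) = DD (ideal_start b)"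
      "(psi ^^ (hh - 1)) (ideal_start b) = DD (ideal_start a)" using walk_partner[of a] at(1) by blast
    have "s = DD (DD s)" using DD_DD[OF K] by simp
    also have "\<dots> = (psi ^^ t) (DD (ideal_start a))"
      using psi_DD[OF ideal_start_J, of a t] at by simp
    also have "\<dots> = (psi ^^ (t + (hh - 1))) (ideal_start b)" unfolding funpow_add b(4)[symmetric] by simp
    also have "\<dots> = (psi ^^ ((t + (hh - 1)) mod n2)) (ideal_start b)"
      using funpow_mod_period[OF psi_period_start[OF b(1,2)]] by simp
    finally have "s = (psi ^^ ((t + (hh - 1)) mod n2)) (ideal_start b)" .
    moreover have "(t + (hh - 1)) mod n2 < n2" using n2(1) by simp
    ultimately show ?thesis using b(1,2) by blast
  qed
qed

text \<open>In the first half of the period this is injectivity of the walk. In the second half the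
  state is dual to a walk state, so \<open>Idl_dual_eq\<close> places there a simple root about to
  be negated, which does not occur before the walk ends.\<close>

lemma psi_return:
  assumes a: "a \<in> S" "a \<in> LP" and c: "c \<in> S" "c \<in> LP" and t: "t < n2"
    and eq: "(psi ^^ t) (ideal_start a) = ideal_start c"
  shows "t = 0"
proof (cases "t < hh")
  case True
  have "image_state ((phi ^^ t) (start a)) = image_state (start c)"
    using psi_walk[OF a True] eq by (simp add: ideal_start_def image_state_def start_def)
  then have "Idl (fst ((phi ^^ t) (start a))) = Idl c" "snd ((phi ^^ t) (start a)) = (\<not> col c)"
    by (simp_all add: image_state_def start_def)
  then have "(phi ^^ t) (start a) = start c"
    using Idl_inj[OF walk_LP[OF a True] c(2)] by (simp add: start_def prod_eq_iff)
  moreover have "inj_on (\<lambda>(a, t). (phi ^^ t) (start a)) (S \<times> {..<hh})" using walk(5) by (simp add: bij_betw_def)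
  ultimately have "(a, t) = (c, 0)"
    using True a c walk(1) by (auto dest!: inj_onD[of _ _ "(a, t)" "(c, 0)"])
  then show ?thesis by simp
next
  case False
  obtain b where b: "b \<in> S" "b \<in> LP" "(psi ^^ (hh - 1)) (ideal_start a) = DD (ideal_start b)"
    using walk_partner[OF a] by blast
  define r where "r = t - (hh - 1)"
  have r: "t = r + (hh - 1)" "Suc r < hh" "r < hh" "0 < r" using False t n2(3) walk(1) by (auto simp: r_def)
  let ?s = "(phi ^^ r) (start b)"
  have "(psi ^^ t) (ideal_start a) = (psi ^^ r) (DD (ideal_start b))" unfolding r(1) funpow_add using b(3) by simp
  also have "\<dots> = DD (image_state ?s)"
    unfolding psi_DD[OF ideal_start_J[OF b(2)]] psi_walk[OF b(1,2) r(3)] ..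
  finally have "DD (image_state ?s) = ideal_start c" using eq by simp
  then have *: "Idl c = dual (Idl (fst ?s))" "snd ?s = col c" by (auto simp: DD_def image_state_def ideal_start_def)
  have "c = fst ?s" by (rule Idl_dual_eq(1)[OF c(2) walk_LP[OF b(1,2) r(3)] *(1)])
  then have "col (fst ?s) = snd ?s" "fst ?s \<in> S" using *(2) c(1) by auto
  then show ?thesis using walk(3)[OF b(1) r(2)] by blast
qed

lemma psi_period: "fst s \<in> J \<Longrightarrow> (psi ^^ n2) s = s"
proof -
  assume "fst s \<in> J"
  then obtain a t where at: "a \<in> S \<inter> LP" "(psi ^^ t) (ideal_start a) = s" using psi_cover by blast
  have "(psi ^^ n2) s = (psi ^^ t) ((psi ^^ n2) (ideal_start a))"
    unfolding at(2)[symmetric] by (rule funpow_commute)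
  then show ?thesis using psi_period_start at by simp
qed

lemma psi_min_period:
  assumes s: "fst s \<in> J" and k: "0 < k" "k < n2" shows "(psi ^^ k) s \<noteq> s"
proof
  assume eq: "(psi ^^ k) s = s"
  obtain a t where at: "a \<in> S" "a \<in> LP" "t < n2" "(psi ^^ t) (ideal_start a) = s" using psi_cover[OF s] by blast
  have ret: "(psi ^^ (n2 - t)) s = ideal_start a"
  proof -
    have "(psi ^^ (n2 - t)) s = (psi ^^ (n2 - t + t)) (ideal_start a)" unfolding at(4)[symmetric] funpow_add by simp
    then show ?thesis using at(3) psi_period_start[OF at(1,2)] by simp
  qed
  have "(psi ^^ k) (ideal_start a) = (psi ^^ (n2 - t)) ((psi ^^ k) s)"
    unfolding ret[symmetric] by (rule funpow_commute)
  then have "(psi ^^ k) (ideal_start a) = ideal_start a" using eq ret by simp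
  then show False using psi_return[OF at(1,2) at(1,2) k(2)] k(1) by simp
qed

text \<open>Starts and times below \<open>n2\<close> enumerate each pair of an ideal and a colour
  exactly once; the factor 2 cancels.\<close>

lemma card_J: "card J = card (S \<inter> LP) * (hh - 1)"
proof -
  let ?f = "\<lambda>(a, t). (psi ^^ t) (ideal_start a)"
  have "inj_on ?f ((S \<inter> LP) \<times> {..<n2})"
  proof -
    have le: "a = c \<and> t = r" if a: "a \<in> S" "a \<in> LP" and c: "c \<in> S" "c \<in> LP" and t: "t \<le> r" "r < n2"
      and eq: "(psi ^^ t) (ideal_start a) = (psi ^^ r) (ideal_start c)" for a c t r
    proof -
      have "(psi ^^ (n2 - r + t)) (ideal_start a) = (psi ^^ (n2 - r + r)) (ideal_start c)"
        using eq by (simp add: funpow_add)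
      then have e: "(psi ^^ (n2 - r + t)) (ideal_start a) = ideal_start c"
        using t psi_period_start[OF c] by simp
      have "t = r"
      proof (rule ccontr)
        assume "t \<noteq> r"
        then have "n2 - r + t < n2" using t by linarith
        then have "n2 - r + t = 0" using psi_return[OF a c _ e] by blast
        then show False using t by linarith
      qed
      then have "ideal_start a = ideal_start c" using e t psi_period_start[OF a] by simp
      then show ?thesis using Idl_inj[OF a(2) c(2)] \<open>t = r\<close> by (simp add: ideal_start_def)
    qed
    show ?thesis
    proof (rule inj_onI, clarify)
      fix a t c r assume "a \<in> S" "a \<in> LP" "c \<in> S" "c \<in> LP" "t < n2" "r < n2"
        "(psi ^^ t) (ideal_start a) = (psi ^^ r) (ideal_start c)"
      then show "a = c \<and> t = r" using le[of a c t r] le[of c a r t] by (cases "t \<le> r") auto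
    qed
  qed
  moreover have "?f ` ((S \<inter> LP) \<times> {..<n2}) = J \<times> UNIV"
  proof (intro equalityI subsetI)
    fix s assume "s \<in> ?f ` ((S \<inter> LP) \<times> {..<n2})"
    then obtain a t where "a \<in> LP" "s = (psi ^^ t) (ideal_start a)" by auto
    then have "fst s \<in> J" using psi_J[OF ideal_start_J] by simp
    then show "s \<in> J \<times> UNIV" by (simp add: mem_Times_iff)
  next
    fix s :: "'a set \<times> bool" assume "s \<in> J \<times> UNIV"
    then have "fst s \<in> J" by (simp add: mem_Times_iff)
    from psi_cover[OF this] obtain a t where "a \<in> S \<inter> LP" "t < n2" "(psi ^^ t) (ideal_start a) = s" by blast
    then show "s \<in> ?f ` ((S \<inter> LP) \<times> {..<n2})" by (intro image_eqI[of _ _ "(a, t)"]) auto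
  qed
  ultimately have "card (J \<times> (UNIV :: bool set)) = card ((S \<inter> LP) \<times> {..<n2})"
    by (metis card_image)
  then show ?thesis by (simp add: card_cartesian_product n2_def)
qed

lemma psi_TT: "(psi ^^ (2 * m)) (K, True) = ((gp.TT ^^ m) K, True)"
proof (induction m)
  case (Suc m)
  have "psi (psi (K, True)) = (gp.TT K, True)" for K by (simp add: psi_def gp.TT_def)
  then show ?case using Suc by simp
qed simp

lemma TT_period:
  assumes "K \<in> J" shows "(gp.TT ^^ (hh - 1)) K = K"
  using psi_period[of "(K, True)"] assms psi_TT[of "hh - 1" K] by (simp add: n2_def)

lemma TT_min_period:
  assumes "K \<in> J" "0 < k" "k < hh - 1" shows "(gp.TT ^^ k) K \<noteq> K"
  using psi_min_period[of "(K, True)" "2 * k"] assms psi_TT[of k K] by (simp add: n2_def)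

section \<open>Transfer to the reverse operator and its behaviour under duality\<close>

abbreviation "X \<equiv> panyushev P (root_le S)"

lemma hh_pos: "hh - 1 > 0"
  using walk(1) by simp

lemma X_period: "I \<in> J \<Longrightarrow> (X ^^ (hh - 1)) I = I"
  by (rule gp.row_period(1)[OF hh_pos TT_period TT_min_period])

lemma X_min_period: "I \<in> J \<Longrightarrow> 0 < k \<Longrightarrow> k < hh - 1 \<Longrightarrow> (X ^^ k) I \<noteq> I"
  by (rule gp.row_period(2)[OF hh_pos TT_period TT_min_period])

lemma X_orbits:
  shows "Ob \<in> orbits X J \<Longrightarrow> card Ob = hh - 1" and "card (orbits X J) = card (long_simple R S)"
proof -
  have h: "hh - 1 > 0" using walk(1) by simp
  note oc = orbits_count[of J X "hh - 1", OF finite_J gp.row_JJ h X_period X_min_period]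
  show "Ob \<in> orbits X J \<Longrightarrow> card Ob = hh - 1" by (rule oc(1))
  have "(hh - 1) * card (orbits X J) = card J" by (rule oc(2))
  then show "card (orbits X J) = card (long_simple R S)" using card_J h by (simp add: long_simple_eq)
qed

text \<open>Complementing and applying \<open>g \<mapsto> \<theta> - g\<close> exchanges the roles
  of \<open>I\<close> and \<open>X I\<close> in \<open>row_rule\<close>, so \<open>dual I\<close>
  satisfies the rule that characterises the left-hand side.\<close>

lemma X_dual_X:
  assumes I: "I \<in> J" shows "X (dual (X I)) = dual I"
proof (rule gp.row_rule_unique[OF dual_J[OF gp.row_JJ] dual_sub])
  fix g assume g: "g \<in> P"
  define h where "h = \<theta> - g"
  have h: "h \<in> P" "\<theta> - h = g" using theta_diff_P[OF g] by (simp_all add: h_def)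
  have Fd: "Fi (\<theta> - x) = Fi g + k \<longleftrightarrow> Fi x = Fi h - k" if "x \<in> P" for x k
    using Fi_theta_diff[OF that] Fi_theta_diff[OF g] by (auto simp: h_def)
  have 1: "(\<exists>g'\<in>dual I. gp.lt g g' \<and> Fi g' = Fi g + 1) \<longleftrightarrow> (\<exists>h'\<in>P - I. gp.lt h' h \<and> Fi h' = Fi h - 1)"
  proof
    assume "\<exists>g'\<in>dual I. gp.lt g g' \<and> Fi g' = Fi g + 1"
    then obtain g' where g': "g' \<in> P" "\<theta> - g' \<notin> I" "gp.lt g g'" "Fi g' = Fi g + 1" by (auto simp: dual_def)
    have "gp.lt (\<theta> - g') h" unfolding h_def lt_theta_diff by (rule g'(3))
    moreover have "Fi (\<theta> - g') = Fi h - 1" using Fd[OF theta_diff_P[OF g'(1)], of 1] g'(4) by simp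
    ultimately show "\<exists>h'\<in>P - I. gp.lt h' h \<and> Fi h' = Fi h - 1" using theta_diff_P[OF g'(1)] g'(2) by blast
  next
    assume "\<exists>h'\<in>P - I. gp.lt h' h \<and> Fi h' = Fi h - 1"
    then obtain h' where h': "h' \<in> P" "h' \<notin> I" "gp.lt h' h" "Fi h' = Fi h - 1" by blast
    have "gp.lt g (\<theta> - h')" using h'(3) lt_theta_diff[of h h'] by (simp add: h(2))
    moreover have "Fi (\<theta> - h') = Fi g + 1" using Fd[OF h'(1), of 1] h'(4) by simp
    moreover have "\<theta> - h' \<in> dual I" using h'(1,2) theta_diff_P by (simp add: dual_def)
    ultimately show "\<exists>g'\<in>dual I. gp.lt g g' \<and> Fi g' = Fi g + 1" by blast
  qed
  have 2: "(\<forall>g'\<in>P. gp.lt g' g \<longrightarrow> Fi g' = Fi g - 1 \<longrightarrow> g' \<in> dual (X I)) \<longleftrightarrow>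
      \<not> (\<exists>h'\<in>X I. gp.lt h h' \<and> Fi h' = Fi h + 1)"
  proof
    assume *: "\<forall>g'\<in>P. gp.lt g' g \<longrightarrow> Fi g' = Fi g - 1 \<longrightarrow> g' \<in> dual (X I)"
    show "\<not> (\<exists>h'\<in>X I. gp.lt h h' \<and> Fi h' = Fi h + 1)"
    proof
      assume "\<exists>h'\<in>X I. gp.lt h h' \<and> Fi h' = Fi h + 1"
      then obtain h' where h': "h' \<in> X I" "gp.lt h h'" "Fi h' = Fi h + 1" by blast
      have h'P: "h' \<in> P" using h'(1) J_sub[OF gp.row_JJ] by blast
      have "gp.lt (\<theta> - h') g" using h'(2) lt_theta_diff[of h' h] by (simp add: h(2))
      moreover have "Fi (\<theta> - h') = Fi g - 1" using Fd[OF h'P, of "- 1"] h'(3) by simp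
      ultimately have "\<theta> - h' \<in> dual (X I)" using * theta_diff_P[OF h'P] by blast
      then show False using h'(1) by (simp add: dual_def)
    qed
  next
    assume *: "\<not> (\<exists>h'\<in>X I. gp.lt h h' \<and> Fi h' = Fi h + 1)"
    show "\<forall>g'\<in>P. gp.lt g' g \<longrightarrow> Fi g' = Fi g - 1 \<longrightarrow> g' \<in> dual (X I)"
    proof (intro ballI impI)
      fix g' assume g': "g' \<in> P" "gp.lt g' g" "Fi g' = Fi g - 1"
      have "gp.lt h (\<theta> - g')" unfolding h_def lt_theta_diff by (rule g'(2))
      moreover have "Fi (\<theta> - g') = Fi h + 1" using Fd[OF theta_diff_P[OF g'(1)], of "- 1"] g'(3) by simp
      ultimately have "\<theta> - g' \<notin> X I" using * by blast
      then show "g' \<in> dual (X I)" using g'(1) by (simp add: dual_def)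
    qed
  qed
  have gd: "g \<in> dual I \<longleftrightarrow> h \<notin> I" "g \<notin> dual (X I) \<longleftrightarrow> h \<in> X I" using g by (auto simp: dual_def h_def)
  have rr: "h \<in> X I \<longleftrightarrow> (\<exists>h'\<in>X I. gp.lt h h' \<and> Fi h' = Fi h + 1) \<or>
      (h \<notin> I \<and> (\<forall>h'\<in>P. gp.lt h' h \<longrightarrow> Fi h' = Fi h - 1 \<longrightarrow> h' \<in> I))"
    by (rule gp.row_rule[OF I h(1)])
  have low: "h \<notin> I" if "\<exists>h'\<in>P - I. gp.lt h' h \<and> Fi h' = Fi h - 1"
    using that J_down[OF I] by (auto simp: gp.lt_def root_le_def)
  have notabove: "\<not> (\<exists>h'\<in>X I. gp.lt h h' \<and> Fi h' = Fi h + 1)" if nI: "h \<notin> I" and no: "\<not> (\<exists>h'\<in>P - I. gp.lt h' h \<and> Fi h' = Fi h - 1)"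
  proof
    assume "\<exists>h'\<in>X I. gp.lt h h' \<and> Fi h' = Fi h + 1"
    then obtain h' m where h': "h' \<in> P" "gp.lt h h'" "m \<in> minimal_elems (P - I) (root_le S)" "root_le S h' m"
      by (auto simp: panyushev_def)
    have mP: "m \<in> P" using h'(3) by (simp add: minimal_elems_def)
    have "root_le S h m" using gp.le_trans[OF h(1) h'(1) mP _ h'(4)] h'(2) by (simp add: gp.lt_def)
    then have "h = m" using h'(3) h(1) nI by (auto simp: minimal_elems_def)
    then show False using gp.le_antisym[OF h(1) h'(1)] h'(2,4) by (auto simp: gp.lt_def)
  qed
  show "g \<in> dual I \<longleftrightarrow> (\<exists>g'\<in>dual I. gp.lt g g' \<and> Fi g' = Fi g + 1) \<or>
      (g \<notin> dual (X I) \<and> (\<forall>g'\<in>P. gp.lt g' g \<longrightarrow> Fi g' = Fi g - 1 \<longrightarrow> g' \<in> dual (X I)))"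
    unfolding 1 2 gd using rr low notabove by blast
qed

lemma X_pow_J: "I \<in> J \<Longrightarrow> (X ^^ k) I \<in> J"
  by (induction k) (simp_all add: gp.row_JJ)

lemma X_pow_dual: "I \<in> J \<Longrightarrow> (X ^^ k) (dual ((X ^^ k) I)) = dual I"
proof (induction k arbitrary: I)
  case (Suc k)
  have "(X ^^ Suc k) (dual ((X ^^ Suc k) I)) = (X ^^ k) (X (dual (X ((X ^^ k) I))))"
    by (simp add: funpow_swap1)
  also have "\<dots> = (X ^^ k) (dual ((X ^^ k) I))" using X_dual_X[OF X_pow_J[OF Suc.prems]] by simp
  finally show ?case using Suc by simp
qed simp

text \<open>If \<open>I\<close> and \<open>X^k I\<close> are both self-dual, then \<open>X\<close>
  applied \<open>2 k\<close> times fixes \<open>I\<close>; an odd period dividing \<open>2 k\<close>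
  divides \<open>k\<close>.\<close>

lemma self_dual_unique:
  assumes odd: "odd (hh - 1)" and I: "I \<in> J" "dual I = I" and I': "I' \<in> orbit_of X I" "dual I' = I'"
  shows "I' = I"
proof -
  obtain k where k: "I' = (X ^^ k) I" using I'(1) by (auto simp: orbit_of_def)
  have "(X ^^ (k + k)) I = I"
    unfolding funpow_add using X_pow_dual[OF I(1), of k] I(2) I'(2) k by simp
  then have e: "(X ^^ ((k + k) mod (hh - 1))) I = I" using funpow_mod_period[OF X_period[OF I(1)], of "k + k"] by simp
  have "(k + k) mod (hh - 1) = 0"
  proof (rule ccontr)
    assume n: "(k + k) mod (hh - 1) \<noteq> 0"
    have "hh - 1 > 0" using walk(1) by simp
    then have "(k + k) mod (hh - 1) < hh - 1" by simp
    then show False using X_min_period[OF I(1), of "(k + k) mod (hh - 1)"] n e by simp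
  qed
  then have "hh - 1 dvd 2 * k" by (simp add: mult_2 mod_eq_0_iff_dvd)
  moreover have "coprime (hh - 1) 2" using odd by (simp add: coprime_commute)
  ultimately have "hh - 1 dvd k" using coprime_dvd_mult_right_iff by blast
  then have "k mod (hh - 1) = 0" by simp
  then show ?thesis using funpow_mod_period[OF X_period[OF I(1)], of k] k by simp
qed

text \<open>Sending a self-dual ideal to its orbit is injective, and there are as many self-dual
  ideals as orbits, so it is also onto.\<close>

lemma orbit_self_dual:
  assumes odd: "odd (hh - 1)" and Ob: "Ob \<in> orbits X J"
  shows "\<exists>!I. I \<in> Ob \<and> dual I = I"
proof -
  let ?SD = "{K\<in>J. dual K = K}"
  have h: "hh - 1 > 0" using walk(1) by simp
  have fin: "finite (orbits X J)" unfolding orbits_def by (rule finite_imageI[OF finite_J])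
  have "inj_on (orbit_of X) ?SD"
  proof (rule inj_onI)
    fix I I' assume I: "I \<in> ?SD" "I' \<in> ?SD" and eq: "orbit_of X I = orbit_of X I'"
    have "I' \<in> orbit_of X I" unfolding eq by (rule orbit_of_self)
    moreover have "I \<in> J" "dual I = I" "dual I' = I'" using I by blast+
    ultimately show "I = I'" using self_dual_unique[OF odd, of I I'] by simp
  qed
  then have "card (orbit_of X ` ?SD) = card ?SD" by (rule card_image)
  also have "\<dots> = card (orbits X J)" unfolding card_self_dual X_orbits(2) ..
  finally have card_eq: "card (orbit_of X ` ?SD) = card (orbits X J)" .
  have "orbit_of X ` ?SD \<subseteq> orbits X J" unfolding orbits_def by (rule image_mono) blast
  then have "orbit_of X ` ?SD = orbits X J" by (rule card_subset_eq[OF fin _ card_eq])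
  with Ob have "Ob \<in> orbit_of X ` ?SD" by (simp only:)
  then obtain I where O: "Ob = orbit_of X I" and "I \<in> ?SD" by (rule imageE)
  then have I: "I \<in> J" "dual I = I" by simp_all
  show ?thesis
  proof (rule ex1I[of _ I])
    show "I \<in> Ob \<and> dual I = I" unfolding O by (rule conjI[OF orbit_of_self I(2)])
    show "I' = I" if "I' \<in> Ob \<and> dual I' = I'" for I'
      by (rule self_dual_unique[OF odd I]) (use that O in simp_all)
  qed
qed

lemma orbit_middle:
  assumes even: "even (coxeter_number R S)" and Ob: "Ob \<in> orbits X J"
  shows "\<exists>!I. I \<in> Ob \<and> int (card I) = dual_coxeter_number R S - 2"
proof -
  have "even hh" using even hh_coxeter by (metis even_of_nat)
  then have "odd (hh - 1)" using walk(1) by simp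
  note ex1 = orbit_self_dual[OF this Ob]
  have "I \<in> J" if I: "I \<in> Ob" for I
  proof -
    obtain K where K: "K \<in> J" "Ob = orbit_of X K" using Ob unfolding orbits_def by blast
    then obtain k where "I = (X ^^ k) K" using I unfolding orbit_of_def by blast
    then show ?thesis using X_pow_J[OF K(1)] by simp
  qed
  moreover have "int (card I) = dual_coxeter_number R S - 2 \<longleftrightarrow> dual I = I" if "I \<in> J" for I
  proof -
    have "int (card I) = dual_coxeter_number R S - 2 \<longleftrightarrow> 2 * card I = card P"
      unfolding dual_coxeter_number_def using coheight_theta by linarith
    then show ?thesis using self_dual_iff_card[OF that] by simp
  qed
  ultimately have "I \<in> Ob \<and> int (card I) = dual_coxeter_number R S - 2 \<longleftrightarrow> I \<in> Ob \<and> dual I = I" for I by blast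
  then show ?thesis using ex1 by (simp only:)
qed

lemma reverse_operator_orbits:
  "card (orbits X J) = card (long_simple R S)
    \<and> (\<forall>Ob\<in>orbits X J. int (card Ob) = coxeter_number R S - 1)
    \<and> (even (coxeter_number R S) \<longrightarrow> (\<forall>Ob\<in>orbits X J.
          \<exists>!I. I \<in> Ob \<and> int (card I) = dual_coxeter_number R S - 2))"
proof (intro conjI ballI impI)
  show "card (orbits X J) = card (long_simple R S)" by (rule X_orbits(2))
  fix Ob assume Ob: "Ob \<in> orbits X J"
  show "int (card Ob) = coxeter_number R S - 1"
    unfolding X_orbits(1)[OF Ob] hh_coxeter[symmetric] using hh_pos by simp
  assume "even (coxeter_number R S)"
  then show "\<exists>!I. I \<in> Ob \<and> int (card I) = dual_coxeter_number R S - 2" using Ob by (rule orbit_middle)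
qed

end

theorem theorem1p6:
  fixes R S :: "'a::euclidean_space set"
  assumes "root_system R" and "irreducible_rs R" and "simple_system R S"
  defines "P \<equiv> delta1 R S"
      and "X \<equiv> panyushev (delta1 R S) (root_le S)"
      and "h \<equiv> coxeter_number R S"
      and "hs \<equiv> dual_coxeter_number R S"
  shows "card (orbits X (lower_ideals P (root_le S))) = card (long_simple R S)
       \<and> (\<forall>Ob\<in>orbits X (lower_ideals P (root_le S)). int (card Ob) = h - 1)
       \<and> (even h \<longrightarrow> (\<forall>Ob\<in>orbits X (lower_ideals P (root_le S)).
              \<exists>!I. I \<in> Ob \<and> int (card I) = hs - 2))"
proof -
  have based: "based_root_system R S"
    using assms(1-3) by (rule based_root_system.intro)
  obtain col :: "'a \<Rightarrow> bool" where "\<forall>a\<in>S. \<forall>b\<in>S. a \<noteq> b \<longrightarrow> a \<bullet> b \<noteq> 0 \<longrightarrow> col a \<noteq> col b"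
    using based_root_system.colouring_exists[OF based order_refl] by (rule exE)
  then have "coloured_root_system R S col"
    by (intro coloured_root_system.intro[OF based] coloured_root_system_axioms.intro) simp
  then show ?thesis
    unfolding P_def X_def h_def hs_def by (rule coloured_root_system.reverse_operator_orbits)
qed

end
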